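(* Let $R$ be a bounded linear operator on $L^2(\mathbb{R}^d)$. The following are equivalent. (i) $Q_R(\varphi)\in C_0(\mathbb{R}^{2d})$ for some $\varphi\in L^2(\mathbb{R}^d)$ such that $V_\varphi\varphi$ has no zeros. (ii) $g\star R$ is compact for some $g\in W(\mathbb{R}^{2d})$. (iii) $Q_R(\psi)\in C_0(\mathbb{R}^{2d})$ for all $\psi\in L^2(\mathbb{R}^d)$. (iv) $f\star R$ is compact for all $f\in L^1(\mathbb{R}^{2d})$.
   Context: For $z=(x,\omega)\in\mathbb{R}^{2d}$, $(\pi(z)\psi)(t)=e^{2\pi i\omega\cdot t}\psi(t-x)$, $V_\phi\psi(z)=\langle\psi,\pi(z)\phi\rangle_{L^2}$ for $\psi,\phi\in L^2(\mathbb{R}^d)$, and $\alpha_z(R)=\pi(z)R\pi(z)^*$. For $f\in L^1(\mathbb{R}^{2d})$ and $R$ bounded on $L^2(\mathbb{R}^d)$, $f\star R=\int_{\mathbb{R}^{2d}}f(z)\alpha_z(R)\,dz$ (weak integral), a bounded operator. With $P\psi(t)=\psi(-t)$ and $\check{R}=PRP$, and $\psi\otimes\psi$ the rank-one operator $\xi\mapsto\langle\xi,\psi\rangle\psi$, the Cohen's class distribution associated with $R$ is $Q_R(\psi)=(\psi\otimes\psi)\star\check{R}$, where $S\star T(z)=\mathrm{tr}(S\alpha_z(\check{T}))$ for $S$ trace class and $T$ bounded; explicitly $Q_R(\psi)(z)=\langle\alpha_z(R)\psi,\psi\rangle_{L^2}$. $W(\mathbb{R}^{2d})$ is the set of $g\in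 L^1(\mathbb{R}^{2d})$ whose symplectic Fourier transform $\mathcal{F}_\sigma(g)(z)=\int_{\mathbb{R}^{2d}}g(z')e^{-2\pi i\sigma(z,z')}\,dz'$, where $\sigma((x_1,\omega_1),(x_2,\omega_2))=\omega_1\cdot x_2-\omega_2\cdot x_1$, has no zeros. *)

theory Defs
  imports "HOL-Analysis.Analysis"
begin

section \<open>The complex Hilbert space of square-integrable functions\<close>

(* Borel representatives suffice: every Lebesgue measurable function agrees almost everywhere
   with a Borel measurable one. *)
definition square_integrable :: "('a::euclidean_space \<Rightarrow> complex) \<Rightarrow> bool" where
  "square_integrable f \<longleftrightarrow>
     f \<in> borel_measurable lborel \<and> integrable lborel (\<lambda>t. (cmod (f t))\<^sup>2)"

definition L2_rel :: "('a::euclidean_space \<Rightarrow> complex) \<Rightarrow> ('a \<Rightarrow> complex) \<Rightarrow> bool" where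
  "L2_rel f g \<longleftrightarrow> square_integrable f \<and> square_integrable g \<and> (AE t in lborel. f t = g t)"

lemma square_integrable_mult_cnj:
  fixes f g :: "'a::euclidean_space \<Rightarrow> complex"
  assumes "square_integrable f" "square_integrable g"
  shows "integrable lborel (\<lambda>t. f t * cnj (g t))"
proof (rule Bochner_Integration.integrable_bound)
  show "integrable lborel (\<lambda>t. (cmod (f t))\<^sup>2 + (cmod (g t))\<^sup>2)"
    using assms by (auto simp: square_integrable_def)
  have [measurable]: "f \<in> borel_measurable borel" "g \<in> borel_measurable borel"
    using assms by (auto simp: square_integrable_def)
  have "(\<lambda>t. cnj (g t)) \<in> borel_measurable borel"
    by (rule borel_measurable_continuous_on[of cnj]) (auto intro: continuous_intros)
  then show "(\<lambda>t. f t * cnj (g t)) \<in> borel_measurable lborel"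
    by simp
  have "x * y \<le> x\<^sup>2 + y\<^sup>2" for x y :: real
    using sum_squares_bound[of x y] zero_le_power2[of x] zero_le_power2[of y]
    by (cases "x * y \<ge> 0"; linarith)
  then show "AE t in lborel. norm (f t * cnj (g t)) \<le> norm ((cmod (f t))\<^sup>2 + (cmod (g t))\<^sup>2)"
    by (auto simp: norm_mult)
qed

lemma square_integrable_zero: "square_integrable (\<lambda>_. 0)"
  by (simp add: square_integrable_def)

lemma square_integrable_add:
  fixes f g :: "'a::euclidean_space \<Rightarrow> complex"
  assumes "square_integrable f" "square_integrable g"
  shows "square_integrable (\<lambda>t. f t + g t)"
proof -
  have [measurable]: "f \<in> borel_measurable borel" "g \<in> borel_measurable borel"
    using assms by (auto simp: square_integrable_def)
  have "integrable lborel (\<lambda>t. (cmod (f t + g t))\<^sup>2)"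
  proof (rule Bochner_Integration.integrable_bound)
    show "integrable lborel (\<lambda>t. 2 * (cmod (f t))\<^sup>2 + 2 * (cmod (g t))\<^sup>2)"
      using assms by (auto simp: square_integrable_def)
    have "(cmod (x + y))\<^sup>2 \<le> 2 * (cmod x)\<^sup>2 + 2 * (cmod y)\<^sup>2" for x y
    proof -
      have "(cmod (x + y))\<^sup>2 \<le> (cmod x + cmod y)\<^sup>2"
        by (intro power_mono norm_triangle_ineq) auto
      also have "\<dots> \<le> 2 * (cmod x)\<^sup>2 + 2 * (cmod y)\<^sup>2"
        using sum_squares_bound[of "cmod x" "cmod y"] by (simp add: power2_sum)
      finally show ?thesis .
    qed
    then show "AE t in lborel. norm ((cmod (f t + g t))\<^sup>2) \<le> norm (2 * (cmod (f t))\<^sup>2 + 2 * (cmod (g t))\<^sup>2)"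
      by auto
  qed simp
  then show ?thesis by (simp add: square_integrable_def)
qed

lemma square_integrable_cmult:
  "square_integrable f \<Longrightarrow> square_integrable (\<lambda>t. c * f t)"
  by (auto simp: square_integrable_def norm_mult power_mult_distrib)

quotient_type (overloaded) 'a L2 = "'a::euclidean_space \<Rightarrow> complex" / partial: L2_rel
proof (rule part_equivpI)
  show "\<exists>f. L2_rel f (f :: 'a \<Rightarrow> complex)"
    by (rule exI[of _ "\<lambda>_. 0"]) (simp add: L2_rel_def square_integrable_zero)
  show "symp (L2_rel :: ('a \<Rightarrow> complex) \<Rightarrow> _)"
    by (auto simp: symp_def L2_rel_def)
  show "transp (L2_rel :: ('a \<Rightarrow> complex) \<Rightarrow> _)"
    unfolding transp_def L2_rel_def by (auto elim: AE_mp)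
qed

(* Inner product, linear in the first argument. *)
lift_definition cinner :: "('a::euclidean_space) L2 \<Rightarrow> 'a L2 \<Rightarrow> complex"
  is "\<lambda>f g. LINT t|lborel. f t * cnj (g t)"
proof -
  fix f f' g g' :: "'a \<Rightarrow> complex"
  assume *: "L2_rel f f'" "L2_rel g g'"
  then have "integrable lborel (\<lambda>t. f t * cnj (g t))" "integrable lborel (\<lambda>t. f' t * cnj (g' t))"
    by (auto simp: L2_rel_def intro: square_integrable_mult_cnj)
  moreover have "AE t in lborel. f t * cnj (g t) = f' t * cnj (g' t)"
    using * by (auto simp: L2_rel_def)
  ultimately show "(LINT t|lborel. f t * cnj (g t)) = (LINT t|lborel. f' t * cnj (g' t))"
    by (intro integral_cong_AE) auto
qed

lift_definition scaleC :: "complex \<Rightarrow> ('a::euclidean_space) L2 \<Rightarrow> 'a L2" (infixr \<open>*\<^sub>C\<close> 75)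
  is "\<lambda>c f t. c * f t"
  by (auto simp: L2_rel_def intro: square_integrable_cmult)

instantiation L2 :: (euclidean_space) real_vector
begin

lift_definition zero_L2 :: "'a L2" is "\<lambda>_. 0"
  by (simp add: L2_rel_def square_integrable_zero)

lift_definition plus_L2 :: "'a L2 \<Rightarrow> 'a L2 \<Rightarrow> 'a L2" is "\<lambda>f g t. f t + g t"
  by (auto simp: L2_rel_def intro: square_integrable_add)

definition scaleR_L2 :: "real \<Rightarrow> 'a L2 \<Rightarrow> 'a L2" where
  "scaleR_L2 r f = complex_of_real r *\<^sub>C f"

definition uminus_L2 :: "'a L2 \<Rightarrow> 'a L2" where
  "uminus_L2 f = (- 1) *\<^sub>C f"

definition minus_L2 :: "'a L2 \<Rightarrow> 'a L2 \<Rightarrow> 'a L2" where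
  "minus_L2 f g = f + (- g)"

instance
proof
  fix f g h :: "'a L2" and r s :: real
  show "f + g + h = f + (g + h)"
    by transfer (auto simp: L2_rel_def add.assoc intro!: square_integrable_add)
  show "f + g = g + f"
    by transfer (auto simp: L2_rel_def add.commute intro!: square_integrable_add)
  show "0 + f = f"
    by transfer (auto simp: L2_rel_def)
  show "- f + f = 0"
    unfolding uminus_L2_def
    by transfer (auto simp: L2_rel_def square_integrable_zero)
  show "f - g = f + - g"
    by (simp add: minus_L2_def)
  show "r *\<^sub>R (f + g) = r *\<^sub>R f + r *\<^sub>R g"
    unfolding scaleR_L2_def
    by transfer (auto simp: L2_rel_def distrib_left intro!: square_integrable_add square_integrable_cmult)
  show "(r + s) *\<^sub>R f = r *\<^sub>R f + s *\<^sub>R f"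
    unfolding scaleR_L2_def of_real_add
    by transfer (auto simp: L2_rel_def distrib_right intro!: square_integrable_add square_integrable_cmult)
  show "r *\<^sub>R s *\<^sub>R f = (r * s) *\<^sub>R f"
    unfolding scaleR_L2_def of_real_mult
    by transfer (auto simp: L2_rel_def mult.assoc intro!: square_integrable_cmult)
  show "1 *\<^sub>R f = f"
    unfolding scaleR_L2_def of_real_1
    by transfer (auto simp: L2_rel_def)
qed

end

instantiation L2 :: (euclidean_space) real_inner
begin

definition inner_L2 :: "'a L2 \<Rightarrow> 'a L2 \<Rightarrow> real" where
  "inner_L2 f g = Re (cinner f g)"

definition norm_L2 :: "'a L2 \<Rightarrow> real" where
  "norm_L2 f = sqrt (inner f f)"

definition dist_L2 :: "'a L2 \<Rightarrow> 'a L2 \<Rightarrow> real" where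
  "dist_L2 f g = norm (f - g)"

definition sgn_L2 :: "'a L2 \<Rightarrow> 'a L2" where
  "sgn_L2 f = f /\<^sub>R norm f"

definition uniformity_L2 :: "('a L2 \<times> 'a L2) filter" where
  "uniformity_L2 = (INF e\<in>{0<..}. principal {(f, g). dist f g < e})"

definition open_L2 :: "'a L2 set \<Rightarrow> bool" where
  "open_L2 U = (\<forall>f\<in>U. eventually (\<lambda>(f', g). f' = f \<longrightarrow> g \<in> U) uniformity)"

instance
proof
  fix f g h :: "'a L2" and r :: real
  show "sgn f = f /\<^sub>R norm f"
    by (simp add: sgn_L2_def)
  show "dist f g = norm (f - g)"
    by (simp add: dist_L2_def)
  show "uniformity = (INF e\<in>{0<..}. principal {(x, y). dist x (y::'a L2) < e})"
    by (simp add: uniformity_L2_def)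
  show "open U = (\<forall>x\<in>U. \<forall>\<^sub>F (x', y) in uniformity. x' = x \<longrightarrow> y \<in> U)" for U :: "'a L2 set"
    by (simp add: open_L2_def)
  show "inner f g = inner g f"
    unfolding inner_L2_def
  proof transfer
    fix f g :: "'a \<Rightarrow> complex"
    have "(LINT t|lborel. f t * cnj (g t)) = (LINT t|lborel. cnj (g t * cnj (f t)))"
      by (simp add: mult.commute)
    also have "\<dots> = cnj (LINT t|lborel. g t * cnj (f t))"
      by (rule Bochner_Integration.integral_cnj)
    finally show "Re (LINT t|lborel. f t * cnj (g t)) = Re (LINT t|lborel. g t * cnj (f t))"
      by simp
  qed
  have "cinner (f + g) h = cinner f h + cinner g h"
    by transfer
      (auto simp: L2_rel_def distrib_right
         intro!: Bochner_Integration.integral_add square_integrable_mult_cnj)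
  then show "inner (f + g) h = inner f h + inner g h"
    by (simp add: inner_L2_def)
  have "cinner (c *\<^sub>C f) g = c * cinner f g" for c
    by transfer (simp add: mult.assoc)
  then show "inner (r *\<^sub>R f) g = r * inner f g"
    by (simp add: inner_L2_def scaleR_L2_def)
  have sq: "Re (LINT t|lborel. f t * cnj (f t)) = (LINT t|lborel. (cmod (f t))\<^sup>2)"
    for f :: "'a \<Rightarrow> complex"
  proof -
    have "(LINT t|lborel. f t * cnj (f t)) = (LINT t|lborel. complex_of_real ((cmod (f t))\<^sup>2))"
      by (simp only: complex_norm_square)
    then show ?thesis by (simp del: of_real_power)
  qed
  show "0 \<le> inner f f"
    unfolding inner_L2_def by transfer (simp add: sq)
  show "inner f f = 0 \<longleftrightarrow> f = 0"
    unfolding inner_L2_def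
  proof transfer
    fix f :: "'a \<Rightarrow> complex"
    assume "L2_rel f f"
    then have f: "square_integrable f"
      by (simp add: L2_rel_def)
    then have "(LINT t|lborel. (cmod (f t))\<^sup>2) = 0 \<longleftrightarrow> (AE t in lborel. (cmod (f t))\<^sup>2 = 0)"
      by (intro integral_nonneg_eq_0_iff_AE) (auto simp: square_integrable_def)
    then show "Re (LINT t|lborel. f t * cnj (f t)) = 0 \<longleftrightarrow> L2_rel f (\<lambda>_. 0)"
      using f by (simp add: sq L2_rel_def square_integrable_zero)
  qed
  show "norm f = sqrt (inner f f)"
    by (simp add: norm_L2_def)
qed

end

section \<open>Operators on \<open>L\<^sup>2\<close>\<close>

type_synonym 'a L2_op = "'a L2 \<Rightarrow> 'a L2"

definition bounded_clinear :: "('a::euclidean_space) L2_op \<Rightarrow> bool" where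
  "bounded_clinear T \<longleftrightarrow> bounded_linear T \<and> (\<forall>c \<psi>. T (c *\<^sub>C \<psi>) = c *\<^sub>C T \<psi>)"

definition compact_operator :: "('a::euclidean_space) L2_op \<Rightarrow> bool" where
  "compact_operator T \<longleftrightarrow> bounded_clinear T \<and> compact (closure (T ` cball 0 1))"

definition cadjoint :: "('a::euclidean_space) L2_op \<Rightarrow> 'a L2_op" where
  "cadjoint T = (THE S. \<forall>\<psi> \<phi>. cinner (T \<psi>) \<phi> = cinner \<psi> (S \<phi>))"

definition rank_one :: "('a::euclidean_space) L2 \<Rightarrow> 'a L2 \<Rightarrow> 'a L2_op" where
  "rank_one \<psi> \<phi> = (\<lambda>\<xi>. cinner \<xi> \<phi> *\<^sub>C \<psi>)"

definition orthonormal_basis :: "('a::euclidean_space) L2 set \<Rightarrow> bool" where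
  "orthonormal_basis B \<longleftrightarrow>
     (\<forall>e\<in>B. \<forall>e'\<in>B. cinner e e' = (if e = e' then 1 else 0)) \<and>
     (\<forall>\<psi>. (\<forall>e\<in>B. cinner \<psi> e = 0) \<longrightarrow> \<psi> = 0)"

(* Meant for trace class operators, where the sum converges absolutely and does not depend
   on the orthonormal basis. *)
definition trace_op :: "('a::euclidean_space) L2_op \<Rightarrow> complex" where
  "trace_op T = (THE c. \<forall>B. orthonormal_basis B \<longrightarrow> ((\<lambda>e. cinner (T e) e) has_sum c) B)"

section \<open>Time-frequency shifts and the short-time Fourier transform\<close>

lemma lborel_distr_reflect_translate:
  fixes a :: "'a::euclidean_space"
  assumes "\<bar>s\<bar> = (1::real)"
  shows "distr lborel borel (\<lambda>t. a + s *\<^sub>R t) = lborel"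
proof -
  have "s \<noteq> 0" using assms by auto
  from lborel_affine[OF this, of a] assms show ?thesis by (simp add: density_1)
qed

lemma square_integrable_affine:
  fixes f :: "'a::euclidean_space \<Rightarrow> complex"
  assumes "square_integrable f" "\<bar>s\<bar> = (1::real)"
  shows "square_integrable (\<lambda>t. f (a + s *\<^sub>R t))"
proof -
  have [measurable]: "f \<in> borel_measurable borel"
    using assms by (auto simp: square_integrable_def)
  have "integrable (distr lborel borel (\<lambda>t. a + s *\<^sub>R t)) (\<lambda>t. (cmod (f t))\<^sup>2)"
    using assms lborel_distr_reflect_translate[OF assms(2), of a]
    by (simp add: square_integrable_def)
  then have "integrable lborel (\<lambda>t. (cmod (f (a + s *\<^sub>R t)))\<^sup>2)"
    by (subst (asm) integrable_distr_eq) auto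
  then show ?thesis by (simp add: square_integrable_def)
qed

lemma AE_lborel_affine:
  fixes a :: "'a::euclidean_space"
  assumes "AE t in lborel. P t" "\<bar>s\<bar> = (1::real)"
  shows "AE t in lborel. P (a + s *\<^sub>R t)"
proof (rule AE_distrD[where M'=borel and f="\<lambda>t. a + s *\<^sub>R t" and P=P])
  show "(\<lambda>t. a + s *\<^sub>R t) \<in> lborel \<rightarrow>\<^sub>M borel"
    by simp
  show "AE t in distr lborel borel (\<lambda>t. a + s *\<^sub>R t). P t"
    unfolding lborel_distr_reflect_translate[OF assms(2)] by (rule assms(1))
qed

lemma L2_rel_affine:
  fixes a :: "'a::euclidean_space"
  assumes "L2_rel f g" "\<bar>s\<bar> = (1::real)"
  shows "L2_rel (\<lambda>t. f (a + s *\<^sub>R t)) (\<lambda>t. g (a + s *\<^sub>R t))"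
  using assms AE_lborel_affine[of "\<lambda>t. f t = g t" s a]
  by (auto simp: L2_rel_def intro: square_integrable_affine)

lift_definition tf_shift :: "'a \<times> 'a \<Rightarrow> ('a::euclidean_space) L2_op"
  is "\<lambda>(x, \<omega>) \<psi> t. exp (2 * pi * \<i> * (\<omega> \<bullet> t)) * \<psi> (t - x)"
proof -
  fix z :: "'a \<times> 'a" and f g :: "'a \<Rightarrow> complex"
  assume fg: "L2_rel f g"
  obtain x \<omega> where z: "z = (x, \<omega>)" by force
  let ?e = "\<lambda>t. exp (2 * pi * \<i> * (\<omega> \<bullet> t))"
  have cmod: "cmod (?e t) = 1" for t
    by (simp add: norm_exp_eq_Re)
  have [measurable]: "?e \<in> borel_measurable borel"
    by (intro borel_measurable_continuous_onI continuous_intros)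
  have mod: "square_integrable h \<Longrightarrow> square_integrable (\<lambda>t. ?e t * h t)" for h
    by (auto simp: square_integrable_def norm_mult cmod)
  have "L2_rel (\<lambda>t. f (t - x)) (\<lambda>t. g (t - x))"
    using L2_rel_affine[OF fg, of 1 "- x"] by simp
  then have "L2_rel (\<lambda>t. ?e t * f (t - x)) (\<lambda>t. ?e t * g (t - x))"
    unfolding L2_rel_def
    using mod[of "\<lambda>t. f (t - x)"] mod[of "\<lambda>t. g (t - x)"] by auto
  then show "L2_rel ((case z of (x, \<omega>) \<Rightarrow> \<lambda>\<psi> t. exp (2 * pi * \<i> * (\<omega> \<bullet> t)) * \<psi> (t - x)) f)
                    ((case z of (x, \<omega>) \<Rightarrow> \<lambda>\<psi> t. exp (2 * pi * \<i> * (\<omega> \<bullet> t)) * \<psi> (t - x)) g)"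
    by (simp add: z)
qed

definition stft :: "('a::euclidean_space) L2 \<Rightarrow> 'a L2 \<Rightarrow> 'a \<times> 'a \<Rightarrow> complex" where
  "stft \<phi> \<psi> z = cinner \<psi> (tf_shift z \<phi>)"

lift_definition parity :: "('a::euclidean_space) L2_op" is "\<lambda>\<psi> t. \<psi> (- t)"
  subgoal for f g using L2_rel_affine[of f g "- 1" 0] by simp
  done

definition op_shift :: "'a \<times> 'a \<Rightarrow> ('a::euclidean_space) L2_op \<Rightarrow> 'a L2_op" where
  "op_shift z R = tf_shift z \<circ> R \<circ> cadjoint (tf_shift z)"

definition op_check :: "('a::euclidean_space) L2_op \<Rightarrow> 'a L2_op" where
  "op_check R = parity \<circ> R \<circ> parity"

section \<open>Convolutions, Cohen's class and the Wiener class\<close>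

(* The integral over z of f(z) op_shift z R in the weak sense; such an operator is unique, and it
   exists (and is bounded) for integrable f and bounded R by the Riesz representation theorem. *)
definition fun_op_conv ::
    "('a \<times> 'a \<Rightarrow> complex) \<Rightarrow> ('a::euclidean_space) L2_op \<Rightarrow> 'a L2_op" where
  "fun_op_conv f R =
     (THE T. \<forall>\<xi> \<eta>. cinner (T \<xi>) \<eta> = (LINT z|lborel. f z * cinner (op_shift z R \<xi>) \<eta>))"

definition op_op_conv ::
    "('a::euclidean_space) L2_op \<Rightarrow> 'a L2_op \<Rightarrow> 'a \<times> 'a \<Rightarrow> complex" where
  "op_op_conv S T z = trace_op (S \<circ> op_shift z (op_check T))"

(* Explicitly, cohen R psi z = cinner (op_shift z R psi) psi, which comes from
   op_check (op_check R) = R and the trace of a rank-one operator. *)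
definition cohen :: "('a::euclidean_space) L2_op \<Rightarrow> 'a L2 \<Rightarrow> 'a \<times> 'a \<Rightarrow> complex" where
  "cohen R \<psi> = op_op_conv (rank_one \<psi> \<psi>) (op_check R)"

definition C0 :: "('b::real_normed_vector \<Rightarrow> complex) set" where
  "C0 = {F. continuous_on UNIV F \<and> (F \<longlongrightarrow> 0) at_infinity}"

definition symplectic_form :: "('a::euclidean_space) \<times> 'a \<Rightarrow> 'a \<times> 'a \<Rightarrow> real" where
  "symplectic_form z z' = snd z \<bullet> fst z' - snd z' \<bullet> fst z"

definition symplectic_fourier ::
    "('a \<times> 'a \<Rightarrow> complex) \<Rightarrow> ('a::euclidean_space) \<times> 'a \<Rightarrow> complex" where
  "symplectic_fourier g z =
     (LINT z'|lborel. g z' * exp (- (2 * pi * \<i> * symplectic_form z z')))"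

definition wiener_class :: "(('a::euclidean_space) \<times> 'a \<Rightarrow> complex) set" where
  "wiener_class = {g. integrable lborel g \<and> (\<forall>z. symplectic_fourier g z \<noteq> 0)}"

end

(* Conditions on R are tested against sequences: an operator on L^2 is compact iff it maps weakly null
   sequences to norm null ones, and the Moyal identity shows that pi(z_n) phi is weakly null
   when z_n tends to infinity.
   (i) => (ii): for S = phi (x) phi put g = |V_phi phi|^2; its symplectic Fourier transform is again
   |V_phi phi|^2. Moyal's identity gives that g * R is the integral of
   Q_R(phi)(-z) pi(z)phi (x) pi(z)phi, which is compact since Q_R(phi) vanishes at infinity.
   (ii) => (iv): for a weakly null sequence xi_n and T = f * R, the functions
   h_n(z) = <alpha_z(R) xi_n, T xi_n> are bounded and their correlations with g tend to 0 pointwise, so by Wiener's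
   theorem (for bounded sequences of functions) so do those with f; at the origin these are ||T xi_n||^2.
   (iv) => (iii): Q_R(psi) is uniformly continuous, so it is uniformly close to its averages over small
   balls, which are Q_{f * R}(psi) with f * R compact.
   (iii) => (i): V_phi phi has no zeros for a Gaussian phi. *)
theory Submission
  imports Defs "HOL-Probability.Characteristic_Functions" "HOL-Library.Diagonal_Subsequence"
begin

section \<open>Integration on Euclidean spaces\<close>

text \<open>In (ii) => (iv) the functions \<open>h n\<close> contain \<open>T (X n)\<close> and so
  change with \<open>n\<close>, which is why Wiener's theorem is proved for sequences, with limits
  taken pointwise in the translation parameter. Its mechanism is quantitative: on a narrow frequency
  window around \<zeta>, convolution with \<open>g\<close> is replaced by multiplication with the
  constant \<open>fourier g \<zeta>\<close>. The error has \<open>L1\<close> norm at most half of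
  that constant, so every bound on the limsup can be halved. The admissible width depends on \<zeta>
  only through a lower bound for \<open>cmod (fourier g \<zeta>)\<close>; one width therefore serves
  a compact set of frequencies, and an integral over frequencies glues the windows together. The
  other obstacle is that \<open>trace_op\<close> and \<open>fun_op_conv\<close> are definite
  descriptions. Completeness of \<open>L2\<close>, the Riesz representation and Parseval's identity
  are there to show that they denote the intended objects.\<close>

lemma has_bochner_integral_lborel_affine:
  fixes f :: "'a::euclidean_space \<Rightarrow> 'b::{banach, second_countable_topology}"
  assumes "has_bochner_integral lborel f I" "\<bar>s\<bar> = (1::real)"
  shows "has_bochner_integral lborel (\<lambda>t. f (a + s *\<^sub>R t)) I"
proof -
  have [measurable]: "f \<in> borel_measurable borel"
    using assms(1) by (auto dest: borel_measurable_has_bochner_integral)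
  from assms(1) have "has_bochner_integral (distr lborel borel (\<lambda>t. a + s *\<^sub>R t)) f I"
    unfolding lborel_distr_reflect_translate[OF assms(2)] .
  then show ?thesis
    by (simp add: has_bochner_integral_iff integrable_distr_eq integral_distr)
qed

lemma lborel_affine_integrable:
  fixes f :: "'a::euclidean_space \<Rightarrow> 'b::{banach, second_countable_topology}"
  assumes "integrable lborel f" "\<bar>s\<bar> = (1::real)"
  shows "integrable lborel (\<lambda>t. f (a + s *\<^sub>R t))"
  using has_bochner_integral_lborel_affine[OF has_bochner_integral_integrable[OF assms(1)] assms(2)]
  by (simp add: has_bochner_integral_iff)

lemma lborel_affine_integral:
  fixes f :: "'a::euclidean_space \<Rightarrow> 'b::{banach, second_countable_topology}"
  assumes "\<bar>s\<bar> = (1::real)"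
  shows "(LINT t|lborel. f (a + s *\<^sub>R t)) = (LINT t|lborel. f t)"
proof (cases "integrable lborel f")
  case True
  then show ?thesis
    using has_bochner_integral_lborel_affine[OF has_bochner_integral_integrable[OF True] assms]
    by (simp add: has_bochner_integral_iff)
next
  case False
  \<comment> \<open>Integrals of non-integrable functions are 0, so it remains to see that the
    substitution preserves non-integrability: with offset \<open>- s *\<^sub>R a\<close> and the
    same \<open>s\<close> it is undone, because \<open>s * s = 1\<close>.\<close>
  have "\<not> integrable lborel (\<lambda>t. f (a + s *\<^sub>R t))"
  proof
    assume "integrable lborel (\<lambda>t. f (a + s *\<^sub>R t))"
    from lborel_affine_integrable[OF this assms, of "- s *\<^sub>R a"] have "integrable lborel f"
      using assms by (cases "s \<ge> 0") auto
    with False show False ..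
  qed
  with False show ?thesis
    by (simp add: not_integrable_integral_eq)
qed

lemma integrable_translate:
  fixes f :: "'a::euclidean_space \<Rightarrow> 'b::{banach, second_countable_topology}"
  assumes "integrable lborel f"
  shows "integrable lborel (\<lambda>t. f (a + t))" "integrable lborel (\<lambda>t. f (t + a))"
    "integrable lborel (\<lambda>t. f (t - a))" "integrable lborel (\<lambda>t. f (a - t))" "integrable lborel (\<lambda>t. f (- t))"
  using lborel_affine_integrable[OF assms, of 1 a] lborel_affine_integrable[OF assms, of 1 "- a"]
    lborel_affine_integrable[OF assms, of "- 1" a] lborel_affine_integrable[OF assms, of "- 1" 0]
  by (simp_all add: add.commute)

lemma integral_translate:
  fixes f :: "'a::euclidean_space \<Rightarrow> 'b::{banach, second_countable_topology}"
  shows "(LINT t|lborel. f (a + t)) = (LINT t|lborel. f t)" "(LINT t|lborel. f (t + a)) = (LINT t|lborel. f t)"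
    "(LINT t|lborel. f (t - a)) = (LINT t|lborel. f t)" "(LINT t|lborel. f (a - t)) = (LINT t|lborel. f t)"
    "(LINT t|lborel. f (- t)) = (LINT t|lborel. f t)"
  using lborel_affine_integral[of 1 f a] lborel_affine_integral[of 1 f "- a"]
    lborel_affine_integral[of "- 1" f a] lborel_affine_integral[of "- 1" f 0]
  by (simp_all add: add.commute)

lemma integral_dilation:
  fixes f :: "'a::euclidean_space \<Rightarrow> 'b::{banach, second_countable_topology}"
  assumes "integrable lborel f" "c > (0::real)"
  shows "integrable lborel (\<lambda>t. f (c *\<^sub>R t))"
    and "(LINT t|lborel. f (c *\<^sub>R t)) = (1 / c ^ DIM('a)) *\<^sub>R (LINT t|lborel. f t)"
proof -
  have [measurable]: "f \<in> borel_measurable borel"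
    using assms(1) by auto
  have *: "lborel = density (distr lborel borel (\<lambda>x. c *\<^sub>R x)) (\<lambda>_::'a. ennreal (c ^ DIM('a)))"
    using lborel_affine[of c "0::'a"] assms by simp
  have "integrable (density (distr lborel borel (\<lambda>x. c *\<^sub>R x)) (\<lambda>_::'a. ennreal (c ^ DIM('a)))) f"
    using assms(1) by (subst *[symmetric])
  then have "integrable lborel (\<lambda>t. c ^ DIM('a) *\<^sub>R f (c *\<^sub>R t))"
    using assms(2) by (simp add: integrable_density integrable_distr_eq)
  from integrable_scaleR_right[OF this, of "1 / c ^ DIM('a)"] assms(2)
  show int: "integrable lborel (\<lambda>t. f (c *\<^sub>R t))"
    by simp
  have "(LINT t|lborel. f t) = (LINT t|density (distr lborel borel (\<lambda>x. c *\<^sub>R x)) (\<lambda>_::'a. ennreal (c ^ DIM('a))). f t)"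
    by (subst *[symmetric]) simp
  also have "\<dots> = c ^ DIM('a) *\<^sub>R (LINT t|lborel. f (c *\<^sub>R t))"
    using assms(2) by (simp add: integral_density integral_distr)
  finally show "(LINT t|lborel. f (c *\<^sub>R t)) = (1 / c ^ DIM('a)) *\<^sub>R (LINT t|lborel. f t)"
    using assms(2) by simp
qed

text \<open>Tonelli with an explicit majorant: fibrewise integrability and an integrable bound
  \<open>G\<close> on the fibre norms are what later applications can check. The almost-everywhere
  and product forms serve convolutions, whose integrals exist only almost everywhere.\<close>

lemma Fubini_lborel:
  fixes f :: "'a::euclidean_space \<Rightarrow> 'b::euclidean_space \<Rightarrow> 'c::{banach, second_countable_topology}"
  assumes [measurable]: "(\<lambda>(x, y). f x y) \<in> borel_measurable (borel \<Otimes>\<^sub>M borel)"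
    and int: "\<And>x. integrable lborel (f x)"
    and bound: "\<And>x. (LINT y|lborel. norm (f x y)) \<le> G x" and G: "integrable lborel G"
  shows "integrable lborel (\<lambda>x. LINT y|lborel. f x y)"
    and "integrable lborel (\<lambda>y. LINT x|lborel. f x y)"
    and "(LINT x|lborel. LINT y|lborel. f x y) = (LINT y|lborel. LINT x|lborel. f x y)"
    and "AE y in lborel. integrable lborel (\<lambda>x. f x y)"
    and "integrable (lborel \<Otimes>\<^sub>M lborel) (\<lambda>(x, y). f x y)"
proof -
  have [measurable]: "(\<lambda>x. LINT y|lborel. norm (f x y)) \<in> borel_measurable borel"
    by measurable
  have "0 \<le> (LINT y|lborel. norm (f x y))" for x
    by simp
  then have "integrable lborel (\<lambda>x. LINT y|lborel. norm (f x y))"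
    using bound by (intro Bochner_Integration.integrable_bound[OF G]) (auto intro!: AE_I2 intro: order_trans abs_ge_self)
  then have *: "integrable (lborel \<Otimes>\<^sub>M lborel) (\<lambda>(x, y). f x y)"
    using int by (intro lborel_pair.Fubini_integrable) auto
  show "integrable (lborel \<Otimes>\<^sub>M lborel) (\<lambda>(x, y). f x y)" by (rule *)
  show "integrable lborel (\<lambda>x. LINT y|lborel. f x y)"
    using lborel_pair.integrable_fst[OF *] .
  show "integrable lborel (\<lambda>y. LINT x|lborel. f x y)"
    using lborel_pair.integrable_snd[OF *] .
  show "AE y in lborel. integrable lborel (\<lambda>x. f x y)"
    using lborel_pair.AE_integrable_snd[OF *] .
  show "(LINT x|lborel. LINT y|lborel. f x y) = (LINT y|lborel. LINT x|lborel. f x y)"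
    using lborel_pair.Fubini_integral[OF *] by simp
qed

text \<open>\<open>lborel\<close> is the image of a product of one-dimensional Lebesgue measures
  under the coordinates along \<open>Basis\<close>; this brings Gaussian integrals down to the real
  line.\<close>

lemma integral_prod_Basis:
  fixes f :: "'a::euclidean_space \<Rightarrow> real \<Rightarrow> complex"
  assumes "\<And>b. b \<in> Basis \<Longrightarrow> integrable lborel (f b)"
  shows "integrable lborel (\<lambda>x::'a. \<Prod>b\<in>Basis. f b (x \<bullet> b))"
    and "(LINT x|lborel. (\<Prod>b\<in>Basis. f b (x \<bullet> b))) = (\<Prod>b\<in>Basis. LINT t|lborel. f b t)"
proof -
  interpret product_sigma_finite "\<lambda>_::'a. lborel :: real measure" ..
  have m[measurable]: "b \<in> Basis \<Longrightarrow> f b \<in> borel_measurable borel" for b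
    using assms by auto
  have m2[measurable]: "(\<lambda>x::'a. \<Prod>b\<in>Basis. f b (x \<bullet> b)) \<in> borel_measurable borel"
    by measurable
  have eq: "(\<Prod>b\<in>Basis. f b ((\<Sum>b'\<in>Basis. g b' *\<^sub>R b') \<bullet> b)) = (\<Prod>b\<in>Basis. f b (g b))" for g
    by (intro prod.cong) auto
  show "integrable lborel (\<lambda>x::'a. \<Prod>b\<in>Basis. f b (x \<bullet> b))"
    using product_integrable_prod[of Basis f] assms
    by (subst lborel_eq) (simp add: integrable_distr_eq eq)
  show "(LINT x|lborel. (\<Prod>b\<in>Basis. f b (x \<bullet> b))) = (\<Prod>b\<in>Basis. LINT t|lborel. f b t)"
    using product_integral_prod[of Basis f] assms
    by (subst lborel_eq) (simp add: integral_distr eq)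
qed

section \<open>Continuity of translation in \<open>L1\<close>\<close>

text \<open>Openness gives pointwise convergence from one side only: points of \<open>U\<close> stay
  in \<open>U\<close> under small translations, but boundary points may enter. So only the positive
  part \<open>p\<close> is shown to vanish; as both indicators have the same integral, the absolute
  difference integrates to twice \<open>p\<close>.\<close>

lemma translation_continuous_indicator_open:
  fixes U :: "'a::euclidean_space set"
  assumes U: "open U" and fin: "emeasure lborel U < \<infinity>" and x: "x \<longlonglongrightarrow> 0"
  shows "(\<lambda>n. LINT t|lborel. \<bar>indicator U (t - x n) - indicator U t :: real\<bar>) \<longlonglongrightarrow> 0"
proof -
  have [measurable]: "U \<in> sets borel" using U by auto
  have iU: "integrable lborel (indicator U :: _ \<Rightarrow> real)"
    using fin by auto
  define p where "p n t = max 0 (indicator U t - indicator U (t - x n) :: real)" for n t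
  have [measurable]: "p n \<in> borel_measurable borel" for n
    unfolding p_def by measurable
  have ip: "integrable lborel (p n)" for n
    by (rule Bochner_Integration.integrable_bound[OF iU]) (auto simp: p_def split: split_indicator)
  have "(\<lambda>n. LINT t|lborel. p n t) \<longlonglongrightarrow> (LINT t::'a|lborel. 0)"
  proof (rule integral_dominated_convergence[where w="indicator U"])
    show "AE t in lborel. (\<lambda>n. p n t) \<longlonglongrightarrow> 0"
    proof (rule AE_I2)
      fix t
      have "eventually (\<lambda>n. p n t = 0) sequentially"
      proof (cases "t \<in> U")
        case True
        have "(\<lambda>n. t - x n) \<longlonglongrightarrow> t" using tendsto_diff[OF tendsto_const x, of t] by simp
        then have "eventually (\<lambda>n. t - x n \<in> U) sequentially"
          using U True by (auto dest: topological_tendstoD)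
        then show ?thesis by eventually_elim (auto simp: p_def True)
      qed (auto simp: p_def split: split_indicator)
      then show "(\<lambda>n. p n t) \<longlonglongrightarrow> 0" by (rule tendsto_eventually)
    qed
  qed (auto simp: p_def iU split: split_indicator)
  moreover have "(LINT t|lborel. \<bar>indicator U (t - x n) - indicator U t :: real\<bar>) = 2 * (LINT t|lborel. p n t)" for n
  proof -
    have "\<bar>indicator U (t - x n) - indicator U t\<bar> = 2 * p n t + (indicator U (t - x n) - indicator U t)" for t
      by (auto simp: p_def split: split_indicator)
    then have "(LINT t|lborel. \<bar>indicator U (t - x n) - indicator U t :: real\<bar>)
       = (LINT t|lborel. 2 * p n t + (indicator U (t - x n) - indicator U t))"
      by simp
    also have "\<dots> = 2 * (LINT t|lborel. p n t) + ((LINT t|lborel. indicator U (t - x n)) - (LINT t|lborel. indicator U t))"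
      using ip integrable_translate(3)[OF iU, of "x n"] iU by simp
    also have "(LINT t|lborel. indicator U (t - x n) :: real) = (LINT t|lborel. indicator U t)"
      by (rule integral_translate)
    finally show ?thesis by simp
  qed
  ultimately show ?thesis
    by (auto intro: tendsto_mult_right_zero)
qed

text \<open>Induction over integrable functions. Closure under \<open>L1\<close> approximation
  (\<open>approx\<close>) serves twice: for indicators, which outer regularity replaces by
  indicators of open sets, and for limits.\<close>

lemma translation_continuous_L1:
  fixes f :: "'a::euclidean_space \<Rightarrow> 'b::{banach, second_countable_topology}"
  assumes "integrable lborel f" and x: "x \<longlonglongrightarrow> 0"
  shows "(\<lambda>n. LINT t|lborel. norm (f (t - x n) - f t)) \<longlonglongrightarrow> 0"
  using assms(1)
proof induct
  have approx: "(\<lambda>n. LINT t|lborel. norm (f (t - x n) - f t)) \<longlonglongrightarrow> 0"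
    if f: "integrable lborel f"
      and ex: "\<And>e. e > 0 \<Longrightarrow> \<exists>g. integrable lborel g \<and> (LINT t|lborel. norm (f t - g t)) < e \<and>
                (\<lambda>n. LINT t|lborel. norm (g (t - x n) - g t)) \<longlonglongrightarrow> 0" for f :: "'a \<Rightarrow> 'b"
  proof (rule LIMSEQ_I)
    fix r :: real assume "r > 0"
    then obtain g where g: "integrable lborel g" "(LINT t|lborel. norm (f t - g t)) < r / 3"
      and gl: "(\<lambda>n. LINT t|lborel. norm (g (t - x n) - g t)) \<longlonglongrightarrow> 0"
      using ex[of "r / 3"] by auto
    from LIMSEQ_D[OF gl, of "r / 3"] \<open>r > 0\<close> obtain N where
      N: "\<And>n. n \<ge> N \<Longrightarrow> (LINT t|lborel. norm (g (t - x n) - g t)) < r / 3" by auto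
    have fg: "integrable lborel (\<lambda>t. norm (f t - g t))" using f g by auto
    have "norm ((LINT t|lborel. norm (f (t - x n) - f t)) - 0) < r" if "n \<ge> N" for n
    proof -
      have "norm (f (t - x n) - f t) \<le> norm (f (t - x n) - g (t - x n)) + norm (g (t - x n) - g t) + norm (f t - g t)" for t
      proof -
        have *: "a - d = (a - b) + (b - c) - (d - c)" for a b c d :: 'b by simp
        show ?thesis
          by (subst *[of _ _ "g (t - x n)" "g t"])
             (rule order_trans[OF norm_triangle_ineq4 add_right_mono[OF norm_triangle_ineq]])
      qed
      then have "(LINT t|lborel. norm (f (t - x n) - f t)) \<le>
         (LINT t|lborel. norm (f (t - x n) - g (t - x n)) + norm (g (t - x n) - g t) + norm (f t - g t))"
        using integrable_translate(3)[OF f, of "x n"] integrable_translate(3)[OF g(1), of "x n"] f g(1)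
        by (intro integral_mono) auto
      also have "\<dots> = (LINT t|lborel. norm (f (t - x n) - g (t - x n))) + (LINT t|lborel. norm (g (t - x n) - g t))
          + (LINT t|lborel. norm (f t - g t))"
        using integrable_translate(3)[OF f, of "x n"] integrable_translate(3)[OF g(1), of "x n"] f g(1)
        by simp
      also have "(LINT t|lborel. norm (f (t - x n) - g (t - x n))) = (LINT t|lborel. norm (f t - g t))"
        using integral_translate(3)[of "\<lambda>t. norm (f t - g t)" "x n"] by simp
      finally show ?thesis using g(2) N[OF that] by simp
    qed
    then show "\<exists>N. \<forall>n\<ge>N. norm ((LINT t|lborel. norm (f (t - x n) - f t)) - 0) < r" by blast
  qed
  {
    case (base A c)
    then have A[measurable]: "A \<in> sets borel" and fin: "emeasure lborel A < \<infinity>" by auto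
    have iA: "integrable lborel (\<lambda>t. indicator A t *\<^sub>R c)"
      using fin by (auto intro!: integrable_scaleR_left)
    show ?case
    proof (rule approx[OF iA])
      fix e :: real assume "e > 0"
      \<comment> \<open>The added 1 keeps the quotient meaningful when \<open>c = 0\<close>.\<close>
      define e' where "e' = e / (norm c + 1)"
      have e': "e' > 0" using \<open>e > 0\<close> by (simp add: e'_def add_nonneg_pos)
      obtain U where U: "open U" "A \<subseteq> U" "emeasure lborel (U - A) < ennreal e'"
        using outer_regular_lborel[OF A e'] by blast
      have [measurable]: "U \<in> sets borel" using U by auto
      have "emeasure lborel U = emeasure lborel A + emeasure lborel (U - A)"
        using U by (subst plus_emeasure) (auto simp: Un_absorb1)
      also have "\<dots> < \<infinity>" using U(3) fin by (auto simp: less_top[symmetric] ennreal_add_eq_top)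
      finally have finU: "emeasure lborel U < \<infinity>" .
      have iU: "integrable lborel (\<lambda>t. indicator U t *\<^sub>R c)"
        using finU by (auto intro!: integrable_scaleR_left)
      have "(LINT t|lborel. norm (indicator A t *\<^sub>R c - indicator U t *\<^sub>R c)) = (LINT t|lborel. norm c * indicator (U - A) t)"
        using U(2) by (intro Bochner_Integration.integral_cong) (auto split: split_indicator)
      also have "\<dots> = norm c * measure lborel (U - A)" by simp
      also have "\<dots> \<le> norm c * e'"
        using U(3) e' emeasure_eq_ennreal_measure[of lborel "U - A"]
        by (cases "emeasure lborel (U - A) = top") (auto simp: ennreal_less_iff intro!: mult_left_mono)
      also have "\<dots> < e"
        using \<open>e > 0\<close> norm_ge_zero[of c] by (simp add: e'_def divide_less_eq distrib_left add_nonneg_pos not_less)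
      finally have 1: "(LINT t|lborel. norm (indicator A t *\<^sub>R c - indicator U t *\<^sub>R c)) < e" .
      have "(\<lambda>n. norm c * (LINT t|lborel. \<bar>indicator U (t - x n) - indicator U t :: real\<bar>)) \<longlonglongrightarrow> 0"
        by (intro tendsto_mult_right_zero translation_continuous_indicator_open U x finU)
      then have 2: "(\<lambda>n. LINT t|lborel. norm (indicator U (t - x n) *\<^sub>R c - indicator U t *\<^sub>R c)) \<longlonglongrightarrow> 0"
        by (simp add: mult.commute flip: scaleR_left_diff_distrib)
      show "\<exists>g. integrable lborel g \<and> (LINT t|lborel. norm (indicator A t *\<^sub>R c - g t)) < e \<and>
                (\<lambda>n. LINT t|lborel. norm (g (t - x n) - g t)) \<longlonglongrightarrow> 0"
        using iU 1 2 by blast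
    qed
  next
    case (add f g)
    show ?case
    proof (rule tendsto_sandwich[OF _ _ tendsto_const])
      show "(\<lambda>n. (LINT t|lborel. norm (f (t - x n) - f t)) + (LINT t|lborel. norm (g (t - x n) - g t))) \<longlonglongrightarrow> 0"
        using tendsto_add[OF add(2) add(4)] by simp
      show "eventually (\<lambda>n. 0 \<le> (LINT t|lborel. norm (f (t - x n) + g (t - x n) - (f t + g t)))) sequentially"
        by simp
      have *: "norm (a + b - (c + d)) \<le> norm (a - c) + norm (b - d)" for a b c d :: 'b
        by (metis add_diff_add norm_triangle_ineq)
      have "(LINT t|lborel. norm (f (t - x n) + g (t - x n) - (f t + g t))) \<le>
         (LINT t|lborel. norm (f (t - x n) - f t)) + (LINT t|lborel. norm (g (t - x n) - g t))" for n
      proof -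
        have "(LINT t|lborel. norm (f (t - x n) + g (t - x n) - (f t + g t))) \<le>
           (LINT t|lborel. norm (f (t - x n) - f t) + norm (g (t - x n) - g t))"
          using integrable_translate(3)[OF add(1), of "x n"] integrable_translate(3)[OF add(3), of "x n"] add(1,3)
          by (intro integral_mono *) auto
        also have "\<dots> = (LINT t|lborel. norm (f (t - x n) - f t)) + (LINT t|lborel. norm (g (t - x n) - g t))"
          using integrable_translate(3)[OF add(1), of "x n"] integrable_translate(3)[OF add(3), of "x n"] add(1,3)
          by simp
        finally show ?thesis .
      qed
      then show "eventually (\<lambda>n. (LINT t|lborel. norm (f (t - x n) + g (t - x n) - (f t + g t))) \<le>
         (LINT t|lborel. norm (f (t - x n) - f t)) + (LINT t|lborel. norm (g (t - x n) - g t))) sequentially"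
        by simp
    qed
  next
    case (lim f s)
    show ?case
    proof (rule approx[OF lim(5)])
      fix e :: real assume "e > 0"
      have "(\<lambda>n. LINT t|lborel. norm (f t - s n t)) \<longlonglongrightarrow> (LINT t::'a|lborel. 0)"
      \<comment> \<open>The approximants satisfy \<open>norm (s n t) \<le> 2 * norm (f t)\<close>,
        hence the factor 3.\<close>
      proof (rule integral_dominated_convergence[where w="\<lambda>t. 3 * norm (f t)"])
        show "AE t in lborel. (\<lambda>n. norm (f t - s n t)) \<longlonglongrightarrow> 0"
          using lim(3) by (auto intro!: AE_I2 tendsto_eq_intros)
        show "AE t in lborel. norm (norm (f t - s n t)) \<le> 3 * norm (f t)" for n
        proof (rule AE_I2)
          fix t :: 'a
          show "norm (norm (f t - s n t)) \<le> 3 * norm (f t)"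
            using lim(4)[of t n] norm_triangle_ineq4[of "f t" "s n t"] by simp
        qed
      qed (use lim in auto)
      then have "eventually (\<lambda>n. (LINT t|lborel. norm (f t - s n t)) < e) sequentially"
        using \<open>e > 0\<close> by (auto dest: order_tendstoD(2))
      then obtain n where "(LINT t|lborel. norm (f t - s n t)) < e"
        by (auto simp: eventually_sequentially)
      then show "\<exists>g. integrable lborel g \<and> (LINT t|lborel. norm (f t - g t)) < e \<and>
                (\<lambda>n. LINT t|lborel. norm (g (t - x n) - g t)) \<longlonglongrightarrow> 0"
        using lim(1,2) by blast
    qed
  }
qed


section \<open>Gaussians and their Fourier transforms\<close>

text \<open>The characteristic function of the standard normal law, rescaled by
  \<open>c = sqrt (2 * pi)\<close>: this makes \<open>c * std_normal_density (c * x)\<close> equal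
  to \<open>exp (- (pi * x\<^sup>2))\<close> and turns the characteristic function at
  \<open>c * s\<close> into the same Gaussian.\<close>

lemma has_bochner_integral_gaussian_fourier_real:
  "has_bochner_integral lborel (\<lambda>x. exp (2 * pi * \<i> * (s * x)) * exp (- (pi * x\<^sup>2))) (complex_of_real (exp (- (pi * s\<^sup>2))))"
proof -
  define c where "c = sqrt (2 * pi)"
  have c: "c > 0" "c\<^sup>2 = 2 * pi" by (auto simp: c_def)
  have i1: "integrable lborel (\<lambda>x. std_normal_density x *\<^sub>R iexp (c * s * x))"
    by (rule Bochner_Integration.integrable_bound[OF integrable_normal_density[of 1 0]])
       (auto simp: normal_density_nonneg)
  have "(LINT x|std_normal_distribution. iexp (c * s * x)) = complex_of_real (exp (- ((c * s)\<^sup>2) / 2))"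
    using fun_cong[OF char_std_normal_distribution, of "c * s"] by (simp add: char_def)
  then have i2: "(LINT x|lborel. std_normal_density x *\<^sub>R iexp (c * s * x)) = complex_of_real (exp (- (pi * s\<^sup>2)))"
    by (subst (asm) integral_density) (auto simp: normal_density_nonneg c power_mult_distrib)
  have eq: "c *\<^sub>R (std_normal_density (0 + c * x) *\<^sub>R iexp (c * s * (0 + c * x)))
      = exp (2 * pi * \<i> * (s * x)) * exp (- (pi * x\<^sup>2))" for x
  proof -
    have E1: "c * std_normal_density (c * x) = exp (- (pi * x\<^sup>2))"
      using c by (simp add: std_normal_density_def power_mult_distrib c_def[symmetric])
    have E2: "iexp (c * s * (c * x)) = exp (2 * pi * \<i> * (s * x))"
    proof -
      have "c * s * (c * x) = c\<^sup>2 * (s * x)"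
        by (simp add: power2_eq_square)
      then have "c * s * (c * x) = 2 * pi * (s * x)"
        unfolding c(2) .
      then show ?thesis by (simp only:) (simp add: ac_simps)
    qed
    have E3: "a *\<^sub>R (b *\<^sub>R z) = complex_of_real (a * b) * z" for a b z
      by (simp add: scaleR_conv_of_real)
    show ?thesis
      unfolding add_0 E2 E3 E1 by (rule mult.commute)
  qed
  have "has_bochner_integral lborel (\<lambda>x. std_normal_density x *\<^sub>R iexp (c * s * x)) (complex_of_real (exp (- (pi * s\<^sup>2))))"
    using i1 i2 by (simp add: has_bochner_integral_iff)
  then have "has_bochner_integral lborel (\<lambda>x. std_normal_density (0 + c * x) *\<^sub>R iexp (c * s * (0 + c * x))) (complex_of_real (exp (- (pi * s\<^sup>2))) /\<^sub>R \<bar>c\<bar>)"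
    using c by (subst (asm) lborel_has_bochner_integral_real_affine_iff[of c _ _ 0]) auto
  from has_bochner_integral_scaleR_right[OF this, of c] show ?thesis
    unfolding eq using c by simp
qed

text \<open>\<open>c\<close> is an inverse width. With the factor \<open>pi\<close> the function
  \<open>gauss 1\<close> is its own Fourier transform, so no stray constants arise in
  frequency.\<close>

definition gauss :: "real \<Rightarrow> 'a::euclidean_space \<Rightarrow> real" where
  "gauss c t = exp (- (pi * (c * norm t)\<^sup>2))"

lemma gauss_pos: "gauss c t > 0"
  by (simp add: gauss_def)

lemma gauss_measurable[measurable]: "gauss c \<in> borel_measurable borel"
  unfolding gauss_def by measurable

lemma has_bochner_integral_gauss_fourier_1:
  "has_bochner_integral lborel (\<lambda>t::'a::euclidean_space. exp (2 * pi * \<i> * (s \<bullet> t)) * gauss 1 t) (complex_of_real (gauss 1 s))"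
proof -
  let ?f = "\<lambda>b x. exp (2 * pi * \<i> * ((s \<bullet> b) * x)) * complex_of_real (exp (- (pi * x\<^sup>2)))"
  note * = has_bochner_integral_gaussian_fourier_real
  have int: "integrable lborel (?f b)" for b :: 'a
    using *[of "s \<bullet> b"] by (simp add: has_bochner_integral_iff)
  have prod: "(\<Prod>b\<in>Basis. ?f b (t \<bullet> b)) = exp (2 * pi * \<i> * (s \<bullet> t)) * gauss 1 t" for t :: 'a
  proof -
    have "(\<Prod>b\<in>Basis. ?f b (t \<bullet> b)) = (\<Prod>b\<in>Basis. exp (2 * pi * \<i> * ((s \<bullet> b) * (t \<bullet> b)))) * (\<Prod>b\<in>Basis. complex_of_real (exp (- (pi * (t \<bullet> b)\<^sup>2))))"
      by (simp add: prod.distrib)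
    also have "(\<Prod>b\<in>Basis. exp (2 * pi * \<i> * ((s \<bullet> b) * (t \<bullet> b)))) = exp (2 * pi * \<i> * (s \<bullet> t))"
      by (simp add: exp_sum[symmetric] euclidean_inner[of s t] sum_distrib_left)
    also have "(\<Prod>b\<in>Basis. complex_of_real (exp (- (pi * (t \<bullet> b)\<^sup>2)))) = complex_of_real (exp (\<Sum>b\<in>Basis. - (pi * (t \<bullet> b)\<^sup>2)))"
      by (simp add: exp_sum)
    also have "(\<Sum>b\<in>Basis. - (pi * (t \<bullet> b)\<^sup>2)) = - (pi * (1 * norm t)\<^sup>2)"
      by (simp add: sum_negf sum_distrib_left power2_norm_eq_inner euclidean_inner[of t t] flip: power2_eq_square)
    finally show ?thesis by (simp add: gauss_def)
  qed
  have "(LINT t|lborel. exp (2 * pi * \<i> * (s \<bullet> t)) * gauss 1 t) = (\<Prod>b\<in>Basis. complex_of_real (exp (- (pi * (s \<bullet> b)\<^sup>2))))"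
    using integral_prod_Basis(2)[of ?f, OF int] * unfolding prod by (simp add: has_bochner_integral_iff)
  also have "\<dots> = complex_of_real (exp (\<Sum>b\<in>Basis. - (pi * (s \<bullet> b)\<^sup>2)))"
    by (simp add: exp_sum)
  also have "(\<Sum>b\<in>Basis. - (pi * (s \<bullet> b)\<^sup>2)) = - (pi * (1 * norm s)\<^sup>2)"
    by (simp add: sum_negf sum_distrib_left power2_norm_eq_inner euclidean_inner[of s s] flip: power2_eq_square)
  finally show ?thesis
    using integral_prod_Basis(1)[of ?f, OF int] unfolding prod by (simp add: has_bochner_integral_iff gauss_def)
qed

lemma has_bochner_integral_gauss_fourier:
  assumes "c > 0"
  shows "has_bochner_integral lborel (\<lambda>t::'a::euclidean_space. exp (2 * pi * \<i> * (s \<bullet> t)) * gauss c t)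
     (complex_of_real (gauss (1 / c) s / c ^ DIM('a)))"
proof -
  note * = has_bochner_integral_gauss_fourier_1[of "s /\<^sub>R c"]
  have "exp (2 * pi * \<i> * ((s /\<^sub>R c) \<bullet> (c *\<^sub>R t))) * gauss 1 (c *\<^sub>R t) = exp (2 * pi * \<i> * (s \<bullet> t)) * gauss c t" for t :: 'a
  proof -
    have "(s /\<^sub>R c) \<bullet> (c *\<^sub>R t) = s \<bullet> t" using assms by simp
    then show ?thesis using assms by (simp only: gauss_def norm_scaleR) simp
  qed
  with integral_dilation[OF _ assms, of "\<lambda>t. exp (2 * pi * \<i> * ((s /\<^sub>R c) \<bullet> t)) * gauss 1 t"] * assms
  show ?thesis
    by (simp add: has_bochner_integral_iff gauss_def scaleR_conv_of_real divide_inverse mult.commute)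
qed

lemma integrable_gauss[simp]: "c > 0 \<Longrightarrow> integrable lborel (gauss c :: 'a::euclidean_space \<Rightarrow> real)"
  and integral_gauss: "c > 0 \<Longrightarrow> (LINT t::'a|lborel. gauss c t) = 1 / c ^ DIM('a)"
proof -
  assume c: "c > 0"
  from has_bochner_integral_gauss_fourier[OF this, of "0::'a"]
  have *: "has_bochner_integral lborel (\<lambda>t::'a. complex_of_real (gauss c t)) (complex_of_real (1 / c ^ DIM('a)))"
    by (simp add: gauss_def)
  then show "integrable lborel (gauss c :: 'a \<Rightarrow> real)" "(LINT t::'a|lborel. gauss c t) = 1 / c ^ DIM('a)"
    by (simp_all only: has_bochner_integral_iff complex_of_real_integrable_eq integral_complex_of_real of_real_eq_iff)
qed

section \<open>The Hilbert space structure of \<open>L\<^sup>2\<close>\<close>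

lemma L2_rel_refl_iff: "L2_rel f f \<longleftrightarrow> square_integrable f"
  by (simp add: L2_rel_def)

lemma L2_cases:
  fixes \<psi> :: "('a::euclidean_space) L2"
  obtains f where "square_integrable f" "\<psi> = abs_L2 f"
  using L2.abs_induct[of "\<lambda>\<psi>. \<exists>f. square_integrable f \<and> \<psi> = abs_L2 f" \<psi>]
  by (auto simp: L2_rel_refl_iff)

lemma cinner_abs:
  "square_integrable f \<Longrightarrow> square_integrable g \<Longrightarrow>
    cinner (abs_L2 f) (abs_L2 g) = (LINT t|lborel. f t * cnj (g t))"
  by (simp add: cinner.abs_eq L2_rel_refl_iff)

lemma plus_abs: "square_integrable f \<Longrightarrow> square_integrable g \<Longrightarrow> abs_L2 f + abs_L2 g = abs_L2 (\<lambda>t. f t + g t)"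
  by (simp add: plus_L2.abs_eq L2_rel_refl_iff)

lemma scaleC_abs: "square_integrable f \<Longrightarrow> c *\<^sub>C abs_L2 f = abs_L2 (\<lambda>t. c * f t)"
  by (simp add: scaleC.abs_eq L2_rel_refl_iff)

lemma minus_abs: "square_integrable f \<Longrightarrow> square_integrable g \<Longrightarrow> abs_L2 f - abs_L2 g = abs_L2 (\<lambda>t. f t - g t)"
  using plus_abs[of f "\<lambda>t. - 1 * g t"] square_integrable_cmult[of g "- 1"]
  unfolding minus_L2_def uminus_L2_def by (simp add: scaleC_abs)

lemma cinner_commute: "cinner f g = cnj (cinner g f)"
proof transfer
  fix f g :: "'a \<Rightarrow> complex"
  have "(LINT t|lborel. f t * cnj (g t)) = (LINT t|lborel. cnj (g t * cnj (f t)))"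
    by (simp add: mult.commute)
  also have "\<dots> = cnj (LINT t|lborel. g t * cnj (f t))"
    by (rule Bochner_Integration.integral_cnj)
  finally show "(LINT t|lborel. f t * cnj (g t)) = cnj (LINT t|lborel. g t * cnj (f t))" .
qed

lemma cinner_add_left: "cinner (f + g) h = cinner f h + cinner g h"
  by transfer
    (auto simp: L2_rel_def distrib_right
       intro!: Bochner_Integration.integral_add square_integrable_mult_cnj)

lemma cinner_scaleC_left: "cinner (c *\<^sub>C f) g = c * cinner f g"
  by transfer (simp add: mult.assoc)

lemma cinner_add_right: "cinner h (f + g) = cinner h f + cinner h g"
  unfolding cinner_commute[of h "f + g"] cinner_commute[of h f] cinner_commute[of h g] cinner_add_left by simp

lemma cinner_scaleC_right: "cinner g (c *\<^sub>C f) = cnj c * cinner g f"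
  unfolding cinner_commute[of g "c *\<^sub>C f"] cinner_commute[of g f] cinner_scaleC_left by simp

lemma cinner_scaleR_left: "cinner (r *\<^sub>R f) g = r * cinner f g"
  by (simp add: scaleR_L2_def cinner_scaleC_left)

lemma cinner_scaleR_right: "cinner g (r *\<^sub>R f) = r * cinner g f"
  by (simp add: scaleR_L2_def cinner_scaleC_right)

lemma cinner_minus_left: "cinner (- f) g = - cinner f g"
  by (simp add: uminus_L2_def cinner_scaleC_left)

lemma cinner_minus_right: "cinner g (- f) = - cinner g f"
  by (simp add: uminus_L2_def cinner_scaleC_right)

lemma cinner_diff_left: "cinner (f - g) h = cinner f h - cinner g h"
  unfolding minus_L2_def cinner_add_left cinner_minus_left by simp

lemma cinner_diff_right: "cinner h (f - g) = cinner h f - cinner h g"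
  unfolding minus_L2_def cinner_add_right cinner_minus_right by simp

lemma cinner_zero_left [simp]: "cinner 0 g = 0"
  using cinner_scaleR_left[of 0 0 g] by simp

lemma cinner_zero_right [simp]: "cinner g 0 = 0"
  using cinner_scaleR_right[of g 0 0] by simp

lemma cinner_sum_left: "cinner (sum f A) g = (\<Sum>a\<in>A. cinner (f a) g)"
  by (induction A rule: infinite_finite_induct) (auto simp: cinner_add_left)

lemma cinner_sum_right: "cinner g (sum f A) = (\<Sum>a\<in>A. cinner g (f a))"
  by (induction A rule: infinite_finite_induct) (auto simp: cinner_add_right)

lemma cinner_self: "cinner f f = complex_of_real ((norm f)\<^sup>2)"
proof (rule complex_eqI)
  show "Re (cinner f f) = Re (complex_of_real ((norm f)\<^sup>2))"
    by (simp add: power2_norm_eq_inner inner_L2_def del: of_real_power)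
  have "cinner f f = cnj (cinner f f)" by (rule cinner_commute)
  then show "Im (cinner f f) = Im (complex_of_real ((norm f)\<^sup>2))"
    by (simp add: complex_eq_iff)
qed

lemma norm_scaleC: "norm (c *\<^sub>C f) = cmod c * norm f"
proof -
  have "complex_of_real ((norm (c *\<^sub>C f))\<^sup>2) = complex_of_real ((cmod c * norm f)\<^sup>2)"
    unfolding cinner_self[symmetric] cinner_scaleC_left cinner_scaleC_right
    by (simp add: cinner_self power_mult_distrib complex_norm_square[of c] mult.assoc del: of_real_power flip: of_real_power[of _ 2])
  then have "(norm (c *\<^sub>C f))\<^sup>2 = (cmod c * norm f)\<^sup>2"
    using of_real_eq_iff by blast
  then show ?thesis by (rule power2_eq_imp_eq) auto
qed

lemma scaleC_one [simp]: "1 *\<^sub>C f = f"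
  using scaleR_one[of f] unfolding scaleR_L2_def by simp

lemma scaleC_scaleC [simp]: "a *\<^sub>C b *\<^sub>C f = (a * b) *\<^sub>C f"
  by transfer (auto simp: L2_rel_def mult.assoc intro!: square_integrable_cmult)

lemma scaleC_add_right: "a *\<^sub>C (f + g) = a *\<^sub>C f + a *\<^sub>C g"
  by transfer (auto simp: L2_rel_def distrib_left intro!: square_integrable_add square_integrable_cmult)

lemma cinner_eqI: "(\<And>\<eta>. cinner f \<eta> = cinner g \<eta>) \<Longrightarrow> f = g"
proof -
  assume "\<And>\<eta>. cinner f \<eta> = cinner g \<eta>"
  then have "cinner (f - g) (f - g) = 0" by (simp add: cinner_diff_left)
  then show ?thesis by (simp add: cinner_self)
qed

lemma norm_cinner_le: "cmod (cinner f g) \<le> norm f * norm g"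
proof (cases "cinner f g = 0")
  case False
  \<comment> \<open>A phase that makes the inner product real and nonnegative, reducing the complex
    Cauchy-Schwarz inequality to the real one.\<close>
  define u where "u = cnj (cinner f g) / cmod (cinner f g)"
  have u: "cmod u = 1" using False by (simp add: u_def norm_divide)
  have "complex_of_real (cmod (cinner f g)) = cinner (u *\<^sub>C f) g"
    using False by (simp add: u_def cinner_scaleC_left complex_norm_square[symmetric] field_simps power2_eq_square)
  then have "cmod (cinner f g) = inner (u *\<^sub>C f) g"
    by (metis inner_L2_def Re_complex_of_real)
  also have "\<dots> \<le> norm (u *\<^sub>C f) * norm g" by (rule norm_cauchy_schwarz)
  finally show ?thesis by (simp add: norm_scaleC u)
qed simp

lemma bounded_bilinear_cinner: "bounded_bilinear cinner"
  by standard
    (auto simp: cinner_add_left cinner_add_right cinner_scaleR_left cinner_scaleR_right scaleR_conv_of_real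
       intro!: exI[of _ 1] norm_cinner_le)

lemmas tendsto_cinner[tendsto_intros] = bounded_bilinear.tendsto[OF bounded_bilinear_cinner]
lemmas continuous_on_cinner[continuous_intros] = bounded_bilinear.continuous_on[OF bounded_bilinear_cinner]

lemma norm_abs_L2:
  assumes "square_integrable f"
  shows "(norm (abs_L2 f))\<^sup>2 = (LINT t|lborel. (cmod (f t))\<^sup>2)"
proof -
  have "complex_of_real ((norm (abs_L2 f))\<^sup>2) = (LINT t|lborel. f t * cnj (f t))"
    unfolding cinner_self[symmetric] using assms by (simp only: cinner_abs)
  also have "\<dots> = (LINT t|lborel. complex_of_real ((cmod (f t))\<^sup>2))"
    by (simp only: complex_norm_square)
  also have "\<dots> = complex_of_real (LINT t|lborel. (cmod (f t))\<^sup>2)"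
    by (rule integral_complex_of_real)
  finally show ?thesis using of_real_eq_iff by blast
qed

lemma nn_integral_norm_abs_L2:
  assumes "square_integrable f"
  shows "(\<integral>\<^sup>+t. ennreal ((cmod (f t))\<^sup>2) \<partial>lborel) = ennreal ((norm (abs_L2 f))\<^sup>2)"
  using assms by (simp add: norm_abs_L2 nn_integral_eq_integral square_integrable_def)

lemma square_integrable_diff: "square_integrable f \<Longrightarrow> square_integrable g \<Longrightarrow> square_integrable (\<lambda>t. f t - g t)"
  using square_integrable_add[of f "\<lambda>t. - 1 * g t"] square_integrable_cmult[of g "- 1"] by simp

lemma square_integrable_gauss: "square_integrable (\<lambda>t. complex_of_real (gauss 1 t))"
proof -
  have "(cmod (complex_of_real (gauss 1 t)))\<^sup>2 = gauss (sqrt 2) t" for t :: 'a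
    by (simp add: gauss_def exp_double[symmetric] power_mult_distrib flip: exp_double)
  then show ?thesis by (simp add: square_integrable_def)
qed

text \<open>Cauchy-Schwarz for the moduli of \<open>f\<close> and \<open>g\<close>: it controls the
  integral of the absolute value, not just the absolute value of the integral.\<close>

lemma integral_norm_mult_le:
  assumes "square_integrable f" "square_integrable g"
  shows "(LINT t|lborel. cmod (f t) * cmod (g t)) \<le> norm (abs_L2 f) * norm (abs_L2 g)"
proof -
  let ?F = "\<lambda>t. complex_of_real (cmod (f t))" and ?G = "\<lambda>t. complex_of_real (cmod (g t))"
  have sq: "square_integrable ?F" "square_integrable ?G"
    using assms by (auto simp: square_integrable_def)
  have "norm (abs_L2 ?F) = norm (abs_L2 f)" "norm (abs_L2 ?G) = norm (abs_L2 g)"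
    by (rule power2_eq_imp_eq; simp add: norm_abs_L2 sq assms)+
  moreover have "complex_of_real (LINT t|lborel. cmod (f t) * cmod (g t)) = cinner (abs_L2 ?F) (abs_L2 ?G)"
    by (simp add: cinner_abs sq flip: of_real_mult)
  then have "cmod (complex_of_real (LINT t|lborel. cmod (f t) * cmod (g t))) \<le> norm (abs_L2 ?F) * norm (abs_L2 ?G)"
    using norm_cinner_le[of "abs_L2 ?F" "abs_L2 ?G"] by (simp only:)
  ultimately show ?thesis by simp
qed

section \<open>Completeness and the Riesz representation\<close>

text \<open>Riesz-Fischer. An almost everywhere convergent subsequence is extracted in
  \<open>L1\<close>: multiplication by a Gaussian, which lies in \<open>L2\<close> and never
  vanishes, makes an \<open>L2\<close> Cauchy sequence \<open>L1\<close> Cauchy, and division by it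
  recovers the pointwise limit.\<close>

instance L2 :: (euclidean_space) banach
proof
  fix X :: "nat \<Rightarrow> 'a L2"
  assume X: "Cauchy X"
  have "\<exists>f. square_integrable f \<and> X n = abs_L2 f" for n
    by (metis L2_cases)
  then obtain f where f: "\<And>n. square_integrable (f n)" "\<And>n. X n = abs_L2 (f n)"
    by metis
  have [measurable]: "f n \<in> borel_measurable borel" for n
    using f(1)[of n] by (simp add: square_integrable_def)
  let ?w = "\<lambda>t::'a. complex_of_real (gauss 1 t)"
  have w: "square_integrable ?w" by (rule square_integrable_gauss)
  let ?W = "norm (abs_L2 ?w)"
  obtain r where r: "strict_mono r" "AE x in lborel. Cauchy (\<lambda>i. f (r i) x * ?w x)"
  proof (rule cauchy_L1_AE_cauchy_subseq[of lborel "\<lambda>n x. f n x * ?w x"])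
    show "integrable lborel (\<lambda>x. f n x * ?w x)" for n
      using square_integrable_mult_cnj[OF f(1)[of n] w] by simp
    fix e :: real assume "e > 0"
    then have e': "e / (?W + 1) > 0" by (simp add: add_nonneg_pos)
    from CauchyD[OF X this] obtain N where N: "\<And>i j. i \<ge> N \<Longrightarrow> j \<ge> N \<Longrightarrow> norm (X i - X j) < e / (?W + 1)"
      by auto
    have "(LINT x|lborel. norm (f i x * ?w x - f j x * ?w x)) < e" if "i \<ge> N" "j \<ge> N" for i j
    proof -
      have "(LINT x|lborel. norm (f i x * ?w x - f j x * ?w x)) = (LINT x|lborel. cmod (f i x - f j x) * cmod (?w x))"
        unfolding norm_mult[symmetric] left_diff_distrib ..
      also have "\<dots> \<le> norm (X i - X j) * ?W"
        using integral_norm_mult_le[OF square_integrable_diff[OF f(1) f(1)] w, of i j]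
        by (simp add: f minus_abs)
      also have "\<dots> \<le> e / (?W + 1) * ?W"
        using N[OF that] by (intro mult_right_mono) auto
      also have "\<dots> < e"
        using \<open>e > 0\<close> norm_ge_zero[of "abs_L2 ?w"]
        by (simp add: divide_less_eq distrib_left add_nonneg_pos not_less)
      finally show ?thesis .
    qed
    then show "\<exists>N. \<forall>i\<ge>N. \<forall>j\<ge>N. (LINT x|lborel. norm (f i x * ?w x - f j x * ?w x)) < e" by blast
  qed
  define g where "g x = lim (\<lambda>i. f (r i) x)" for x
  have [measurable]: "g \<in> borel_measurable borel"
    unfolding g_def by measurable
  have conv: "AE x in lborel. (\<lambda>i. f (r i) x) \<longlonglongrightarrow> g x"
    using r(2)
  proof eventually_elim
    case (elim x)
    then obtain l where "(\<lambda>i. f (r i) x * ?w x) \<longlonglongrightarrow> l"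
      using Cauchy_convergent_iff convergent_def by blast
    then have "(\<lambda>i. f (r i) x * ?w x / ?w x) \<longlonglongrightarrow> l / ?w x"
      by (intro tendsto_intros) (simp_all add: less_imp_neq[OF gauss_pos, symmetric])
    then have "convergent (\<lambda>i. f (r i) x)"
      by (auto simp: less_imp_neq[OF gauss_pos, symmetric] convergent_def)
    then show ?case by (simp add: g_def convergent_LIMSEQ_iff)
  qed
  \<comment> \<open>Fatou's lemma carries the Cauchy estimate over to the limit. Nonnegative
    integrals are used because square integrability of \<open>g - f n\<close> is only concluded from
    this bound.\<close>
  have bound: "(\<integral>\<^sup>+t. ennreal ((cmod (g t - f n t))\<^sup>2) \<partial>lborel) \<le> ennreal (e\<^sup>2)"
    if "\<And>i j. i \<ge> N \<Longrightarrow> j \<ge> N \<Longrightarrow> norm (X i - X j) < e" "n \<ge> N" for e N n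
  proof -
    have "(\<integral>\<^sup>+t. ennreal ((cmod (g t - f n t))\<^sup>2) \<partial>lborel) =
        (\<integral>\<^sup>+t. liminf (\<lambda>k. ennreal ((cmod (f (r k) t - f n t))\<^sup>2)) \<partial>lborel)"
    proof (rule nn_integral_cong_AE, use conv in eventually_elim)
      case (elim t)
      then have "(\<lambda>k. ennreal ((cmod (f (r k) t - f n t))\<^sup>2)) \<longlonglongrightarrow> ennreal ((cmod (g t - f n t))\<^sup>2)"
        by (intro tendsto_intros)
      then show ?case by (rule lim_imp_Liminf[OF sequentially_bot, symmetric])
    qed
    also have "\<dots> \<le> liminf (\<lambda>k. \<integral>\<^sup>+t. ennreal ((cmod (f (r k) t - f n t))\<^sup>2) \<partial>lborel)"
      by (rule nn_integral_liminf) measurable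
    also have "\<dots> \<le> liminf (\<lambda>k. ennreal (e\<^sup>2))"
    proof (rule Liminf_mono)
      show "\<forall>\<^sub>F k in sequentially. (\<integral>\<^sup>+t. ennreal ((cmod (f (r k) t - f n t))\<^sup>2) \<partial>lborel) \<le> ennreal (e\<^sup>2)"
        using eventually_ge_at_top[of N]
      proof eventually_elim
        case (elim k)
        then have "r k \<ge> N" using seq_suble[OF r(1), of k] by linarith
        then have "norm (X (r k) - X n) < e" using that by blast
        then have "(norm (X (r k) - X n))\<^sup>2 \<le> e\<^sup>2" by (intro power_mono) auto
        then show ?case
          using nn_integral_norm_abs_L2[OF square_integrable_diff[OF f(1) f(1)], of "r k" n]
          by (simp add: f minus_abs ennreal_leI)
      qed
    qed
    also have "\<dots> = ennreal (e\<^sup>2)"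
      by (rule lim_imp_Liminf[OF sequentially_bot tendsto_const])
    finally show ?thesis .
  qed
  have gf: "square_integrable (\<lambda>t. g t - f n t) \<and> norm (abs_L2 (\<lambda>t. g t - f n t)) \<le> e"
    if N: "\<And>i j. i \<ge> N \<Longrightarrow> j \<ge> N \<Longrightarrow> norm (X i - X j) < e" "n \<ge> N" "e > 0" for e N n
  proof -
    have sq: "square_integrable (\<lambda>t. g t - f n t)"
      unfolding square_integrable_def
      using bound[OF N(1,2)] by (auto intro!: integrableI_bounded elim!: le_less_trans)
    from bound[OF N(1,2)] have "(norm (abs_L2 (\<lambda>t. g t - f n t)))\<^sup>2 \<le> e\<^sup>2"
      unfolding nn_integral_norm_abs_L2[OF sq] by (simp add: ennreal_le_iff)
    then show ?thesis using sq N(3) power2_le_imp_le by fastforce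
  qed
  have "\<exists>N. \<forall>i\<ge>N. \<forall>j\<ge>N. norm (X i - X j) < 1" by (rule CauchyD[OF X]) simp
  then obtain N where "\<And>i j. i \<ge> N \<Longrightarrow> j \<ge> N \<Longrightarrow> norm (X i - X j) < 1" by auto
  from gf[OF this, of N] have "square_integrable (\<lambda>t. g t - f N t)" by simp
  from square_integrable_add[OF this f(1)[of N]] have g: "square_integrable g" by simp
  have "X \<longlonglongrightarrow> abs_L2 g"
  proof (rule LIMSEQ_I)
    fix e :: real assume e: "e > 0"
    from CauchyD[OF X, of "e / 2"] e obtain N where N: "\<And>i j. i \<ge> N \<Longrightarrow> j \<ge> N \<Longrightarrow> norm (X i - X j) < e / 2"
      by auto
    have "norm (X n - abs_L2 g) < e" if "n \<ge> N" for n
      using gf[OF N that] e by (subst norm_minus_commute) (simp add: f minus_abs g)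
    then show "\<exists>N. \<forall>n\<ge>N. norm (X n - abs_L2 g) < e" by blast
  qed
  then show "convergent X" by (auto simp: convergent_def)
qed

text \<open>The representing vector minimises \<open>\<parallel>x\<parallel>\<^sup>2 - 2 l x\<close>; minimising sequences are Cauchy by the parallelogram law.\<close>

lemma riesz_real:
  fixes l :: "'h::{real_inner, complete_space} \<Rightarrow> real"
  assumes l: "bounded_linear l"
  obtains u where "\<And>x. l x = inner u x"
proof -
  interpret l: bounded_linear l by fact
  define J where "J x = (norm x)\<^sup>2 - 2 * l x" for x
  obtain K where K: "\<And>x. norm (l x) \<le> norm x * K" using l.bounded by blast
  have lb: "- K\<^sup>2 \<le> J x" for x
  proof -
    have "0 \<le> (norm x - K)\<^sup>2" by simp
    moreover have "l x \<le> norm x * K" using K[of x] by simp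
    ultimately show ?thesis by (simp add: J_def power2_diff algebra_simps)
  qed
  define m where "m = Inf (range J)"
  have bdd: "bdd_below (range J)" using lb by (auto intro!: bdd_belowI)
  have mJ: "m \<le> J x" for x unfolding m_def using bdd by (auto intro: cInf_lower)
  have "\<exists>x. J x < m + 1 / real (Suc n)" for n
    using cInf_lessD[of "range J" "m + 1 / real (Suc n)"] by (auto simp: m_def)
  then obtain x where x: "\<And>n. J (x n) < m + 1 / real (Suc n)" by metis
  have par: "(norm (a - b))\<^sup>2 \<le> 2 * (J a - m) + 2 * (J b - m)" for a b
  proof -
    define c where "c = (1/2) *\<^sub>R (a + b)"
    have "(norm (a - b))\<^sup>2 = 2 * J a + 2 * J b - 4 * J c"
      by (simp add: c_def J_def l.scaleR l.add power2_norm_eq_inner inner_diff_left inner_diff_right inner_add_left inner_add_right inner_commute field_simps)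
    with mJ[of c] show ?thesis by (simp add: right_diff_distrib)
  qed
  have "Cauchy x"
  proof (rule CauchyI)
    fix e :: real assume e: "e > 0"
    obtain N where N: "1 / real (Suc N) < e\<^sup>2 / 4"
      using e nat_approx_posE[of "e\<^sup>2 / 4"] by auto
    have "norm (x i - x j) < e" if "i \<ge> N" "j \<ge> N" for i j
    proof -
      have "1 / real (Suc i) \<le> 1 / real (Suc N)" "1 / real (Suc j) \<le> 1 / real (Suc N)"
        using that by (auto simp: frac_le)
      then have "(norm (x i - x j))\<^sup>2 < e\<^sup>2"
        using par[of "x i" "x j"] x[of i] x[of j] N by argo
      then show ?thesis by (rule power2_less_imp_less) (use e in auto)
    qed
    then show "\<exists>N. \<forall>i\<ge>N. \<forall>j\<ge>N. norm (x i - x j) < e" by blast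
  qed
  then obtain u where u: "x \<longlonglongrightarrow> u" using Cauchy_convergent_iff convergent_def by blast
  have "(\<lambda>n. J (x n)) \<longlonglongrightarrow> J u" unfolding J_def by (intro tendsto_intros u l.tendsto)
  moreover have "(\<lambda>n. m + 1 / real (Suc n)) \<longlonglongrightarrow> m + 0"
    by (intro tendsto_intros LIMSEQ_Suc[OF lim_1_over_n])
  ultimately have Ju: "J u \<le> m"
    using LIMSEQ_le[of "\<lambda>n. J (x n)" "J u" "\<lambda>n. m + 1 / real (Suc n)" "m + 0"] x less_imp_le by auto
  have "l y = inner u y" for y
  proof -
    define d where "d = inner u y - l y"
    \<comment> \<open>First variation at the minimiser: a quadratic in \<open>t\<close> that is
      nonnegative everywhere and 0 at \<open>t = 0\<close> has no linear term.\<close>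
    have *: "0 \<le> t\<^sup>2 * (norm y)\<^sup>2 + 2 * t * d" for t
    proof -
      have "J (u + t *\<^sub>R y) = J u + t\<^sup>2 * (norm y)\<^sup>2 + 2 * t * d"
        unfolding J_def d_def l.add l.scaleR power2_norm_eq_inner
        by (simp add: inner_add_left inner_add_right inner_commute algebra_simps power2_eq_square)
      with mJ[of "u + t *\<^sub>R y"] Ju show ?thesis by linarith
    qed
    have "d = 0"
    proof (rule ccontr)
      assume d: "d \<noteq> 0"
      \<comment> \<open>\<open>- d / (norm y)\<^sup>2\<close> would minimise the quadratic; the
        added 1 avoids a division by 0 when \<open>y = 0\<close> and still leaves a negative
        value.\<close>
      define p where "p = (norm y)\<^sup>2 + 1"
      define t where "t = - d / p"
      have p: "p > 0" by (simp add: p_def add_nonneg_pos)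
      have "t\<^sup>2 * (norm y)\<^sup>2 + 2 * t * d \<le> t\<^sup>2 * p + 2 * t * d"
        by (simp add: p_def distrib_left)
      also have "\<dots> = - (d\<^sup>2 / p)"
        using p by (simp add: t_def power2_eq_square field_simps)
      also have "\<dots> < 0" using p d by simp
      finally show False using *[of t] by simp
    qed
    then show ?thesis by (simp add: d_def)
  qed
  then show thesis by (rule that)
qed

text \<open>A complex linear functional is determined by its real part: the imaginary part at
  \<open>x\<close> is the real part at \<open>(- \<i>) *\<^sub>C x\<close>. So the real representing
  vector already works.\<close>

lemma riesz_complex:
  fixes L :: "('a::euclidean_space) L2 \<Rightarrow> complex"
  assumes L: "bounded_linear L" and C: "\<And>c x. L (c *\<^sub>C x) = c * L x"
  obtains u where "\<And>x. L x = cinner x u"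
proof -
  have "bounded_linear (\<lambda>x. Re (L x))"
    using bounded_linear_compose[OF bounded_linear_Re L] .
  from riesz_real[OF this] obtain u where u: "\<And>x. Re (L x) = inner u x" by blast
  then have u': "Re (L x) = Re (cinner x u)" for x
    by (subst inner_commute[of u x, unfolded inner_L2_def] | simp add: inner_L2_def inner_commute)+
  have "L x = cinner x u" for x
  proof (rule complex_eqI)
    show "Re (L x) = Re (cinner x u)" by (rule u')
    show "Im (L x) = Im (cinner x u)"
      using u'[of "(- \<i>) *\<^sub>C x"] by (simp add: C cinner_scaleC_left)
  qed
  then show thesis by (rule that)
qed

lemma bounded_clinear_imp:
  assumes "bounded_clinear T"
  shows "bounded_linear T" "T (a + b) = T a + T b" "T (c *\<^sub>C a) = c *\<^sub>C T a" "T (a - b) = T a - T b" "T 0 = 0"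
  using assms linear_simps[of T] by (auto simp: bounded_clinear_def)

lemma bounded_clinear_bound:
  assumes "bounded_clinear T"
  obtains K where "K > 0" "\<And>x. norm (T x) \<le> K * norm x"
  using bounded_linear.pos_bounded[OF bounded_clinear_imp(1)[OF assms]] by (metis mult.commute)

lemma bounded_clinearI:
  assumes "\<And>a b. T (a + b) = T a + T b" "\<And>c a. T (c *\<^sub>C a) = c *\<^sub>C T a" "\<And>a. norm (T a) \<le> K * norm a"
  shows "bounded_clinear T"
  unfolding bounded_clinear_def
  using assms by (auto intro!: bounded_linear_intro[where K=K] simp: scaleR_L2_def mult.commute)

text \<open>For fixed \<open>a\<close> the conjugate of \<open>B a\<close> is a bounded linear
  functional, to which Riesz applies. Both adjoints and weakly defined integrals are obtained from
  this.\<close>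

lemma sesquilinear_representation:
  fixes B :: "('a::euclidean_space) L2 \<Rightarrow> 'a L2 \<Rightarrow> complex"
  assumes add1: "\<And>a b c. B (a + b) c = B a c + B b c" and sc1: "\<And>k a c. B (k *\<^sub>C a) c = k * B a c"
    and add2: "\<And>a b c. B c (a + b) = B c a + B c b" and sc2: "\<And>k a c. B c (k *\<^sub>C a) = cnj k * B c a"
    and bound: "\<And>a b. cmod (B a b) \<le> K * norm a * norm b"
  obtains T where "bounded_clinear T" "\<And>a b. cinner (T a) b = B a b" "\<And>a. norm (T a) \<le> K * norm a"
proof -
  have "\<exists>u. \<forall>b. cnj (B a b) = cinner b u" for a
  proof -
    have "bounded_linear (\<lambda>b. cnj (B a b))"
      using add2 sc2 bound[of a]
      by (intro bounded_linear_intro[where K="K * norm a"])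
         (auto simp: scaleR_L2_def scaleR_conv_of_real mult.commute)
    then show ?thesis
      by (rule riesz_complex[of "\<lambda>b. cnj (B a b)"]) (auto simp: sc2)
  qed
  then obtain T where "\<And>a b. cnj (B a b) = cinner b (T a)" by metis
  then have T: "cinner (T a) b = B a b" for a b
    by (metis cinner_commute complex_cnj_cnj)
  have nT: "norm (T a) \<le> K * norm a" for a
  \<comment> \<open>If \<open>T a = 0\<close> the claim still asks for
    \<open>0 \<le> K * norm a\<close>; the sign of \<open>K\<close> is read off from
    \<open>bound\<close> at the pair \<open>a\<close>, \<open>a\<close>.\<close>
  proof (cases "norm (T a) = 0")
    case True
    have "0 \<le> K * norm a"
    proof (cases "norm a = 0")
      case False
      then have "0 \<le> K * norm a * norm a" using bound[of a a] norm_ge_zero order_trans by blast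
      then show ?thesis using False by (simp add: zero_le_mult_iff)
    qed simp
    with True show ?thesis by simp
  next
    case False
    have "(norm (T a))\<^sup>2 = cmod (cinner (T a) (T a))" unfolding cinner_self norm_of_real by simp
    also have "\<dots> \<le> K * norm a * norm (T a)" using bound[of a "T a"] by (simp add: T)
    finally show ?thesis using False by (simp add: power2_eq_square mult_le_cancel_right)
  qed
  have "bounded_clinear T"
    by (rule bounded_clinearI[OF _ _ nT])
       (auto intro!: cinner_eqI simp: T add1 sc1 cinner_add_left cinner_scaleC_left)
  from that[OF this T nT] show thesis .
qed

text \<open>The form \<open>cinner a (R b)\<close> is linear in \<open>a\<close> and conjugate
  linear in \<open>b\<close>, hence represented by some \<open>S\<close>; conjugation of the
  identity moves \<open>S\<close> to the other slot.\<close>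

lemma adjoint_exists:
  assumes R: "bounded_clinear R"
  obtains S where "bounded_clinear S" "\<And>a b. cinner (R a) b = cinner a (S b)"
proof -
  obtain K where K: "K > 0" "\<And>x. norm (R x) \<le> K * norm x" using bounded_clinear_bound[OF R] by blast
  obtain S where S: "bounded_clinear S" "\<And>a b. cinner (S a) b = cinner a (R b)"
  proof (rule sesquilinear_representation[of "\<lambda>a b. cinner a (R b)" K])
    show "cmod (cinner a (R b)) \<le> K * norm a * norm b" for a b
    proof -
      have "cmod (cinner a (R b)) \<le> norm a * norm (R b)" by (rule norm_cinner_le)
      also have "\<dots> \<le> norm a * (K * norm b)" by (intro mult_left_mono K) auto
      finally show ?thesis by (simp add: ac_simps)
    qed
  qed (auto simp: bounded_clinear_imp[OF R] cinner_add_left cinner_add_right cinner_scaleC_left cinner_scaleC_right)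
  have "cinner (R a) b = cinner a (S b)" for a b
    using S(2)[of b a] by (metis cinner_commute)
  with S(1) that show thesis by blast
qed

section \<open>Orthonormal bases and the trace of rank-one compositions\<close>

text \<open>A maximal orthonormal set is a basis, since a nonzero vector orthogonal to it could be
  normalised and added. At least one basis must exist for the description in \<open>trace_op\<close>
  to pin down a unique number.\<close>

lemma orthonormal_basis_exists: "\<exists>B::('a::euclidean_space) L2 set. orthonormal_basis B"
proof -
  define ON where "ON = {B::'a L2 set. \<forall>e\<in>B. \<forall>e'\<in>B. cinner e e' = (if e = e' then 1 else 0)}"
  have "\<exists>M\<in>ON. \<forall>X\<in>ON. M \<subseteq> X \<longrightarrow> X = M"
  proof (rule subset_Zorn)
    fix C assume C: "subset.chain ON C"
    have "\<Union> C \<in> ON"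
      unfolding ON_def
    proof (clarify)
      fix e X e' Y assume *: "e \<in> X" "X \<in> C" "e' \<in> Y" "Y \<in> C"
      then have "X \<subseteq> Y \<or> Y \<subseteq> X" "X \<in> ON" "Y \<in> ON"
        using C by (auto simp: subset.chain_def)
      then show "cinner e e' = (if e = e' then 1 else 0)"
        using * unfolding ON_def by blast
    qed
    then show "\<exists>U\<in>ON. \<forall>X\<in>C. X \<subseteq> U" by blast
  qed
  then obtain B where B: "B \<in> ON" "\<And>X. X \<in> ON \<Longrightarrow> B \<subseteq> X \<Longrightarrow> X = B" by blast
  have "\<psi> = 0" if orth: "\<forall>e\<in>B. cinner \<psi> e = 0" for \<psi>
  proof (rule ccontr)
    assume "\<psi> \<noteq> 0"
    define u where "u = (1 / norm \<psi>) *\<^sub>R \<psi>"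
    have u: "cinner u u = 1" "\<And>e. e \<in> B \<Longrightarrow> cinner u e = 0"
      using \<open>\<psi> \<noteq> 0\<close> orth by (auto simp: u_def cinner_self cinner_scaleR_left)
    then have u': "cinner e u = 0" if "e \<in> B" for e
      using that by (metis cinner_commute complex_cnj_zero)
    have "insert u B \<in> ON" using B(1) u u' by (auto simp: ON_def)
    from B(2)[OF this] have "u \<in> B" by auto
    with u show False by force
  qed
  with B(1) show ?thesis unfolding orthonormal_basis_def ON_def by blast
qed

text \<open>Pythagoras for the projection onto the span of \<open>F\<close>, the residual being
  orthogonal to \<open>F\<close>. The first identity contains Bessel's inequality.\<close>

lemma orthonormal_approx:
  fixes B :: "('a::euclidean_space) L2 set"
  assumes on: "\<And>e e'. e \<in> F \<Longrightarrow> e' \<in> F \<Longrightarrow> cinner e e' = (if e = e' then 1 else 0)" and F: "finite F"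
  shows "(norm (\<psi> - (\<Sum>e\<in>F. cinner \<psi> e *\<^sub>C e)))\<^sup>2 = (norm \<psi>)\<^sup>2 - (\<Sum>e\<in>F. (cmod (cinner \<psi> e))\<^sup>2)"
    and "(norm (\<Sum>e\<in>F. cinner \<psi> e *\<^sub>C e))\<^sup>2 = (\<Sum>e\<in>F. (cmod (cinner \<psi> e))\<^sup>2)"
    and "e' \<in> F \<Longrightarrow> cinner (\<Sum>e\<in>F. cinner \<psi> e *\<^sub>C e) e' = cinner \<psi> e'"
proof -
  let ?p = "\<Sum>e\<in>F. cinner \<psi> e *\<^sub>C e" and ?s = "\<Sum>e\<in>F. (cmod (cinner \<psi> e))\<^sup>2"
  have p: "cinner ?p e' = cinner \<psi> e'" if "e' \<in> F" for e'
  proof -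
    have "cinner ?p e' = (\<Sum>e\<in>F. if e = e' then cinner \<psi> e else 0)"
      unfolding cinner_sum_left by (rule sum.cong) (use that on in \<open>auto simp: cinner_scaleC_left\<close>)
    then show ?thesis using F that by simp
  qed
  then show "e' \<in> F \<Longrightarrow> cinner ?p e' = cinner \<psi> e'" .
  have pp: "cinner ?p ?p = of_real ?s"
    unfolding cinner_sum_right of_real_sum
    by (rule sum.cong[OF refl]) (simp only: cinner_scaleC_right p complex_norm_square mult.commute)
  have pp2: "cinner \<psi> ?p = of_real ?s"
    unfolding cinner_sum_right of_real_sum
    by (rule sum.cong[OF refl]) (simp only: cinner_scaleC_right complex_norm_square mult.commute)
  have pp3: "cinner ?p \<psi> = of_real ?s"
    by (subst cinner_commute) (simp add: pp2)
  have "complex_of_real ((norm ?p)\<^sup>2) = of_real ?s" using pp by (simp only: cinner_self)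
  then show "(norm ?p)\<^sup>2 = ?s" using of_real_eq_iff by blast
  have "complex_of_real ((norm (\<psi> - ?p))\<^sup>2) = complex_of_real ((norm \<psi>)\<^sup>2 - ?s)"
    unfolding of_real_diff cinner_self[symmetric] unfolding cinner_diff_left cinner_diff_right pp pp2 pp3 by simp
  then show "(norm (\<psi> - ?p))\<^sup>2 = (norm \<psi>)\<^sup>2 - ?s" using of_real_eq_iff by blast
qed


text \<open>Finite subsets that nearly exhaust the supremum of the Bessel sums give a Cauchy
  sequence of projections. Its limit \<open>u\<close> has the same coefficients as \<psi> along all
  of \<open>B\<close>, so it is \<psi> by completeness of the basis.\<close>

lemma orthonormal_basis_approx:
  fixes B :: "('a::euclidean_space) L2 set"
  assumes B: "orthonormal_basis B" and e: "e > 0"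
  obtains F where "finite F" "F \<subseteq> B" "norm (\<psi> - (\<Sum>e\<in>F. cinner \<psi> e *\<^sub>C e)) < e"
proof -
  define P where "P F = (\<Sum>e\<in>F. cinner \<psi> e *\<^sub>C e)" for F
  define S where "S F = (\<Sum>e\<in>F. (cmod (cinner \<psi> e))\<^sup>2)" for F
  have on: "cinner e e' = (if e = e' then 1 else 0)" if "e \<in> B" "e' \<in> B" for e e'
    using B that by (simp add: orthonormal_basis_def)
  define Fs where "Fs = {F. finite F \<and> F \<subseteq> B}"
  have onF: "cinner e e' = (if e = e' then 1 else 0)" if "F \<in> Fs" "e \<in> F" "e' \<in> F" for e e' F
    by (rule on) (use that in \<open>auto simp: Fs_def\<close>)
  have finF: "finite F" if "F \<in> Fs" for F using that by (simp add: Fs_def)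
  have n1: "(norm (\<psi> - P F))\<^sup>2 = (norm \<psi>)\<^sup>2 - S F" if "F \<in> Fs" for F
    unfolding P_def S_def by (rule orthonormal_approx(1)[OF onF[OF that] finF[OF that]])
  have n2: "(norm (P F))\<^sup>2 = S F" if "F \<in> Fs" for F
    unfolding P_def S_def by (rule orthonormal_approx(2)[OF onF[OF that] finF[OF that]])
  have n3: "cinner (P F) e' = cinner \<psi> e'" if "F \<in> Fs" "e' \<in> F" for F e'
    unfolding P_def by (rule orthonormal_approx(3)[OF onF[OF that(1)] finF[OF that(1)] that(2)])
  have bdd: "bdd_above (S ` Fs)"
  proof (rule bdd_aboveI)
    fix x assume "x \<in> S ` Fs"
    then obtain F where F: "F \<in> Fs" "x = S F" by blast
    show "x \<le> (norm \<psi>)\<^sup>2"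
      using n1[OF F(1)] F(2) zero_le_power2[of "norm (\<psi> - P F)"] by linarith
  qed
  define s where "s = Sup (S ` Fs)"
  have Ss: "S F \<le> s" if "F \<in> Fs" for F
    unfolding s_def using bdd that by (auto intro: cSup_upper)
  have "\<exists>F\<in>Fs. s - 1 / real (Suc n) < S F" for n
    using less_cSupD[of "S ` Fs" "s - 1 / real (Suc n)"] by (auto simp: s_def Fs_def)
  then obtain G where G: "\<And>n. G n \<in> Fs" "\<And>n. s - 1 / real (Suc n) < S (G n)" by metis
  \<comment> \<open>Unions make the near-maximising sets nested, so that \<open>PFG\<close> turns
    differences of Bessel sums into squared distances.\<close>
  define F where "F n = (\<Union>i\<le>n. G i)" for n
  have FFs: "F n \<in> Fs" for n using G(1) by (auto simp: F_def Fs_def)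
  have Fmono: "F m \<subseteq> F n" if "m \<le> n" for m n using that by (force simp: F_def)
  have Smono: "S X \<le> S Y" if "X \<subseteq> Y" "Y \<in> Fs" for X Y
    using that by (auto simp: S_def Fs_def intro: sum_mono2)
  have Fs': "s - 1 / real (Suc n) < S (F n)" for n
    using G(2)[of n] Smono[of "G n" "F n"] FFs by (force simp: F_def)
  have PFG: "(norm (P Y - P X))\<^sup>2 = S Y - S X" if "X \<subseteq> Y" "Y \<in> Fs" for X Y
  proof -
    have YX: "Y - X \<in> Fs" "X \<in> Fs" using that by (auto simp: Fs_def intro: finite_subset)
    have fin: "finite Y" using that by (simp add: Fs_def)
    have "P Y - P X = P (Y - X)" "S Y - S X = S (Y - X)"
      unfolding P_def S_def
      using sum.subset_diff[OF that(1) fin, of "\<lambda>e. cinner \<psi> e *\<^sub>C e"]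
        sum.subset_diff[OF that(1) fin, of "\<lambda>e. (cmod (cinner \<psi> e))\<^sup>2"] by simp_all
    then show ?thesis using n2[OF YX(1)] by simp
  qed
  have "Cauchy (\<lambda>n. P (F n))"
  proof (rule CauchyI)
    fix e :: real assume e: "e > 0"
    obtain N where N: "1 / real (Suc N) < (e / 2)\<^sup>2"
      using e nat_approx_posE[of "(e / 2)\<^sup>2"] by auto
    have *: "norm (P (F n) - P (F N)) < e / 2" if "n \<ge> N" for n
    proof -
      have "(norm (P (F n) - P (F N)))\<^sup>2 = S (F n) - S (F N)" by (rule PFG[OF Fmono[OF that] FFs])
      also have "\<dots> < (e / 2)\<^sup>2" using Ss[OF FFs, of n] Fs'[of N] N by linarith
      finally show ?thesis by (rule power2_less_imp_less) (use e in auto)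
    qed
    have "norm (P (F m) - P (F n)) < e" if "m \<ge> N" "n \<ge> N" for m n
      using *[OF that(1)] *[OF that(2)] norm_triangle_ineq4[of "P (F m) - P (F N)" "P (F n) - P (F N)"] by simp
    then show "\<exists>N. \<forall>m\<ge>N. \<forall>n\<ge>N. norm (P (F m) - P (F n)) < e" by blast
  qed
  then obtain u where u: "(\<lambda>n. P (F n)) \<longlonglongrightarrow> u" using Cauchy_convergent_iff convergent_def by blast
  have "cinner (\<psi> - u) b = 0" if b: "b \<in> B" for b
  proof (cases "\<exists>n. b \<in> F n")
    case True
    then obtain N where N: "b \<in> F N" ..
    have lim: "(\<lambda>n. cinner (P (F n)) b) \<longlonglongrightarrow> cinner u b" by (intro tendsto_intros u)
    have "eventually (\<lambda>n. cinner (P (F n)) b = cinner \<psi> b) sequentially"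
      using eventually_ge_at_top[of N] by eventually_elim (rule n3[OF FFs subsetD[OF Fmono N]])
    then have "(\<lambda>n. cinner (P (F n)) b) \<longlonglongrightarrow> cinner \<psi> b" by (rule tendsto_eventually)
    from LIMSEQ_unique[OF lim this] have "cinner u b = cinner \<psi> b" .
    then show ?thesis by (simp add: cinner_diff_left)
  next
    case False
    have Pb: "cinner (P (F n)) b = 0" for n
      unfolding P_def cinner_sum_left
    proof (rule sum.neutral, rule ballI)
      fix x assume "x \<in> F n"
      then have "x \<in> B" "x \<noteq> b" using False FFs[of n] by (auto simp: Fs_def)
      then show "cinner (cinner \<psi> x *\<^sub>C x) b = 0" using on[of x b] b by (simp add: cinner_scaleC_left)
    qed
    have "(\<lambda>n. cinner (P (F n)) b) \<longlonglongrightarrow> cinner u b" by (intro tendsto_intros u)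
    then have ub: "cinner u b = 0" unfolding Pb using LIMSEQ_const_iff[of "0::complex"] by metis
    \<comment> \<open>Adding \<open>b\<close> to \<open>F n\<close> cannot lift the Bessel sum above
      its supremum, so the coefficient at a \<open>b\<close> outside every \<open>F n\<close> is
      squeezed to 0.\<close>
    have le: "(cmod (cinner \<psi> b))\<^sup>2 \<le> 1 / real (Suc n)" for n
    proof -
      have i: "insert b (F n) \<in> Fs" using FFs[of n] b by (auto simp: Fs_def)
      have "S (insert b (F n)) = (cmod (cinner \<psi> b))\<^sup>2 + S (F n)"
        using False FFs[of n] by (auto simp: S_def Fs_def)
      with Ss[OF i] Fs'[of n] show ?thesis by linarith
    qed
    have "(\<lambda>n. 1 / real (Suc n)) \<longlonglongrightarrow> 0" by (rule LIMSEQ_Suc[OF lim_1_over_n])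
    then have "(cmod (cinner \<psi> b))\<^sup>2 \<le> 0" by (rule LIMSEQ_le_const) (use le in auto)
    then show ?thesis by (simp add: cinner_diff_left ub)
  qed
  then have "\<psi> - u = 0" using B unfolding orthonormal_basis_def by blast
  then have "(\<lambda>n. P (F n)) \<longlonglongrightarrow> \<psi>" using u by simp
  from LIMSEQ_D[OF this e] obtain n where "norm (P (F n) - \<psi>) < e" by auto
  then have "norm (\<psi> - P (F n)) < e" by (simp add: norm_minus_commute)
  then show thesis using that[of "F n"] FFs[of n] by (simp add: P_def Fs_def)
qed

text \<open>The residual norm decreases as the finite set grows, so one good finite set controls all
  larger ones; this gives convergence along the net that \<open>has_sum\<close> asks for.\<close>

lemma parseval_has_sum:
  fixes B :: "('a::euclidean_space) L2 set"
  assumes B: "orthonormal_basis B"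
  shows "((\<lambda>e. cinner \<psi> e * cinner e \<eta>) has_sum cinner \<psi> \<eta>) B"
proof -
  define P where "P F = (\<Sum>e\<in>F. cinner \<psi> e *\<^sub>C e)" for F
  have on: "cinner e e' = (if e = e' then 1 else 0)" if "e \<in> B" "e' \<in> B" for e e'
    using B that by (simp add: orthonormal_basis_def)
  have n1: "(norm (\<psi> - P F))\<^sup>2 = (norm \<psi>)\<^sup>2 - (\<Sum>e\<in>F. (cmod (cinner \<psi> e))\<^sup>2)" if "finite F" "F \<subseteq> B" for F
    unfolding P_def by (rule orthonormal_approx(1)[OF on that(1)]) (use that in blast)+
  have "(P \<longlongrightarrow> \<psi>) (finite_subsets_at_top B)"
  proof (rule tendstoI)
    fix e :: real assume e: "e > 0"
    obtain F where F: "finite F" "F \<subseteq> B" "norm (\<psi> - P F) < e"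
      using orthonormal_basis_approx[OF B e, of \<psi>] unfolding P_def by blast
    have "eventually (\<lambda>Y. finite Y \<and> F \<subseteq> Y \<and> Y \<subseteq> B) (finite_subsets_at_top B)"
      using F unfolding eventually_finite_subsets_at_top by blast
    then show "eventually (\<lambda>Y. dist (P Y) \<psi> < e) (finite_subsets_at_top B)"
    proof eventually_elim
      case (elim Y)
      then have "(\<Sum>e\<in>F. (cmod (cinner \<psi> e))\<^sup>2) \<le> (\<Sum>e\<in>Y. (cmod (cinner \<psi> e))\<^sup>2)"
        by (intro sum_mono2) auto
      then have "(norm (\<psi> - P Y))\<^sup>2 \<le> (norm (\<psi> - P F))\<^sup>2" using n1 F elim by simp
      then have "norm (\<psi> - P Y) \<le> norm (\<psi> - P F)" by (rule power2_le_imp_le) simp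
      then show ?case using F(3) by (simp add: dist_norm norm_minus_commute)
    qed
  qed
  then have "((\<lambda>F. cinner (P F) \<eta>) \<longlongrightarrow> cinner \<psi> \<eta>) (finite_subsets_at_top B)"
    by (intro tendsto_intros)
  then show ?thesis
    by (simp add: has_sum_def P_def cinner_sum_left cinner_scaleC_left)
qed

text \<open>With \<open>S\<close> the adjoint of \<open>A\<close>, the diagonal sum is the Parseval
  sum of \<psi> against \<open>S \<phi>\<close>, whose value is the same in every basis.\<close>

lemma trace_rank_one:
  assumes A: "bounded_clinear A"
  shows "trace_op (rank_one \<psi> \<phi> \<circ> A) = cinner (A \<psi>) \<phi>"
proof -
  obtain S where S: "\<And>a b. cinner (A a) b = cinner a (S b)" using adjoint_exists[OF A] by metis
  have *: "((\<lambda>e. cinner ((rank_one \<psi> \<phi> \<circ> A) e) e) has_sum cinner (A \<psi>) \<phi>) B" if "orthonormal_basis B" for B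
    using parseval_has_sum[OF that, of \<psi> "S \<phi>"]
    by (simp add: rank_one_def cinner_scaleC_left S mult.commute)
  obtain B0 :: "'a L2 set" where B0: "orthonormal_basis B0" using orthonormal_basis_exists by blast
  show ?thesis
    unfolding trace_op_def
  proof (rule the_equality)
    show "\<forall>B. orthonormal_basis B \<longrightarrow> ((\<lambda>e. cinner ((rank_one \<psi> \<phi> \<circ> A) e) e) has_sum cinner (A \<psi>) \<phi>) B"
      using * by blast
    fix c assume "\<forall>B. orthonormal_basis B \<longrightarrow> ((\<lambda>e. cinner ((rank_one \<psi> \<phi> \<circ> A) e) e) has_sum c) B"
    then show "c = cinner (A \<psi>) \<phi>" using *[OF B0] B0 has_sum_unique by blast
  qed
qed

section \<open>Time-frequency shifts\<close>

text \<open>The additive character with period 1. Naming it keeps phases out of reach of the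
  simplifier's rules for \<open>exp\<close> and lets them combine through
  \<open>ee_add\<close>.\<close>

definition ee :: "real \<Rightarrow> complex" where
  "ee x = exp (complex_of_real (2 * pi) * \<i> * complex_of_real x)"

lemma ee_add: "ee (x + y) = ee x * ee y"
  by (simp add: ee_def distrib_left exp_add)

lemma ee_0 [simp]: "ee 0 = 1"
  by (simp add: ee_def)

lemma norm_ee [simp]: "cmod (ee x) = 1"
  by (simp add: ee_def norm_exp_eq_Re)

lemma cnj_ee: "cnj (ee x) = ee (- x)"
  by (simp add: ee_def exp_cnj)

lemma ee_minus_cancel [simp]: "ee x * ee (- x) = 1" "ee (- x) * ee x = 1"
  by (simp_all flip: ee_add)

lemma ee_minus_cancel2 [simp]: "ee x * (ee (- x) * c) = c" "ee (- x) * (ee x * c) = c"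
  by (simp_all flip: mult.assoc)

lemma tendsto_ee [tendsto_intros]: "(f \<longlongrightarrow> l) F \<Longrightarrow> ((\<lambda>x. ee (f x)) \<longlongrightarrow> ee l) F"
  unfolding ee_def by (intro tendsto_intros)

lemma continuous_on_ee [continuous_intros]: "continuous_on S f \<Longrightarrow> continuous_on S (\<lambda>x. ee (f x))"
  unfolding ee_def by (intro continuous_intros)

lemma measurable_ee [measurable (raw)]: "f \<in> borel_measurable M \<Longrightarrow> (\<lambda>x. ee (f x)) \<in> borel_measurable M"
  by (rule borel_measurable_continuous_on[of ee]) (intro continuous_intros)

lemma measurable_cnj [measurable (raw)]: "g \<in> borel_measurable M \<Longrightarrow> (\<lambda>x. cnj (g x)) \<in> borel_measurable M"
  by (rule borel_measurable_continuous_on[of cnj]) (intro continuous_intros)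

lemma has_bochner_integral_gauss_ee:
  assumes "c > 0"
  shows "has_bochner_integral lborel (\<lambda>t::'a::euclidean_space. ee (s \<bullet> t) * gauss c t)
     (complex_of_real (gauss (1 / c) s / c ^ DIM('a)))"
  using has_bochner_integral_gauss_fourier[OF assms, of s] by (simp add: ee_def)

lemma square_integrable_tf:
  assumes "square_integrable f"
  shows "square_integrable (\<lambda>t. ee (\<omega> \<bullet> t) * f (t - x))"
proof -
  have sq: "square_integrable (\<lambda>t. f (t - x))"
    using square_integrable_affine[OF assms, of 1 "- x"] by simp
  then have [measurable]: "(\<lambda>t. f (t - x)) \<in> borel_measurable borel"
    by (simp add: square_integrable_def)
  have "(\<lambda>t. ee (\<omega> \<bullet> t) * f (t - x)) \<in> borel_measurable borel" by measurable
  with sq show ?thesis by (simp add: square_integrable_def norm_mult)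
qed

lemma tf_shift_abs:
  assumes "square_integrable f"
  shows "tf_shift (x, \<omega>) (abs_L2 f) = abs_L2 (\<lambda>t. ee (\<omega> \<bullet> t) * f (t - x))"
  using assms by (simp add: tf_shift.abs_eq L2_rel_refl_iff ee_def)

lemma tf_shift_add: "tf_shift z (a + b) = tf_shift z a + tf_shift z b"
proof -
  obtain x \<omega> where z: "z = (x, \<omega>)" by force
  obtain f g where "square_integrable f" "a = abs_L2 f" "square_integrable g" "b = abs_L2 g"
    by (metis L2_cases)
  then show ?thesis
    by (simp add: z plus_abs tf_shift_abs square_integrable_tf square_integrable_add distrib_left)
qed

lemma tf_shift_scaleC: "tf_shift z (c *\<^sub>C a) = c *\<^sub>C tf_shift z a"
proof -
  obtain x \<omega> where z: "z = (x, \<omega>)" by force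
  obtain f where "square_integrable f" "a = abs_L2 f" by (metis L2_cases)
  then show ?thesis
    by (simp add: z scaleC_abs tf_shift_abs square_integrable_tf square_integrable_cmult mult.left_commute)
qed

lemma cinner_tf_shift [simp]: "cinner (tf_shift z a) (tf_shift z b) = cinner a b"
proof -
  obtain x \<omega> where z: "z = (x, \<omega>)" by force
  obtain f g where *: "square_integrable f" "a = abs_L2 f" "square_integrable g" "b = abs_L2 g"
    by (metis L2_cases)
  have "cinner (tf_shift z a) (tf_shift z b) = (LINT t|lborel. f (t - x) * cnj (g (t - x)))"
    unfolding z * tf_shift_abs[OF *(1)] tf_shift_abs[OF *(3)] cinner_abs[OF square_integrable_tf square_integrable_tf, OF *(1,3)]
    by (rule Bochner_Integration.integral_cong) (simp_all add: cnj_ee mult.assoc mult.left_commute[of "f _" "ee (- _)"])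
  also have "\<dots> = cinner a b"
    using integral_translate(3)[of "\<lambda>t. f t * cnj (g t)" x] * by (simp add: cinner_abs)
  finally show ?thesis .
qed

lemma norm_tf_shift [simp]: "norm (tf_shift z a) = norm a"
  by (simp add: norm_L2_def inner_L2_def)

lemma bounded_clinear_tf_shift: "bounded_clinear (tf_shift z)"
  by (rule bounded_clinearI[where K=1]) (auto simp: tf_shift_add tf_shift_scaleC)

lemma tf_shift_zero [simp]: "tf_shift z 0 = 0"
  using bounded_clinear_imp(5)[OF bounded_clinear_tf_shift] .

lemma tf_shift_diff: "tf_shift z (a - b) = tf_shift z a - tf_shift z b"
  using bounded_clinear_imp(4)[OF bounded_clinear_tf_shift] .

lemma tf_shift_0: "tf_shift 0 a = a"
proof -
  obtain f where "square_integrable f" "a = abs_L2 f" by (metis L2_cases)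
  then show ?thesis using tf_shift_abs[of f 0 0] by (simp add: zero_prod_def)
qed

text \<open>Time-frequency shifts form only a projective representation: translating the modulation
  of \<open>w\<close> by \<open>fst z\<close> leaves a constant phase.\<close>

lemma tf_shift_tf_shift:
  "tf_shift z (tf_shift w a) = ee (- (snd w \<bullet> fst z)) *\<^sub>C tf_shift (z + w) a"
proof -
  obtain x \<omega> y \<eta> where z: "z = (x, \<omega>)" "w = (y, \<eta>)" by (metis surj_pair)
  obtain f where *: "square_integrable f" "a = abs_L2 f" by (metis L2_cases)
  have "ee (\<omega> \<bullet> t) * (ee (\<eta> \<bullet> (t - x)) * f (t - x - y)) = ee (- (\<eta> \<bullet> x)) * (ee ((\<omega> + \<eta>) \<bullet> t) * f (t - (x + y)))" for t
  proof -
    have "ee (\<omega> \<bullet> t) * ee (\<eta> \<bullet> (t - x)) = ee (- (\<eta> \<bullet> x)) * ee ((\<omega> + \<eta>) \<bullet> t)"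
      by (simp add: ee_add[symmetric] inner_add_left inner_diff_right algebra_simps)
    then show ?thesis by (simp add: diff_diff_add flip: mult.assoc)
  qed
  then show ?thesis
    unfolding z * by (simp add: tf_shift_abs * square_integrable_tf scaleC_abs)
qed

text \<open>The adjoint, which is also the inverse: the phase cancels the one arising when
  \<open>tf_shift z\<close> is composed with \<open>tf_shift (- z)\<close>.\<close>

definition tf_adj :: "'a \<times> 'a \<Rightarrow> ('a::euclidean_space) L2_op" where
  "tf_adj z a = ee (- (snd z \<bullet> fst z)) *\<^sub>C tf_shift (- z) a"

lemma tf_shift_tf_adj [simp]: "tf_shift z (tf_adj z a) = a"
  by (simp add: tf_adj_def tf_shift_scaleC tf_shift_tf_shift tf_shift_0)

lemma cinner_tf_shift_left: "cinner (tf_shift z a) b = cinner a (tf_adj z b)"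
  by (metis cinner_tf_shift tf_shift_tf_adj)

lemma cinner_tf_shift_right: "cinner a (tf_shift z b) = cinner (tf_adj z a) b"
  by (metis cinner_tf_shift tf_shift_tf_adj)

lemma tf_adj_add: "tf_adj z (a + b) = tf_adj z a + tf_adj z b"
  by (simp add: tf_adj_def tf_shift_add scaleC_add_right)

lemma tf_adj_scaleC: "tf_adj z (c *\<^sub>C a) = c *\<^sub>C tf_adj z a"
  by (simp add: tf_adj_def tf_shift_scaleC mult.commute)

lemma norm_tf_adj [simp]: "norm (tf_adj z a) = norm a"
  by (simp add: tf_adj_def norm_scaleC)

lemma tf_adj_tf_adj:
  "tf_adj (w + z) a = ee (- (snd z \<bullet> fst w)) *\<^sub>C tf_adj z (tf_adj w a)"
  by (rule cinner_eqI[symmetric])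
     (simp add: cinner_scaleC_left cinner_tf_shift_right[symmetric] tf_shift_tf_shift cinner_scaleC_right cnj_ee flip: ee_add)

lemma cadjoint_tf_shift: "cadjoint (tf_shift z) = tf_adj z"
  unfolding cadjoint_def
proof (rule the_equality)
  show "\<forall>\<psi> \<phi>. cinner (tf_shift z \<psi>) \<phi> = cinner \<psi> (tf_adj z \<phi>)"
    by (simp add: cinner_tf_shift_left)
  fix S assume S: "\<forall>\<psi> \<phi>. cinner (tf_shift z \<psi>) \<phi> = cinner \<psi> (S \<phi>)"
  show "S = tf_adj z"
  proof
    fix a
    show "S a = tf_adj z a"
    proof (rule cinner_eqI)
      fix \<eta>
      have "cinner \<eta> (S a) = cinner \<eta> (tf_adj z a)" using S by (simp add: cinner_tf_shift_left)
      then show "cinner (S a) \<eta> = cinner (tf_adj z a) \<eta>" by (metis cinner_commute)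
    qed
  qed
qed

lemma op_shift_apply: "op_shift z R a = tf_shift z (R (tf_adj z a))"
  by (simp add: op_shift_def cadjoint_tf_shift)

lemma cinner_op_shift: "cinner (op_shift z R a) b = cinner (R (tf_adj z a)) (tf_adj z b)"
  by (simp add: op_shift_apply cinner_tf_shift_left)

text \<open>The phase of \<open>tf_adj_tf_adj\<close> enters both slots of the inner product and
  cancels. Hence conjugation by shifts is a genuine group action although the shifts themselves are
  only projective.\<close>

lemma cinner_op_shift_add:
  assumes "bounded_clinear R"
  shows "cinner (op_shift (w + z) R a) b = cinner (op_shift z R (tf_adj w a)) (tf_adj w b)"
  by (simp add: cinner_op_shift tf_adj_tf_adj[of w z] bounded_clinear_imp[OF assms] cinner_scaleC_left cinner_scaleC_right cnj_ee)

lemma bounded_clinear_op_shift: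
  assumes "bounded_clinear R"
  shows "bounded_clinear (op_shift z R)"
proof -
  obtain K where K: "\<And>x. norm (R x) \<le> K * norm x" using bounded_clinear_bound[OF assms] by blast
  show ?thesis
    by (rule bounded_clinearI[where K=K])
       (use K[of "tf_adj z _"] in \<open>auto simp: op_shift_apply tf_adj_add tf_adj_scaleC tf_shift_add tf_shift_scaleC bounded_clinear_imp[OF assms]\<close>)
qed

lemma parity_parity [simp]: "parity (parity a) = a"
  by transfer (simp add: L2_rel_refl_iff L2_rel_def)

lemma op_check_op_check [simp]: "op_check (op_check R) = R"
  by (simp add: op_check_def fun_eq_iff)

lemma cohen_eq:
  assumes "bounded_clinear R"
  shows "cohen R \<psi> z = cinner (op_shift z R \<psi>) \<psi>"
  unfolding cohen_def op_op_conv_def op_check_op_check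
  by (rule trace_rank_one[OF bounded_clinear_op_shift[OF assms]])

section \<open>Strong continuity of time-frequency shifts\<close>

text \<open>Monotonicity of \<open>a \<mapsto> norm a *\<^sub>R a\<close>: twice its inner product
  with \<open>a - b\<close> exceeds \<open>(norm a + norm b) * (norm (a - b))\<^sup>2\<close> by
  \<open>(norm a - norm b)\<^sup>2 * (norm a + norm b)\<close>. Applied pointwise, it deduces
  \<open>L2\<close> continuity of translation from the \<open>L1\<close> case for
  \<open>cmod (f t) *\<^sub>R f t\<close>.\<close>

lemma norm_diff_square_le:
  fixes a b :: "'h::real_inner"
  shows "(norm (a - b))\<^sup>2 \<le> 2 * norm (norm a *\<^sub>R a - norm b *\<^sub>R b)"
proof (cases "a = b")
  case False
  let ?A = "norm a" and ?B = "norm b" and ?d = "norm (a - b)"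
  have d: "?d\<^sup>2 = ?A\<^sup>2 + ?B\<^sup>2 - 2 * inner a b"
    by (simp add: power2_norm_eq_inner inner_diff_left inner_diff_right inner_commute)
  have "?d \<le> ?A + ?B" by (rule norm_triangle_ineq4)
  then have "?d * ?d\<^sup>2 \<le> (?A + ?B) * ?d\<^sup>2" by (intro mult_right_mono) auto
  also have "\<dots> \<le> 2 * inner (?A *\<^sub>R a - ?B *\<^sub>R b) (a - b)"
  proof -
    have "2 * inner (?A *\<^sub>R a - ?B *\<^sub>R b) (a - b) - (?A + ?B) * ?d\<^sup>2 = (?A - ?B)\<^sup>2 * (?A + ?B)"
      unfolding d by (simp add: inner_diff_left inner_diff_right inner_commute[of b a] power2_norm_eq_inner[symmetric] power2_eq_square[of "norm _ - norm _"] algebra_simps power2_eq_square dot_square_norm)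
    moreover have "0 \<le> (?A - ?B)\<^sup>2 * (?A + ?B)" by simp
    ultimately show ?thesis by linarith
  qed
  also have "\<dots> \<le> 2 * (norm (?A *\<^sub>R a - ?B *\<^sub>R b) * ?d)"
    using norm_cauchy_schwarz[of "?A *\<^sub>R a - ?B *\<^sub>R b" "a - b"] by simp
  finally have "?d * ?d\<^sup>2 \<le> ?d * (2 * norm (?A *\<^sub>R a - ?B *\<^sub>R b))"
    by (simp only: mult_ac)
  then show ?thesis using False by (subst (asm) mult_le_cancel_left_pos) auto
qed simp

lemma translation_continuous_L2:
  assumes f: "square_integrable f" and x: "x \<longlonglongrightarrow> 0"
  shows "(\<lambda>n. LINT t|lborel. (cmod (f (t - x n) - f t))\<^sup>2) \<longlonglongrightarrow> 0"
proof -
  have [measurable]: "f \<in> borel_measurable borel" using f by (simp add: square_integrable_def)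
  define F where "F t = cmod (f t) *\<^sub>R f t" for t
  have F: "integrable lborel F"
  proof (rule Bochner_Integration.integrable_bound)
    show "integrable lborel (\<lambda>t. (cmod (f t))\<^sup>2)" using f by (simp add: square_integrable_def)
    show "F \<in> borel_measurable lborel" unfolding F_def by measurable
  qed (simp add: F_def power2_eq_square)
  have sh: "square_integrable (\<lambda>t. f (t - a))" for a
    using square_integrable_affine[OF f, of 1 "- a"] by simp
  show ?thesis
  proof (rule tendsto_sandwich[OF _ _ tendsto_const])
    show "(\<lambda>n. 2 * (LINT t|lborel. norm (F (t - x n) - F t))) \<longlonglongrightarrow> 0"
      by (intro tendsto_mult_right_zero translation_continuous_L1[OF F x])
    have "(LINT t|lborel. (cmod (f (t - x n) - f t))\<^sup>2) \<le> (LINT t|lborel. 2 * norm (F (t - x n) - F t))" for n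
    proof (rule integral_mono)
      show "integrable lborel (\<lambda>t. (cmod (f (t - x n) - f t))\<^sup>2)"
        using square_integrable_diff[OF sh f] by (simp add: square_integrable_def)
      show "integrable lborel (\<lambda>t. 2 * norm (F (t - x n) - F t))"
        using integrable_translate(3)[OF F, of "x n"] F by auto
      show "(cmod (f (t - x n) - f t))\<^sup>2 \<le> 2 * norm (F (t - x n) - F t)" for t
        unfolding F_def by (rule norm_diff_square_le)
    qed
    then show "eventually (\<lambda>n. (LINT t|lborel. (cmod (f (t - x n) - f t))\<^sup>2) \<le> 2 * (LINT t|lborel. norm (F (t - x n) - F t))) sequentially"
      by simp
  qed simp
qed

lemma bounded_bilinear_scaleC: "bounded_bilinear scaleC"
proof
  fix a a' :: complex and b b' :: "'a L2" and r :: real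
  show "(a + a') *\<^sub>C b = a *\<^sub>C b + a' *\<^sub>C b"
    by transfer (auto simp: L2_rel_def distrib_right intro!: square_integrable_add square_integrable_cmult)
  show "a *\<^sub>C (b + b') = a *\<^sub>C b + a *\<^sub>C b'" by (rule scaleC_add_right)
  show "(r *\<^sub>R a) *\<^sub>C b = r *\<^sub>R a *\<^sub>C b" by (simp add: scaleR_L2_def scaleR_conv_of_real)
  show "a *\<^sub>C r *\<^sub>R b = r *\<^sub>R a *\<^sub>C b" by (simp add: scaleR_L2_def mult.commute)
  show "\<exists>K. \<forall>a (b::'a L2). norm (a *\<^sub>C b) \<le> norm a * norm b * K"
    by (rule exI[of _ 1]) (simp add: norm_scaleC)
qed

lemmas tendsto_scaleC [tendsto_intros] = bounded_bilinear.tendsto[OF bounded_bilinear_scaleC]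
lemmas continuous_on_scaleC [continuous_intros] = bounded_bilinear.continuous_on[OF bounded_bilinear_scaleC]

text \<open>The error splits into a translation part, small by
  \<open>translation_continuous_L2\<close>, and a modulation part, small by dominated convergence
  since \<open>cmod (ee s - 1) \<le> 2\<close>.\<close>

lemma tf_shift_continuous_at_0:
  fixes z :: "nat \<Rightarrow> 'a::euclidean_space \<times> 'a"
  assumes z: "z \<longlonglongrightarrow> 0"
  shows "(\<lambda>n. tf_shift (z n) a) \<longlonglongrightarrow> a"
proof -
  obtain f where f: "square_integrable f" "a = abs_L2 f" by (metis L2_cases)
  have [measurable]: "f \<in> borel_measurable borel" using f by (simp add: square_integrable_def)
  have x0: "(\<lambda>n. fst (z n)) \<longlonglongrightarrow> 0" and w0: "(\<lambda>n. snd (z n)) \<longlonglongrightarrow> 0"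
    using tendsto_fst[OF z] tendsto_snd[OF z] by simp_all
  let ?g = "\<lambda>n t. ee (snd (z n) \<bullet> t) * f (t - fst (z n))"
  have sq: "square_integrable (?g n)" for n by (rule square_integrable_tf[OF f(1)])
  have sh: "square_integrable (\<lambda>t. f (t - fst (z n)))" for n
    using square_integrable_affine[OF f(1), of 1 "- fst (z n)"] by simp
  have int1: "integrable lborel (\<lambda>t. (cmod (f (t - fst (z n)) - f t))\<^sup>2)" for n
    using square_integrable_diff[OF sh f(1)] by (simp add: square_integrable_def)
  have int2: "integrable lborel (\<lambda>t. (cmod ((ee (snd (z n) \<bullet> t) - 1) * f t))\<^sup>2)" for n
  proof -
    have "square_integrable (\<lambda>t. ee (snd (z n) \<bullet> t) * f (t - 0) - f t)"
      by (rule square_integrable_diff[OF square_integrable_tf[OF f(1)] f(1)])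
    then show ?thesis by (simp add: square_integrable_def left_diff_distrib)
  qed
  have "(\<lambda>n. LINT t|lborel. (cmod ((ee (snd (z n) \<bullet> t) - 1) * f t))\<^sup>2) \<longlonglongrightarrow> (LINT t::'a|lborel. 0)"
  proof (rule integral_dominated_convergence[where w="\<lambda>t. 4 * (cmod (f t))\<^sup>2"])
    show "AE t in lborel. (\<lambda>n. (cmod ((ee (snd (z n) \<bullet> t) - 1) * f t))\<^sup>2) \<longlonglongrightarrow> 0"
    proof (rule AE_I2)
      fix t
      have "(\<lambda>n. (cmod ((ee (snd (z n) \<bullet> t) - 1) * f t))\<^sup>2) \<longlonglongrightarrow> (cmod ((ee (0 \<bullet> t) - 1) * f t))\<^sup>2"
        by (intro tendsto_intros w0)
      then show "(\<lambda>n. (cmod ((ee (snd (z n) \<bullet> t) - 1) * f t))\<^sup>2) \<longlonglongrightarrow> 0" by simp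
    qed
    have "cmod (ee s - 1) \<le> 2" for s
      using norm_triangle_ineq4[of "ee s" 1] by simp
    then have "(cmod (ee s - 1))\<^sup>2 \<le> 2\<^sup>2" for s by (intro power_mono) auto
    then show "AE t in lborel. norm ((cmod ((ee (snd (z n) \<bullet> t) - 1) * f t))\<^sup>2) \<le> 4 * (cmod (f t))\<^sup>2" for n
      by (auto simp: norm_mult power_mult_distrib intro!: mult_right_mono)
  qed (use f in \<open>auto simp: square_integrable_def\<close>)
  moreover have "(\<lambda>n. LINT t|lborel. (cmod (f (t - fst (z n)) - f t))\<^sup>2) \<longlonglongrightarrow> 0"
    by (rule translation_continuous_L2[OF f(1) x0])
  ultimately have lim: "(\<lambda>n. 2 * (LINT t|lborel. (cmod (f (t - fst (z n)) - f t))\<^sup>2)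
      + 2 * (LINT t|lborel. (cmod ((ee (snd (z n) \<bullet> t) - 1) * f t))\<^sup>2)) \<longlonglongrightarrow> 0"
    by (auto intro!: tendsto_eq_intros)
  have bound: "(norm (tf_shift (z n) a - a))\<^sup>2 \<le> 2 * (LINT t|lborel. (cmod (f (t - fst (z n)) - f t))\<^sup>2)
      + 2 * (LINT t|lborel. (cmod ((ee (snd (z n) \<bullet> t) - 1) * f t))\<^sup>2)" for n
  proof -
    have zn: "z n = (fst (z n), snd (z n))" by simp
    have "tf_shift (z n) a - a = abs_L2 (\<lambda>t. ?g n t - f t)"
      by (subst zn) (simp only: f(2) tf_shift_abs[OF f(1)] minus_abs[OF sq f(1)])
    then have "(norm (tf_shift (z n) a - a))\<^sup>2 = (LINT t|lborel. (cmod (?g n t - f t))\<^sup>2)"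
      using norm_abs_L2[OF square_integrable_diff[OF sq f(1)]] by simp
    also have "\<dots> \<le> (LINT t|lborel. 2 * (cmod (f (t - fst (z n)) - f t))\<^sup>2 + 2 * (cmod ((ee (snd (z n) \<bullet> t) - 1) * f t))\<^sup>2)"
    proof (rule integral_mono)
      show "integrable lborel (\<lambda>t. (cmod (?g n t - f t))\<^sup>2)"
        using square_integrable_diff[OF sq f(1)] by (simp add: square_integrable_def)
      show "integrable lborel (\<lambda>t. 2 * (cmod (f (t - fst (z n)) - f t))\<^sup>2 + 2 * (cmod ((ee (snd (z n) \<bullet> t) - 1) * f t))\<^sup>2)"
        using int1 int2 by (intro Bochner_Integration.integrable_add integrable_mult_right) auto
      fix t
      let ?p = "f (t - fst (z n)) - f t" and ?q = "(ee (snd (z n) \<bullet> t) - 1) * f t"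
      have "?g n t - f t = ee (snd (z n) \<bullet> t) * ?p + ?q" by (simp add: algebra_simps)
      then have "cmod (?g n t - f t) \<le> cmod ?p + cmod ?q"
        using norm_triangle_ineq[of "ee (snd (z n) \<bullet> t) * ?p" ?q] by (simp add: norm_mult)
      then have "(cmod (?g n t - f t))\<^sup>2 \<le> (cmod ?p + cmod ?q)\<^sup>2" by (intro power_mono) auto
      also have "\<dots> \<le> 2 * (cmod ?p)\<^sup>2 + 2 * (cmod ?q)\<^sup>2"
        using sum_squares_bound[of "cmod ?p" "cmod ?q"] by (simp add: power2_sum)
      finally show "(cmod (?g n t - f t))\<^sup>2 \<le> 2 * (cmod ?p)\<^sup>2 + 2 * (cmod ?q)\<^sup>2" .
    qed
    also have "\<dots> = 2 * (LINT t|lborel. (cmod (f (t - fst (z n)) - f t))\<^sup>2)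
      + 2 * (LINT t|lborel. (cmod ((ee (snd (z n) \<bullet> t) - 1) * f t))\<^sup>2)"
      using int1 int2 by (subst Bochner_Integration.integral_add) auto
    finally show ?thesis .
  qed
  have "(\<lambda>n. (norm (tf_shift (z n) a - a))\<^sup>2) \<longlonglongrightarrow> 0"
    by (rule tendsto_sandwich[OF _ _ tendsto_const lim]) (use bound in auto)
  then have "(\<lambda>n. sqrt ((norm (tf_shift (z n) a - a))\<^sup>2)) \<longlonglongrightarrow> sqrt 0"
    by (rule tendsto_real_sqrt)
  then show ?thesis by (simp add: LIM_zero_iff tendsto_norm_zero_iff)
qed

lemma LIMSEQ_tf_shift:
  fixes z :: "nat \<Rightarrow> 'a::euclidean_space \<times> 'a"
  assumes z: "z \<longlonglongrightarrow> l" and a: "a \<longlonglongrightarrow> b"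
  shows "(\<lambda>n. tf_shift (z n) (a n)) \<longlonglongrightarrow> tf_shift l b"
proof -
  have z0: "(\<lambda>n. z n - l) \<longlonglongrightarrow> 0" using z by (simp add: LIM_zero)
  \<comment> \<open>The composition law transports continuity from 0 to \<open>l\<close>, at the
    cost of a phase that tends to 1.\<close>
  have eq: "tf_shift (z n) b = ee (snd l \<bullet> fst (z n - l)) *\<^sub>C tf_shift (z n - l) (tf_shift l b)" for n
    by (simp add: tf_shift_tf_shift)
  have "(\<lambda>n. ee (snd l \<bullet> fst (z n - l)) *\<^sub>C tf_shift (z n - l) (tf_shift l b)) \<longlonglongrightarrow> ee (snd l \<bullet> fst (0::'a \<times> 'a)) *\<^sub>C tf_shift l b"
    by (intro tendsto_intros tf_shift_continuous_at_0 z0)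
  then have 1: "(\<lambda>n. tf_shift (z n) b) \<longlonglongrightarrow> tf_shift l b" unfolding eq[symmetric] by simp
  have "(\<lambda>n. norm (a n - b)) \<longlonglongrightarrow> 0" using a by (simp add: LIM_zero tendsto_norm_zero)
  then have "(\<lambda>n. norm (tf_shift (z n) (a n - b))) \<longlonglongrightarrow> 0" by simp
  then have "(\<lambda>n. tf_shift (z n) (a n - b)) \<longlonglongrightarrow> 0" by (rule tendsto_norm_zero_cancel)
  from tendsto_add[OF this 1] show ?thesis by (simp add: tf_shift_diff)
qed

lemma continuous_on_tf_shift [continuous_intros]:
  fixes g :: "'b::metric_space \<Rightarrow> 'a::euclidean_space \<times> 'a"
  assumes "continuous_on S g" "continuous_on S a"
  shows "continuous_on S (\<lambda>x. tf_shift (g x) (a x))"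
  using assms unfolding continuous_on_sequentially by (auto simp: o_def intro!: LIMSEQ_tf_shift)

lemma continuous_on_tf_adj [continuous_intros]:
  fixes g :: "'b::metric_space \<Rightarrow> 'a::euclidean_space \<times> 'a"
  assumes "continuous_on S g" "continuous_on S a"
  shows "continuous_on S (\<lambda>x. tf_adj (g x) (a x))"
  unfolding tf_adj_def by (intro continuous_intros assms)

lemma continuous_on_bounded_clinear:
  "bounded_clinear R \<Longrightarrow> continuous_on S a \<Longrightarrow> continuous_on S (\<lambda>x. R (a x))"
  using bounded_linear.continuous_on[OF bounded_clinear_imp(1)] by blast

section \<open>Plancherel and Moyal identities\<close>

text \<open>Gaussian regularisation: \<open>\<integral> |F\<^sup>^|\<^sup>2 gauss c\<close> equals an average of the autocorrelation of \<open>F\<close>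
  over a Gaussian of width \<open>c\<close>, and \<open>c \<rightarrow> 0\<close>.\<close>

lemma plancherel:
  fixes f :: "'a::euclidean_space \<Rightarrow> complex"
  assumes sq: "square_integrable f" and int: "integrable lborel f"
  shows "(\<integral>\<^sup>+\<omega>. ennreal ((cmod (LINT t|lborel. f t * ee (- (\<omega> \<bullet> t))))\<^sup>2) \<partial>lborel) = ennreal ((norm (abs_L2 f))\<^sup>2)"
proof -
  have [measurable]: "f \<in> borel_measurable borel" using sq by (simp add: square_integrable_def)
  define a where "a = abs_L2 f"
  define F where "F \<omega> = (LINT t|lborel. f t * ee (- (\<omega> \<bullet> t)))" for \<omega>
  define N where "N = (LINT t|lborel. cmod (f t))"
  have [measurable]: "F \<in> borel_measurable borel" unfolding F_def by measurable
  have N0: "N \<ge> 0" unfolding N_def by simp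
  have FN: "cmod (F \<omega>) \<le> N" for \<omega>
    unfolding F_def N_def
    by (rule order_trans[OF integral_norm_bound]) (simp add: norm_mult)
  have intF: "integrable lborel (\<lambda>t. f t * ee (- (\<omega> \<bullet> t)))" for \<omega>
    by (rule Bochner_Integration.integrable_bound[OF int]) (auto simp: norm_mult)
  \<comment> \<open>As an inner product of \<open>a\<close> with one of its translates, the
    autocorrelation inherits continuity and the bound \<open>(norm a)\<^sup>2\<close> from
    \<open>tf_shift\<close>.\<close>
  define \<phi> where "\<phi> u = (LINT t|lborel. f t * cnj (f (t + u)))" for u
  have sh: "square_integrable (\<lambda>t. f (t + u))" for u
    using square_integrable_affine[OF sq, of 1 u] by (simp add: add.commute)
  have intff: "integrable lborel (\<lambda>t. f t * cnj (f (t + u)))" for u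
    by (rule square_integrable_mult_cnj[OF sq sh])
  have tf: "tf_shift (- u, 0) a = abs_L2 (\<lambda>t. f (t + u))" for u
    unfolding a_def by (subst tf_shift_abs[OF sq]) simp
  have \<phi>: "\<phi> u = cinner a (tf_shift (- u, 0) a)" for u
    unfolding tf unfolding a_def \<phi>_def by (simp add: cinner_abs sq sh)
  have boundff: "(LINT t|lborel. cmod (f t) * cmod (f (t + u))) \<le> (norm a)\<^sup>2" for u
  proof -
    have "norm (abs_L2 (\<lambda>t. f (t + u))) = norm a"
      unfolding tf[symmetric] by simp
    then show ?thesis
      using integral_norm_mult_le[OF sq sh, of u] by (simp add: a_def power2_eq_square)
  qed
  have A: "(LINT \<omega>|lborel. (cmod (F \<omega>))\<^sup>2 * gauss c \<omega>) = Re (LINT v|lborel. gauss 1 v * \<phi> (c *\<^sub>R v))"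
    and iA: "integrable lborel (\<lambda>\<omega>. (cmod (F \<omega>))\<^sup>2 * gauss c \<omega>)" if c: "c > 0" for c
  proof -
    have gp: "0 < gauss c (x::'a)" for c x by (rule gauss_pos)
    show iA: "integrable lborel (\<lambda>\<omega>. (cmod (F \<omega>))\<^sup>2 * gauss c \<omega>)"
    proof (rule Bochner_Integration.integrable_bound)
      show "integrable lborel (\<lambda>\<omega>::'a. N\<^sup>2 * gauss c \<omega>)" using c by simp
      show "AE \<omega> in lborel. norm ((cmod (F \<omega>))\<^sup>2 * gauss c \<omega>) \<le> norm (N\<^sup>2 * gauss c \<omega>)"
        using FN gp[of c] by (auto intro!: mult_right_mono power_mono simp: abs_mult less_imp_le)
    qed simp
    \<comment> \<open>The Fourier transform of \<open>gauss c\<close>: a Gaussian of width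
      proportional to \<open>c\<close> and integral 1, hence an approximate identity as
      \<open>c\<close> tends to 0.\<close>
    define k where "k u = gauss (1 / c) u / c ^ DIM('a)" for u :: 'a
    have k0: "k u \<ge> 0" for u using c by (simp add: k_def less_imp_le[OF gauss_pos])
    have [measurable]: "k \<in> borel_measurable borel" unfolding k_def by measurable
    have ik: "integrable lborel k" unfolding k_def using c by simp
    have kk: "(LINT \<omega>|lborel. ee (u \<bullet> \<omega>) * gauss c \<omega>) = complex_of_real (k u)" for u
      using has_bochner_integral_gauss_ee[OF c, of u] by (simp add: k_def has_bochner_integral_iff)
    have "complex_of_real (LINT \<omega>|lborel. (cmod (F \<omega>))\<^sup>2 * gauss c \<omega>) = (LINT \<omega>|lborel. F \<omega> * cnj (F \<omega>) * gauss c \<omega>)"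
      by (simp add: integral_complex_of_real[symmetric] complex_norm_square del: of_real_power)
    also have "\<dots> = (LINT \<omega>|lborel. LINT t|lborel. f t * ee (- (\<omega> \<bullet> t)) * (cnj (F \<omega>) * gauss c \<omega>))"
      by (simp only: integral_mult_left_zero F_def[symmetric] mult.assoc[of "F _"])
    also have "\<dots> = (LINT t|lborel. LINT \<omega>|lborel. f t * ee (- (\<omega> \<bullet> t)) * (cnj (F \<omega>) * gauss c \<omega>))"
    proof (rule Fubini_lborel(3))
      show "integrable lborel (\<lambda>t. f t * ee (- (\<omega> \<bullet> t)) * (cnj (F \<omega>) * gauss c \<omega>))" for \<omega>
        using intF by simp
      have "(LINT t|lborel. norm (f t * ee (- (\<omega> \<bullet> t)) * (cnj (F \<omega>) * gauss c \<omega>))) = N * (cmod (F \<omega>) * gauss c \<omega>)" for \<omega>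
        using gp[of c \<omega>] by (simp add: norm_mult N_def)
      also have "\<dots> \<omega> \<le> N * (N * gauss c \<omega>)" for \<omega>
        using gp[of c \<omega>] FN[of \<omega>] N0 by (intro mult_left_mono mult_right_mono) auto
      finally show "(LINT t|lborel. norm (f t * ee (- (\<omega> \<bullet> t)) * (cnj (F \<omega>) * gauss c \<omega>))) \<le> N * (N * gauss c \<omega>)" for \<omega> .
      show "integrable lborel (\<lambda>\<omega>::'a. N * (N * gauss c \<omega>))" using c by simp
    qed measurable
    \<comment> \<open>Once the conjugate factor is expanded as well, the integral over \<omega> is
      the Gaussian transform at \<open>s - t\<close>; the substitution \<open>s = t + u\<close>
      exhibits the autocorrelation.\<close>
    also have "\<dots> = (LINT t|lborel. LINT u|lborel. f t * cnj (f (t + u)) * k u)"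
    proof (rule Bochner_Integration.integral_cong[OF refl])
      fix t
      have cF: "cnj (F \<omega>) = (LINT s|lborel. cnj (f s) * ee (\<omega> \<bullet> s))" for \<omega>
        unfolding F_def by (subst Bochner_Integration.integral_cnj[symmetric]) (simp add: cnj_ee)
      have "(LINT \<omega>|lborel. f t * ee (- (\<omega> \<bullet> t)) * (cnj (F \<omega>) * gauss c \<omega>)) =
        f t * (LINT \<omega>|lborel. LINT s|lborel. cnj (f s) * (ee ((s - t) \<bullet> \<omega>) * gauss c \<omega>))"
      proof -
        have "ee ((s - t) \<bullet> \<omega>) = ee (- (\<omega> \<bullet> t)) * ee (\<omega> \<bullet> s)" for s \<omega>
          unfolding ee_add[symmetric] by (simp add: inner_diff_left inner_commute[of s] inner_commute[of t])
        then have "(LINT s|lborel. cnj (f s) * (ee ((s - t) \<bullet> \<omega>) * gauss c \<omega>)) =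
            (LINT s|lborel. cnj (f s) * ee (\<omega> \<bullet> s) * (ee (- (\<omega> \<bullet> t)) * gauss c \<omega>))" for \<omega>
          by (simp add: mult_ac)
        then have "(LINT s|lborel. cnj (f s) * (ee ((s - t) \<bullet> \<omega>) * gauss c \<omega>)) = ee (- (\<omega> \<bullet> t)) * (cnj (F \<omega>) * gauss c \<omega>)" for \<omega>
          unfolding integral_mult_left_zero cF by (simp only: mult_ac)
        then show ?thesis by (simp only: integral_mult_right_zero mult.assoc)
      qed
      also have "(LINT \<omega>|lborel. LINT s|lborel. cnj (f s) * (ee ((s - t) \<bullet> \<omega>) * gauss c \<omega>)) =
          (LINT s|lborel. LINT \<omega>|lborel. cnj (f s) * (ee ((s - t) \<bullet> \<omega>) * gauss c \<omega>))"
      proof (rule Fubini_lborel(3))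
        show "integrable lborel (\<lambda>s. cnj (f s) * (ee ((s - t) \<bullet> \<omega>) * gauss c \<omega>))" for \<omega>
        proof (rule Bochner_Integration.integrable_bound)
          show "integrable lborel (\<lambda>s. f s * gauss c \<omega>)" using int by simp
        qed (auto simp: norm_mult)
        show "(LINT s|lborel. norm (cnj (f s) * (ee ((s - t) \<bullet> \<omega>) * gauss c \<omega>))) \<le> N * gauss c \<omega>" for \<omega>
          using gp[of c \<omega>] by (simp add: norm_mult N_def)
        show "integrable lborel (\<lambda>\<omega>::'a. N * gauss c \<omega>)" using c by simp
      qed measurable
      also have "\<dots> = (LINT s|lborel. cnj (f s) * k (s - t))"
        by (simp add: kk)
      also have "\<dots> = (LINT u|lborel. cnj (f (t + u)) * k u)"
        using integral_translate(1)[of "\<lambda>s. cnj (f s) * complex_of_real (k (s - t))" t] by simp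
      finally show "(LINT \<omega>|lborel. f t * ee (- (\<omega> \<bullet> t)) * (cnj (F \<omega>) * gauss c \<omega>)) = (LINT u|lborel. f t * cnj (f (t + u)) * k u)"
        by (simp add: mult.assoc)
    qed
    finally have 1: "complex_of_real (LINT \<omega>|lborel. (cmod (F \<omega>))\<^sup>2 * gauss c \<omega>) = (LINT t|lborel. LINT u|lborel. f t * cnj (f (t + u)) * k u)" .
    have int3: "integrable lborel (\<lambda>t. f t * cnj (f (t + u)) * complex_of_real (k u))" for u
      using intff by simp
    have "(LINT t|lborel. norm (f t * cnj (f (t + u)) * complex_of_real (k u))) = (LINT t|lborel. cmod (f t) * cmod (f (t + u))) * k u" for u
      using k0[of u] by (simp add: norm_mult)
    then have bd: "(LINT t|lborel. norm (f t * cnj (f (t + u)) * complex_of_real (k u))) \<le> (norm a)\<^sup>2 * k u" for u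
      using boundff[of u] k0[of u] by (simp add: mult_right_mono)
    have iG: "integrable lborel (\<lambda>u. (norm a)\<^sup>2 * k u)" using ik by simp
    have m: "(\<lambda>(u, t). f t * cnj (f (t + u)) * complex_of_real (k u)) \<in> borel_measurable (borel \<Otimes>\<^sub>M borel)"
      by measurable
    note Fub = Fubini_lborel[of "\<lambda>u t. f t * cnj (f (t + u)) * complex_of_real (k u)", OF m int3 bd iG]
    have eqphi: "(LINT t|lborel. f t * cnj (f (t + u)) * complex_of_real (k u)) = k u * \<phi> u" for u
      by (simp add: \<phi>_def)
    have 2: "(LINT t|lborel. LINT u|lborel. f t * cnj (f (t + u)) * k u) = (LINT u|lborel. k u * \<phi> u)"
      unfolding eqphi[symmetric] by (rule Fub(3)[symmetric])
    have 3: "integrable lborel (\<lambda>u. k u * \<phi> u)" using Fub(1) unfolding eqphi .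
    have "complex_of_real (k (c *\<^sub>R v)) * \<phi> (c *\<^sub>R v) = (gauss 1 v * \<phi> (c *\<^sub>R v)) / of_real (c ^ DIM('a))" for v
      using c by (simp add: k_def gauss_def)
    then have "(LINT u|lborel. k u * \<phi> u) = (LINT v|lborel. gauss 1 v * \<phi> (c *\<^sub>R v))"
      using integral_dilation(2)[OF 3 c] c by (simp add: scaleR_conv_of_real)
    with 1 2 show "(LINT \<omega>|lborel. (cmod (F \<omega>))\<^sup>2 * gauss c \<omega>) = Re (LINT v|lborel. gauss 1 v * \<phi> (c *\<^sub>R v))"
      by (metis Re_complex_of_real)
  qed
  define c where "c n = 1 / real (Suc n)" for n
  have c: "c n > 0" for n by (simp add: c_def)
  have c0: "c \<longlonglongrightarrow> 0" unfolding c_def by (rule LIMSEQ_Suc[OF lim_1_over_n])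
  have "(\<lambda>n. LINT v|lborel. gauss 1 v * \<phi> (c n *\<^sub>R v)) \<longlonglongrightarrow> (LINT v::'a|lborel. gauss 1 v * (complex_of_real ((norm a)\<^sup>2)))"
  proof (rule integral_dominated_convergence[where w="\<lambda>v. gauss 1 v * (norm a)\<^sup>2"])
    have [measurable]: "\<phi> \<in> borel_measurable borel"
      unfolding \<phi> by (intro borel_measurable_continuous_onI continuous_intros)
    show "(\<lambda>v. complex_of_real (gauss 1 v) * \<phi> (c n *\<^sub>R v)) \<in> borel_measurable lborel" for n by measurable
    show "(\<lambda>v::'a. complex_of_real (gauss 1 v) * complex_of_real ((norm a)\<^sup>2)) \<in> borel_measurable lborel" by measurable
    show "integrable lborel (\<lambda>v::'a. gauss 1 v * (norm a)\<^sup>2)" by simp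
    show "AE v in lborel. (\<lambda>n. gauss 1 v * \<phi> (c n *\<^sub>R v)) \<longlonglongrightarrow> gauss 1 v * complex_of_real ((norm a)\<^sup>2)"
    proof (rule AE_I2)
      fix v :: 'a
      have "(\<lambda>n. c n *\<^sub>R v) \<longlonglongrightarrow> 0 *\<^sub>R v" by (rule tendsto_scaleR[OF c0 tendsto_const])
      then have "(\<lambda>n. (- (c n *\<^sub>R v), 0::'a)) \<longlonglongrightarrow> (- (0 *\<^sub>R v), 0)"
        by (rule tendsto_Pair[OF tendsto_minus tendsto_const])
      from LIMSEQ_tf_shift[OF this tendsto_const[of a]]
      have "(\<lambda>n. cinner a (tf_shift (- (c n *\<^sub>R v), 0) a)) \<longlonglongrightarrow> cinner a (tf_shift (- (0 *\<^sub>R v), 0) a)"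
        by (rule tendsto_cinner[OF tendsto_const])
      moreover have "tf_shift (- (0 *\<^sub>R v), 0) a = a"
        using tf_shift_0[of a] by (simp add: zero_prod_def)
      ultimately have "(\<lambda>n. \<phi> (c n *\<^sub>R v)) \<longlonglongrightarrow> complex_of_real ((norm a)\<^sup>2)"
        unfolding \<phi> by (simp only: cinner_self)
      then show "(\<lambda>n. gauss 1 v * \<phi> (c n *\<^sub>R v)) \<longlonglongrightarrow> gauss 1 v * complex_of_real ((norm a)\<^sup>2)"
        by (intro tendsto_intros)
    qed
    show "AE v in lborel. norm (gauss 1 v * \<phi> (c n *\<^sub>R v)) \<le> gauss 1 v * (norm a)\<^sup>2" for n
    proof (rule AE_I2)
      fix v :: 'a
      show "norm (gauss 1 v * \<phi> (c n *\<^sub>R v)) \<le> gauss 1 v * (norm a)\<^sup>2"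
        using norm_cinner_le[of a "tf_shift (- (c n *\<^sub>R v), 0) a"] gauss_pos[of 1 v]
        by (simp add: norm_mult \<phi> power2_eq_square)
    qed
  qed
  from tendsto_Re[OF this] have lim: "(\<lambda>n. LINT \<omega>|lborel. (cmod (F \<omega>))\<^sup>2 * gauss (c n) \<omega>) \<longlonglongrightarrow> (norm a)\<^sup>2"
    unfolding A[OF c] by (simp add: integral_gauss flip: of_real_mult of_real_power)
  have nn: "(\<integral>\<^sup>+\<omega>. ennreal ((cmod (F \<omega>))\<^sup>2 * gauss (c n) \<omega>) \<partial>lborel) = ennreal (LINT \<omega>|lborel. (cmod (F \<omega>))\<^sup>2 * gauss (c n) \<omega>)" for n
    by (intro nn_integral_eq_integral iA[OF c] AE_I2 mult_nonneg_nonneg less_imp_le[OF gauss_pos] zero_le_power2)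
  \<comment> \<open>The weights \<open>gauss (c n)\<close> increase to 1, so monotone convergence
    applies before \<open>F\<close> is known to be square integrable.\<close>
  have "(\<lambda>n. \<integral>\<^sup>+\<omega>. ennreal ((cmod (F \<omega>))\<^sup>2 * gauss (c n) \<omega>) \<partial>lborel) \<longlonglongrightarrow> (\<integral>\<^sup>+\<omega>. ennreal ((cmod (F \<omega>))\<^sup>2) \<partial>lborel)"
  proof (rule nn_integral_LIMSEQ)
    show "incseq (\<lambda>n \<omega>. ennreal ((cmod (F \<omega>))\<^sup>2 * gauss (c n) \<omega>))"
    proof (intro incseq_SucI le_funI ennreal_leI mult_left_mono)
      fix n and \<omega> :: 'a
      have "c (Suc n) \<le> c n" by (simp add: c_def frac_le)
      then have "(c (Suc n) * norm \<omega>)\<^sup>2 \<le> (c n * norm \<omega>)\<^sup>2"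
        using c[of "Suc n"] by (intro power_mono mult_right_mono) auto
      then show "gauss (c n) \<omega> \<le> gauss (c (Suc n)) \<omega>" by (simp add: gauss_def)
    qed simp
    show "(\<lambda>n. ennreal ((cmod (F \<omega>))\<^sup>2 * gauss (c n) \<omega>)) \<longlonglongrightarrow> ennreal ((cmod (F \<omega>))\<^sup>2)" for \<omega>
    proof -
      have "(\<lambda>n. (cmod (F \<omega>))\<^sup>2 * gauss (c n) \<omega>) \<longlonglongrightarrow> (cmod (F \<omega>))\<^sup>2 * exp (- (pi * (0 * norm \<omega>)\<^sup>2))"
        unfolding gauss_def by (intro tendsto_intros c0)
      then show ?thesis by (intro tendsto_ennrealI) simp
    qed
  qed measurable
  moreover have "(\<lambda>n. \<integral>\<^sup>+\<omega>. ennreal ((cmod (F \<omega>))\<^sup>2 * gauss (c n) \<omega>) \<partial>lborel) \<longlonglongrightarrow> ennreal ((norm a)\<^sup>2)"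
    unfolding nn by (intro tendsto_ennrealI lim)
  ultimately show ?thesis
    unfolding F_def a_def by (rule LIMSEQ_unique)
qed

text \<open>For fixed \<open>x\<close> the transform is, in \<omega>, the Fourier transform of
  \<open>H x\<close>. Plancherel in \<omega> and Tonelli in \<open>x\<close> and \<open>t\<close>
  leave the product of the two norms.\<close>

lemma moyal_norm:
  fixes a b :: "('a::euclidean_space) L2"
  shows "(\<integral>\<^sup>+z. ennreal ((cmod (cinner a (tf_shift z b)))\<^sup>2) \<partial>lborel) = ennreal ((norm a)\<^sup>2 * (norm b)\<^sup>2)"
proof -
  obtain f where f: "square_integrable f" "a = abs_L2 f" by (metis L2_cases)
  obtain g where g: "square_integrable g" "b = abs_L2 g" by (metis L2_cases)
  have [measurable]: "f \<in> borel_measurable borel" "g \<in> borel_measurable borel"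
    using f g by (simp_all add: square_integrable_def)
  have sh: "square_integrable (\<lambda>t. g (t - x))" for x
    using square_integrable_affine[OF g(1), of 1 "- x"] by simp
  define H where "H x t = f t * cnj (g (t - x))" for x t
  have [measurable]: "(\<lambda>(x, t). H x t) \<in> borel_measurable (borel \<Otimes>\<^sub>M borel)" unfolding H_def by measurable
  have intH: "integrable lborel (H x)" for x
    unfolding H_def by (rule square_integrable_mult_cnj[OF f(1) sh])
  have V: "cinner a (tf_shift (x, \<omega>) b) = (LINT t|lborel. H x t * ee (- (\<omega> \<bullet> t)))" for x \<omega>
    unfolding f g tf_shift_abs[OF g(1)]
    by (subst cinner_abs[OF f(1) square_integrable_tf[OF g(1)]])
       (simp add: H_def cnj_ee mult_ac)
  have total: "(\<integral>\<^sup>+x. \<integral>\<^sup>+t. ennreal ((cmod (H x t))\<^sup>2) \<partial>lborel \<partial>lborel) = ennreal ((norm a)\<^sup>2 * (norm b)\<^sup>2)"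
  proof -
    have "(\<integral>\<^sup>+x. \<integral>\<^sup>+t. ennreal ((cmod (H x t))\<^sup>2) \<partial>lborel \<partial>lborel) = (\<integral>\<^sup>+t. \<integral>\<^sup>+x. ennreal ((cmod (H x t))\<^sup>2) \<partial>lborel \<partial>lborel)"
      by (rule lborel_pair.Fubini'[symmetric]) measurable
    also have "\<dots> = (\<integral>\<^sup>+t. ennreal ((cmod (f t))\<^sup>2) * ennreal ((norm b)\<^sup>2) \<partial>lborel)"
    proof (rule nn_integral_cong)
      fix t
      have i: "integrable lborel (\<lambda>x. (cmod (g x))\<^sup>2)" using g by (simp add: square_integrable_def)
      have "(\<integral>\<^sup>+x. ennreal ((cmod (H x t))\<^sup>2) \<partial>lborel) = (\<integral>\<^sup>+x. ennreal ((cmod (f t))\<^sup>2) * ennreal ((cmod (g (t - x)))\<^sup>2) \<partial>lborel)"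
        by (simp add: H_def norm_mult power_mult_distrib ennreal_mult)
      also have "\<dots> = ennreal ((cmod (f t))\<^sup>2) * (\<integral>\<^sup>+x. ennreal ((cmod (g (t - x)))\<^sup>2) \<partial>lborel)"
        by (rule nn_integral_cmult) measurable
      also have "(\<integral>\<^sup>+x. ennreal ((cmod (g (t - x)))\<^sup>2) \<partial>lborel) = ennreal (LINT x|lborel. (cmod (g (t - x)))\<^sup>2)"
        by (rule nn_integral_eq_integral[OF integrable_translate(4)[OF i]]) simp
      also have "(LINT x|lborel. (cmod (g (t - x)))\<^sup>2) = (norm b)\<^sup>2"
        unfolding integral_translate(4)[of "\<lambda>x. (cmod (g x))\<^sup>2"] g(2) norm_abs_L2[OF g(1)] ..
      finally show "(\<integral>\<^sup>+x. ennreal ((cmod (H x t))\<^sup>2) \<partial>lborel) = ennreal ((cmod (f t))\<^sup>2) * ennreal ((norm b)\<^sup>2)" .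
    qed
    also have "\<dots> = ennreal ((norm a)\<^sup>2) * ennreal ((norm b)\<^sup>2)"
      using nn_integral_norm_abs_L2[OF f(1)] by (subst nn_integral_multc) (auto simp: f(2))
    finally show ?thesis by (simp add: ennreal_mult)
  qed
  have "(\<integral>\<^sup>+z. ennreal ((cmod (cinner a (tf_shift z b)))\<^sup>2) \<partial>lborel) =
      (\<integral>\<^sup>+z. ennreal ((cmod (cinner a (tf_shift z b)))\<^sup>2) \<partial>(lborel \<Otimes>\<^sub>M lborel))"
    by (simp add: lborel_prod)
  also have "\<dots> = (\<integral>\<^sup>+x. \<integral>\<^sup>+\<omega>. ennreal ((cmod (cinner a (tf_shift (x, \<omega>) b)))\<^sup>2) \<partial>lborel \<partial>lborel)"
  proof (rule lborel.nn_integral_fst[symmetric])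
    have "(\<lambda>z. ennreal ((cmod (cinner a (tf_shift z b)))\<^sup>2)) \<in> borel_measurable borel"
      by (intro measurable_compose[OF _ measurable_ennreal] borel_measurable_continuous_onI continuous_intros)
    then show "(\<lambda>z. ennreal ((cmod (cinner a (tf_shift z b)))\<^sup>2)) \<in> borel_measurable (lborel \<Otimes>\<^sub>M lborel)"
      by (simp add: lborel_prod)
  qed
  also have "\<dots> = (\<integral>\<^sup>+x. \<integral>\<^sup>+t. ennreal ((cmod (H x t))\<^sup>2) \<partial>lborel \<partial>lborel)"
  proof (rule nn_integral_cong_AE)
    have "(\<integral>\<^sup>+x. \<integral>\<^sup>+t. ennreal ((cmod (H x t))\<^sup>2) \<partial>lborel \<partial>lborel) \<noteq> \<infinity>"
      unfolding total by simp
    \<comment> \<open>\<open>H x\<close> is integrable for every \<open>x\<close>, but as a product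
      of two \<open>L2\<close> functions it is square integrable only for almost every
      \<open>x\<close>.\<close>
    then have "AE x in lborel. (\<integral>\<^sup>+t. ennreal ((cmod (H x t))\<^sup>2) \<partial>lborel) \<noteq> \<infinity>"
      by (intro nn_integral_PInf_AE) measurable
    then show "AE x in lborel. (\<integral>\<^sup>+\<omega>. ennreal ((cmod (cinner a (tf_shift (x, \<omega>) b)))\<^sup>2) \<partial>lborel) = (\<integral>\<^sup>+t. ennreal ((cmod (H x t))\<^sup>2) \<partial>lborel)"
    proof eventually_elim
      case (elim x)
      then have sq: "square_integrable (H x)"
        unfolding square_integrable_def by (auto intro!: integrableI_bounded simp: less_top)
      show ?case
        unfolding V plancherel[OF sq intH] nn_integral_norm_abs_L2[OF sq] ..
    qed
  qed
  finally show ?thesis unfolding total .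
qed

lemma continuous_on_stft [continuous_intros]:
  "continuous_on S (\<lambda>z. cinner a (tf_shift z b))" "continuous_on S (\<lambda>z. cinner (tf_shift z b) a)"
  by (intro continuous_intros)+

lemma square_integrable_stft: "square_integrable (\<lambda>z. cinner a (tf_shift z b))"
  unfolding square_integrable_def
proof
  show [measurable]: "(\<lambda>z. cinner a (tf_shift z b)) \<in> borel_measurable lborel"
    by (simp add: borel_measurable_continuous_onI continuous_intros)
  show "integrable lborel (\<lambda>z. (cmod (cinner a (tf_shift z b)))\<^sup>2)"
    using moyal_norm[of a b] by (intro integrableI_bounded) auto
qed

lemma norm_stft: "norm (abs_L2 (\<lambda>z. cinner a (tf_shift z b))) = norm a * norm b"
proof (rule power2_eq_imp_eq)
  have "ennreal ((norm (abs_L2 (\<lambda>z. cinner a (tf_shift z b))))\<^sup>2) = ennreal ((norm a)\<^sup>2 * (norm b)\<^sup>2)"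
    unfolding nn_integral_norm_abs_L2[OF square_integrable_stft, symmetric] by (rule moyal_norm)
  then show "(norm (abs_L2 (\<lambda>z. cinner a (tf_shift z b))))\<^sup>2 = (norm a * norm b)\<^sup>2"
    by (simp add: power_mult_distrib)
qed auto

text \<open>Vanishing on \<open>a + c\<close> and on \<open>a + \<i> *\<^sub>C c\<close> gives two
  independent linear equations for \<open>D a c\<close> and \<open>D c a\<close>.\<close>

lemma polarization_zero:
  fixes D :: "('a::euclidean_space) L2 \<Rightarrow> 'a L2 \<Rightarrow> complex"
  assumes add: "\<And>a b c. D (a + b) c = D a c + D b c" "\<And>a b c. D c (a + b) = D c a + D c b"
    and sc: "\<And>k a c. D (k *\<^sub>C a) c = k * D a c" "\<And>k a c. D c (k *\<^sub>C a) = cnj k * D c a"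
    and diag: "\<And>a. D a a = 0"
  shows "D a c = 0"
proof -
  have 1: "D a c + D c a = 0" using diag[of "a + c"] unfolding add by (simp add: diag add.commute)
  have "\<i> * (D c a - D a c) = 0"
    using diag[of "a + \<i> *\<^sub>C c"] unfolding add sc by (simp add: diag algebra_simps)
  with 1 show ?thesis by simp
qed

text \<open>\<open>moyal_norm\<close> is the doubly diagonal case \<open>a = c\<close>,
  \<open>b = d\<close>. Both sides are sesquilinear in the pair \<open>a\<close>, \<open>c\<close>
  and in the pair \<open>d\<close>, \<open>b\<close>, so polarisation is applied once in each
  pair.\<close>

lemma moyal:
  fixes a b c d :: "('a::euclidean_space) L2"
  shows "integrable lborel (\<lambda>z. cinner a (tf_shift z b) * cinner (tf_shift z d) c)"
    and "(LINT z|lborel. cinner a (tf_shift z b) * cinner (tf_shift z d) c) = cinner a c * cinner d b"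
proof -
  define W where "W b a = abs_L2 (\<lambda>z. cinner a (tf_shift z b))" for a b :: "'a L2"
  note sq = square_integrable_stft
  have cn: "cinner (tf_shift z d) c = cnj (cinner c (tf_shift z d))" for z and c d :: "'a L2" by (rule cinner_commute)
  show "integrable lborel (\<lambda>z. cinner a (tf_shift z b) * cinner (tf_shift z d) c)"
    unfolding cn by (rule square_integrable_mult_cnj[OF sq sq])
  have W1: "W b (a + c) = W b a + W b c" "W b (k *\<^sub>C a) = k *\<^sub>C W b a" for a b c :: "'a L2" and k
    unfolding W_def by (simp_all add: plus_abs sq scaleC_abs cinner_add_left cinner_scaleC_left)
  have W2: "W (b + c) a = W b a + W c a" "W (k *\<^sub>C b) a = cnj k *\<^sub>C W b a" for a b c :: "'a L2" and k
    unfolding W_def by (simp_all add: plus_abs sq scaleC_abs tf_shift_add tf_shift_scaleC cinner_add_right cinner_scaleC_right)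
  have diag: "cinner (W b a) (W b a) = cinner a a * cinner b b" for a b :: "'a L2"
    by (simp add: cinner_self W_def norm_stft power_mult_distrib)
  have same: "cinner (W b a) (W b c) - cinner a c * cinner b b = 0" for a b c :: "'a L2"
    by (rule polarization_zero[where D="\<lambda>a c. cinner (W b a) (W b c) - cinner a c * cinner b b"])
       (simp_all add: W1 diag cinner_add_left cinner_add_right cinner_scaleC_left cinner_scaleC_right algebra_simps)
  have "cinner (W b a) (W d c) - cinner a c * cinner d b = 0"
    by (rule polarization_zero[where D="\<lambda>d b. cinner (W b a) (W d c) - cinner a c * cinner d b"])
       (use same in \<open>simp_all add: W2 cinner_add_left cinner_add_right cinner_scaleC_left cinner_scaleC_right algebra_simps\<close>)
  then show "(LINT z|lborel. cinner a (tf_shift z b) * cinner (tf_shift z d) c) = cinner a c * cinner d b"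
    unfolding cn W_def cinner_abs[OF sq sq] by simp
qed

lemma integral_norm_stft_le:
  "(LINT z|lborel. cmod (cinner a (tf_shift z b)) * cmod (cinner (tf_shift z d) c)) \<le> norm a * norm b * (norm c * norm d)"
proof -
  have "cmod (cinner (tf_shift z d) c) = cmod (cinner c (tf_shift z d))" for z
    by (subst cinner_commute) simp
  then show ?thesis
    using integral_norm_mult_le[OF square_integrable_stft square_integrable_stft, of a b c d]
    by (simp add: norm_stft)
qed

lemma tf_shift_commute: "tf_shift w (tf_shift z a) = ee (symplectic_form w z) *\<^sub>C tf_shift z (tf_shift w a)"
  unfolding tf_shift_tf_shift scaleC_scaleC add.commute[of z w] ee_add[symmetric] symplectic_form_def by simp

text \<open>Commuting \<open>tf_shift w\<close> past \<open>tf_shift z\<close> produces exactly the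
  symplectic character, so the modulated integral is a Moyal integral for the shifted
  vectors.\<close>

lemma moyal_fourier:
  fixes p q r s :: "('a::euclidean_space) L2"
  shows "(LINT z|lborel. cinner p (tf_shift z q) * cinner (tf_shift z r) s * ee (symplectic_form w z))
      = cinner (tf_shift w p) s * cinner r (tf_shift w q)"
proof -
  have "cinner p (tf_shift z q) * ee (symplectic_form w z) = cinner (tf_shift w p) (tf_shift z (tf_shift w q))" for z
  proof -
    have "cinner p (tf_shift z q) = cinner (tf_shift w p) (tf_shift w (tf_shift z q))" by simp
    also have "\<dots> = cnj (ee (symplectic_form w z)) * cinner (tf_shift w p) (tf_shift z (tf_shift w q))"
      unfolding tf_shift_commute[of w z] cinner_scaleC_right ..
    finally show ?thesis by (simp add: cnj_ee mult_ac)
  qed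
  then have "cinner p (tf_shift z q) * cinner (tf_shift z r) s * ee (symplectic_form w z)
    = cinner (tf_shift w p) (tf_shift z (tf_shift w q)) * cinner (tf_shift z r) s" for z
    by (subst mult.assoc, subst mult.commute[of "cinner (tf_shift z r) s"], subst mult.assoc[symmetric]) simp
  then show ?thesis by (simp only: moyal)
qed

lemma continuous_on_symplectic_form [continuous_intros]:
  "continuous_on S f \<Longrightarrow> continuous_on S g \<Longrightarrow> continuous_on S (\<lambda>x. symplectic_form (f x) (g x))"
  unfolding symplectic_form_def by (intro continuous_intros)

text \<open>Parseval for two products of short-time Fourier transforms, each being the symplectic Fourier
  transform of an integrable function by the Moyal identity.\<close>

lemma stft_parseval:
  fixes p q r s P Q R' S :: "('a::euclidean_space) L2"
  shows "(LINT z|lborel. cinner (tf_shift z P) S * cinner R' (tf_shift z Q) * (cinner p (tf_shift z q) * cinner (tf_shift z r) s))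
    = (LINT w|lborel. cinner P (tf_shift w Q) * cinner (tf_shift w R') S * (cinner p (tf_shift w s) * cinner (tf_shift w r) q))"
proof -
  let ?H = "\<lambda>w. cinner P (tf_shift w Q) * cinner (tf_shift w R') S"
  let ?G = "\<lambda>z. cinner p (tf_shift z q) * cinner (tf_shift z r) s"
  have "(LINT z|lborel. cinner (tf_shift z P) S * cinner R' (tf_shift z Q) * ?G z) =
    (LINT z|lborel. LINT w|lborel. ?H w * ee (symplectic_form z w) * ?G z)"
    unfolding moyal_fourier[symmetric] by simp
  also have "\<dots> = (LINT w|lborel. LINT z|lborel. ?H w * ee (symplectic_form z w) * ?G z)"
  proof (rule Fubini_lborel(3))
    show "(\<lambda>(z, w). ?H w * ee (symplectic_form z w) * ?G z) \<in> borel_measurable (borel \<Otimes>\<^sub>M borel)"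
      unfolding borel_prod split_beta by (intro borel_measurable_continuous_onI continuous_intros)
    have H: "integrable lborel (\<lambda>w. ?H w * ee (symplectic_form z w))" for z
    proof (rule Bochner_Integration.integrable_bound[OF moyal(1)[of P Q R' S]])
      show "(\<lambda>w. ?H w * ee (symplectic_form z w)) \<in> borel_measurable lborel"
        by (simp, intro borel_measurable_continuous_onI continuous_intros)
    qed (simp add: norm_mult)
    show "integrable lborel (\<lambda>w. ?H w * ee (symplectic_form z w) * ?G z)" for z
      using H by simp
    show "(LINT w|lborel. norm (?H w * ee (symplectic_form z w) * ?G z)) \<le> (LINT w|lborel. norm (?H w)) * norm (?G z)" for z
      by (simp add: norm_mult)
    show "integrable lborel (\<lambda>z. (LINT w|lborel. norm (?H w)) * norm (?G z))"
      using moyal(1) by (intro integrable_mult_right integrable_norm)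
  qed
  also have "\<dots> = (LINT w|lborel. ?H w * (cinner p (tf_shift w s) * cinner (tf_shift w r) q))"
  proof (rule Bochner_Integration.integral_cong[OF refl])
    fix w :: "'a \<times> 'a"
    \<comment> \<open>Antisymmetry turns the character evaluated at \<open>w\<close> into one
      evaluated at \<open>z\<close>, so the inner integral is again of the form in
      \<open>moyal_fourier\<close>, now at \<open>- w\<close>.\<close>
    have s: "symplectic_form z w = symplectic_form (- w) z" for z
      by (simp add: symplectic_form_def inner_commute)
    have neg: "tf_shift (- w) a = ee (snd w \<bullet> fst w) *\<^sub>C tf_adj w a" for a :: "'a L2"
      by (simp add: tf_adj_def)
    have "(LINT z|lborel. ?H w * ee (symplectic_form z w) * ?G z) = ?H w * (LINT z|lborel. ?G z * ee (symplectic_form (- w) z))"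
      unfolding s by (subst Bochner_Integration.integral_mult_right_zero[symmetric]) (simp add: mult_ac)
    also have "(LINT z|lborel. ?G z * ee (symplectic_form (- w) z)) = cinner (tf_shift (- w) p) s * cinner r (tf_shift (- w) q)"
      by (rule moyal_fourier)
    also have "\<dots> = cinner p (tf_shift w s) * cinner (tf_shift w r) q"
      by (simp add: neg cinner_scaleC_left cinner_scaleC_right cnj_ee cinner_tf_shift_right[symmetric] cinner_tf_shift_left[symmetric] mult_ac)
    finally show "(LINT z|lborel. ?H w * ee (symplectic_form z w) * ?G z) = ?H w * (cinner p (tf_shift w s) * cinner (tf_shift w r) q)" .
  qed
  finally show ?thesis .
qed

section \<open>Wiener's Tauberian theorem\<close>

definition conv :: "('a::euclidean_space \<Rightarrow> complex) \<Rightarrow> ('a \<Rightarrow> complex) \<Rightarrow> 'a \<Rightarrow> complex" where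
  "conv f g x = (LINT y|lborel. f y * g (x - y))"

text \<open>The substitution rule holds without integrability, so the equality is valid at every
  point, also where the integrals diverge and count as 0.\<close>

lemma conv_commute: "conv f g = conv g f"
proof
  fix x
  show "conv f g x = conv g f x"
    unfolding conv_def using integral_translate(4)[of "\<lambda>y. f y * g (x - y)" x] by (simp add: mult.commute)
qed

lemma conv_integrable_pair:
  assumes f: "integrable lborel f" and g: "integrable lborel g"
  shows "integrable (lborel \<Otimes>\<^sub>M lborel) (\<lambda>(y, x). f y * g (x - y))"
    and "integrable lborel (conv f g)"
proof -
  have [measurable]: "f \<in> borel_measurable borel" "g \<in> borel_measurable borel" using f g by auto
  have m: "(\<lambda>(y, x). f y * g (x - y)) \<in> borel_measurable (borel \<Otimes>\<^sub>M borel)" by measurable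
  have i: "integrable lborel (\<lambda>x. f y * g (x - y))" for y
    using integrable_translate(3)[OF g, of y] by simp
  have b: "(LINT x|lborel. norm (f y * g (x - y))) \<le> norm (f y) * (LINT x|lborel. norm (g x))" for y
    using integral_translate(3)[of "\<lambda>x. norm (g x)" y] by (simp add: norm_mult)
  have G: "integrable lborel (\<lambda>y. norm (f y) * (LINT x|lborel. norm (g x)))" using f by simp
  show "integrable (lborel \<Otimes>\<^sub>M lborel) (\<lambda>(y, x). f y * g (x - y))"
    by (rule Fubini_lborel(5)[OF m i b G])
  show "integrable lborel (conv f g)"
    unfolding conv_def by (rule Fubini_lborel(2)[OF m i b G])
qed

section \<open>Correlations with a bounded sequence of functions\<close>

text \<open>The index \<open>n\<close> comes last so that \<open>corr h f w\<close> is itself a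
  sequence. Correlation is the form in which translates of \<open>h\<close> appear when a
  convolution with an operator is conjugated by a shift.\<close>

definition corr :: "(nat \<Rightarrow> 'a::euclidean_space \<Rightarrow> complex) \<Rightarrow> ('a \<Rightarrow> complex) \<Rightarrow> 'a \<Rightarrow> nat \<Rightarrow> complex" where
  "corr h f w n = (LINT z|lborel. f z * h n (w + z))"

context
  fixes h :: "nat \<Rightarrow> 'a::euclidean_space \<Rightarrow> complex" and M :: real
  assumes hm [measurable]: "\<And>n. h n \<in> borel_measurable borel" and hb: "\<And>n z. cmod (h n z) \<le> M"
begin

lemma M_nonneg: "M \<ge> 0"
  using norm_ge_zero hb order_trans by blast

lemma corr_integrable:
  assumes f: "integrable lborel f"
  shows "integrable lborel (\<lambda>z. f z * h n (w + z))"
proof (rule Bochner_Integration.integrable_bound)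
  have [measurable]: "f \<in> borel_measurable borel" using f by auto
  show "integrable lborel (\<lambda>z. norm (f z) * M)" using f by simp
  show "(\<lambda>z. f z * h n (w + z)) \<in> borel_measurable lborel" by measurable
  show "AE z in lborel. norm (f z * h n (w + z)) \<le> norm (norm (f z) * M)"
    using hb M_nonneg by (auto simp: norm_mult abs_mult intro!: mult_left_mono)
qed

lemma corr_bound:
  assumes f: "integrable lborel f"
  shows "cmod (corr h f w n) \<le> M * (LINT z|lborel. cmod (f z))"
proof -
  have "cmod (corr h f w n) \<le> (LINT z|lborel. norm (f z * h n (w + z)))"
    unfolding corr_def by (rule integral_norm_bound)
  also have "\<dots> \<le> (LINT z|lborel. M * cmod (f z))"
  proof (rule integral_mono)
    show "integrable lborel (\<lambda>z. norm (f z * h n (w + z)))" by (rule integrable_norm[OF corr_integrable[OF f]])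
    show "integrable lborel (\<lambda>z. M * cmod (f z))" using f by simp
    show "norm (f z * h n (w + z)) \<le> M * cmod (f z)" for z
      using mult_left_mono[OF hb[of n "w + z"] norm_ge_zero[of "f z"]] by (simp add: norm_mult mult.commute)
  qed
  finally show ?thesis by simp
qed

lemma corr_measurable [measurable]:
  assumes [measurable]: "f \<in> borel_measurable borel"
  shows "(\<lambda>w. corr h f w n) \<in> borel_measurable borel"
  unfolding corr_def by measurable

lemma corr_add:
  assumes "integrable lborel f" "integrable lborel g"
  shows "corr h (\<lambda>z. f z + g z) w n = corr h f w n + corr h g w n"
  using corr_integrable[OF assms(1)] corr_integrable[OF assms(2)]
  by (simp add: corr_def distrib_right)

lemma corr_diff:
  assumes "integrable lborel f" "integrable lborel g"
  shows "corr h (\<lambda>z. f z - g z) w n = corr h f w n - corr h g w n"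
  using corr_integrable[OF assms(1)] corr_integrable[OF assms(2)]
  by (simp add: corr_def left_diff_distrib)

lemma corr_cmult: "corr h (\<lambda>z. c * f z) w n = c * corr h f w n"
  by (simp add: corr_def mult.assoc)

lemma corr_conv:
  assumes f: "integrable lborel f" and g: "integrable lborel g"
  shows "corr h (conv f g) w n = (LINT y|lborel. f y * corr h g (w + y) n)"
proof -
  have [measurable]: "f \<in> borel_measurable borel" "g \<in> borel_measurable borel" using f g by auto
  have "(LINT y|lborel. f y * corr h g (w + y) n) = (LINT y|lborel. LINT x|lborel. f y * g (x - y) * h n (w + x))"
  proof (rule Bochner_Integration.integral_cong[OF refl])
    fix y
    have "corr h g (w + y) n = (LINT x|lborel. g (x - y) * h n (w + x))"
      unfolding corr_def using integral_translate(3)[of "\<lambda>z. g z * h n (w + y + z)" y] by (simp add: add.assoc)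
    then show "f y * corr h g (w + y) n = (LINT x|lborel. f y * g (x - y) * h n (w + x))"
      by (simp add: mult.assoc)
  qed
  also have "\<dots> = (LINT x|lborel. LINT y|lborel. f y * g (x - y) * h n (w + x))"
  proof (rule Fubini_lborel(3))
    show "integrable lborel (\<lambda>x. f y * g (x - y) * h n (w + x))" for y
      using corr_integrable[OF integrable_translate(3)[OF g, of y], of n w] by (simp add: mult.assoc)
    fix y
    have gy: "integrable lborel (\<lambda>x. g (x - y))" by (rule integrable_translate(3)[OF g])
    have "(LINT x|lborel. norm (f y * g (x - y) * h n (w + x))) \<le> (LINT x|lborel. norm (f y) * M * norm (g (x - y)))"
    proof (rule integral_mono)
      show "integrable lborel (\<lambda>x. norm (f y * g (x - y) * h n (w + x)))"
        using integrable_norm[OF corr_integrable[OF integrable_mult_right[OF gy], of "f y" n w]] by (simp add: mult.assoc)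
      show "integrable lborel (\<lambda>x. norm (f y) * M * norm (g (x - y)))" using gy by simp
      show "norm (f y * g (x - y) * h n (w + x)) \<le> norm (f y) * M * norm (g (x - y))" for x
        using mult_left_mono[OF hb[of n "w + x"] norm_ge_zero[of "f y * g (x - y)"]] by (simp add: norm_mult mult_ac)
    qed
    also have "\<dots> = norm (f y) * M * (LINT x|lborel. norm (g x))"
      using integral_translate(3)[of "\<lambda>x. norm (g x)" y] by simp
    finally show "(LINT x|lborel. norm (f y * g (x - y) * h n (w + x))) \<le> norm (f y) * M * (LINT x|lborel. norm (g x))" .
    show "integrable lborel (\<lambda>y. norm (f y) * M * (LINT x|lborel. norm (g x)))" using f by simp
  qed measurable
  also have "\<dots> = corr h (conv f g) w n"
    by (simp add: corr_def conv_def)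
  finally show ?thesis ..
qed

text \<open>By \<open>corr_conv\<close> the new correlation is an average of translates of the old
  one, weighted by \<open>f\<close>. The bound \<open>corr_bound\<close> is uniform in the
  translation, so dominated convergence applies: null correlations pass to the whole convolution
  ideal of \<open>g\<close>.\<close>

lemma corr_conv_tendsto_0:
  assumes f: "integrable lborel f" and g: "integrable lborel g" and lim: "\<And>w. corr h g w \<longlonglongrightarrow> 0"
  shows "corr h (conv f g) w \<longlonglongrightarrow> 0"
proof -
  have [measurable]: "f \<in> borel_measurable borel" "g \<in> borel_measurable borel" using f g by auto
  have "(\<lambda>n. LINT y|lborel. f y * corr h g (w + y) n) \<longlonglongrightarrow> (LINT y::'a|lborel. 0)"
  proof (rule integral_dominated_convergence[where w="\<lambda>y. cmod (f y) * (M * (LINT z|lborel. cmod (g z)))"])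
    show "AE y in lborel. (\<lambda>n. f y * corr h g (w + y) n) \<longlonglongrightarrow> 0"
      using lim by (auto intro!: tendsto_mult_right_zero)
    show "AE y in lborel. norm (f y * corr h g (w + y) n) \<le> cmod (f y) * (M * (LINT z|lborel. cmod (g z)))" for n
      using corr_bound[OF g] by (auto simp: norm_mult intro!: mult_left_mono)
  qed (use f in simp_all)
  moreover have "corr h (conv f g) w = (\<lambda>n. LINT y|lborel. f y * corr h g (w + y) n)"
    by (rule ext) (rule corr_conv[OF f g])
  ultimately show ?thesis by simp
qed

text \<open>\<open>max 0 (|s n| - B) \<longlonglongrightarrow> 0\<close> says that \<open>limsup |s n| \<le> B\<close>. Since \<open>Y = Y * U\<close> and \<open>G U\<close> is close to
  \<open>g * U\<close>, the bound \<open>B\<close> for \<open>corr h Y\<close> can be halved.\<close>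

lemma corr_local_tendsto_0:
  assumes g: "integrable lborel g" and lim: "\<And>w. corr h g w \<longlonglongrightarrow> 0"
    and Y: "integrable lborel Y" and U: "integrable lborel U" and YU: "Y = conv Y U"
    and G: "G \<noteq> 0" and small: "(LINT x|lborel. cmod (G * U x - conv g U x)) \<le> cmod G / 2"
  shows "corr h Y w \<longlonglongrightarrow> 0"
proof -
  define E where "E x = G * U x - conv g U x" for x
  note gU = conv_integrable_pair(2)[OF g U]
  have E: "integrable lborel E" unfolding E_def using U gU by simp
  have [measurable]: "E \<in> borel_measurable borel" "Y \<in> borel_measurable borel" using E Y by auto
  define \<epsilon> where "\<epsilon> = (LINT x|lborel. cmod (E x))"
  have \<epsilon>: "\<epsilon> \<le> cmod G / 2" using small by (simp add: \<epsilon>_def E_def)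
  have "corr h (conv U g) w \<longlonglongrightarrow> 0" for w by (rule corr_conv_tendsto_0[OF U g lim])
  then have r0: "corr h (conv Y (conv g U)) w \<longlonglongrightarrow> 0" for w
    by (intro corr_conv_tendsto_0[OF Y gU]) (simp add: conv_commute[of g U])
  \<comment> \<open>\<open>G * Y\<close> is the convolution of \<open>Y\<close> with
    \<open>G * U = E + g * U\<close> (convolution in the last product). The identity holds only
    almost everywhere, where the integrals exist; its second part is already null by
    \<open>r0\<close>.\<close>
  have split: "G * corr h Y w n = (LINT y|lborel. E y * corr h Y (w + y) n) + corr h (conv Y (conv g U)) w n" for w n
  proof -
    have "G * Y x = conv E Y x + conv Y (conv g U) x" if ae: "integrable lborel (\<lambda>y. Y y * U (x - y))"
        "integrable lborel (\<lambda>y. Y y * conv g U (x - y))" for x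
    proof -
      have "conv E Y x = (LINT y|lborel. G * (Y y * U (x - y)) - Y y * conv g U (x - y))"
        unfolding conv_commute[of E Y] by (simp add: conv_def[of Y] E_def algebra_simps)
      also have "\<dots> = G * conv Y U x - conv Y (conv g U) x"
        using ae by (simp add: conv_def[of Y])
      finally show ?thesis using YU by simp
    qed
    moreover have "AE x in lborel. integrable lborel (\<lambda>y. Y y * U (x - y))"
      using lborel_pair.AE_integrable_snd[OF conv_integrable_pair(1)[OF Y U]] .
    moreover have "AE x in lborel. integrable lborel (\<lambda>y. Y y * conv g U (x - y))"
      using lborel_pair.AE_integrable_snd[OF conv_integrable_pair(1)[OF Y gU]] .
    ultimately have ae: "AE x in lborel. G * Y x = conv E Y x + conv Y (conv g U) x"
      by auto
    have iEY: "integrable lborel (conv E Y)" "integrable lborel (conv Y (conv g U))"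
      by (intro conv_integrable_pair E Y gU)+
    then have [measurable]: "conv E Y \<in> borel_measurable borel" "conv Y (conv g U) \<in> borel_measurable borel" by auto
    have "G * corr h Y w n = corr h (\<lambda>x. G * Y x) w n" by (simp add: corr_cmult)
    also have "\<dots> = corr h (\<lambda>x. conv E Y x + conv Y (conv g U) x) w n"
      unfolding corr_def by (rule integral_cong_AE) (use ae in auto)
    also have "\<dots> = corr h (conv E Y) w n + corr h (conv Y (conv g U)) w n"
      by (rule corr_add[OF iEY])
    finally show ?thesis by (simp add: corr_conv[OF E Y])
  qed
  \<comment> \<open>Values up to \<open>B\<close> contribute at most \<open>\<epsilon> * B\<close>
    with \<open>\<epsilon> \<le> cmod G / 2\<close>. The excess over \<open>B\<close> is integrated
    against \<open>cmod (E y)\<close> and vanishes by dominated convergence, which is why the bound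
    is assumed at every \<open>w\<close> at once.\<close>
  have step: "\<forall>w. (\<lambda>n. max 0 (cmod (corr h Y w n) - B / 2)) \<longlonglongrightarrow> 0"
    if B: "\<forall>w. (\<lambda>n. max 0 (cmod (corr h Y w n) - B)) \<longlonglongrightarrow> 0" "B \<ge> 0" for B
  proof
    fix w
    define s where "s n = (LINT y|lborel. cmod (E y) * max 0 (cmod (corr h Y (w + y) n) - B))" for n
    define C where "C = M * (LINT z|lborel. cmod (Y z))"
    have C: "cmod (corr h Y w n) \<le> C" for w n unfolding C_def by (rule corr_bound[OF Y])
    have bd: "\<bar>max 0 (cmod (corr h Y w n) - B)\<bar> \<le> C" for w n
      using C[of w n] B(2) norm_ge_zero[of "corr h Y w n"] by linarith
    have i1: "integrable lborel (\<lambda>y. cmod (E y) * max 0 (cmod (corr h Y (w + y) n) - B))" for n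
      by (rule Bochner_Integration.integrable_bound[of _ "\<lambda>y. cmod (E y) * C"])
         (use E bd in \<open>auto simp: abs_mult intro!: mult_left_mono order_trans[OF bd abs_ge_self]\<close>)
    have "s \<longlonglongrightarrow> (LINT y::'a|lborel. 0)"
      unfolding s_def
    proof (rule integral_dominated_convergence[where w="\<lambda>y. cmod (E y) * C"])
      show "AE y in lborel. (\<lambda>n. cmod (E y) * max 0 (cmod (corr h Y (w + y) n) - B)) \<longlonglongrightarrow> 0"
        using B(1) by (auto intro!: tendsto_mult_right_zero)
      show "AE y in lborel. norm (cmod (E y) * max 0 (cmod (corr h Y (w + y) n) - B)) \<le> cmod (E y) * C" for n
        using bd by (auto simp: abs_mult intro!: mult_left_mono)
    qed (use E in simp_all)
    then have s0: "s \<longlonglongrightarrow> 0" by simp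
    have lim: "(\<lambda>n. (s n + cmod (corr h (conv Y (conv g U)) w n)) / cmod G) \<longlonglongrightarrow> 0"
      using tendsto_divide[OF tendsto_add[OF s0 tendsto_norm_zero[OF r0[of w]]] tendsto_const[of "cmod G"]] G by simp
    have ub: "max 0 (cmod (corr h Y w n) - B / 2) \<le> (s n + cmod (corr h (conv Y (conv g U)) w n)) / cmod G" for n
    proof -
      have s_nonneg: "0 \<le> s n" unfolding s_def by simp
      have "cmod (LINT y|lborel. E y * corr h Y (w + y) n) \<le> (LINT y|lborel. norm (E y * corr h Y (w + y) n))"
        by (rule integral_norm_bound)
      also have "\<dots> \<le> (LINT y|lborel. cmod (E y) * B + cmod (E y) * max 0 (cmod (corr h Y (w + y) n) - B))"
      proof (rule integral_mono)
        show "integrable lborel (\<lambda>y. norm (E y * corr h Y (w + y) n))"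
          by (rule Bochner_Integration.integrable_bound[of _ "\<lambda>y. cmod (E y) * C"])
             (use E C in \<open>auto simp: norm_mult abs_mult intro!: mult_left_mono order_trans[OF C abs_ge_self]\<close>)
        show "integrable lborel (\<lambda>y. cmod (E y) * B + cmod (E y) * max 0 (cmod (corr h Y (w + y) n) - B))"
          using E i1[of n] by simp
        show "norm (E y * corr h Y (w + y) n) \<le> cmod (E y) * B + cmod (E y) * max 0 (cmod (corr h Y (w + y) n) - B)" for y
          unfolding norm_mult distrib_left[symmetric] by (intro mult_left_mono) auto
      qed
      also have "\<dots> = \<epsilon> * B + s n"
        using E i1[of n] by (simp add: \<epsilon>_def s_def)
      finally have "cmod G * cmod (corr h Y w n) \<le> \<epsilon> * B + s n + cmod (corr h (conv Y (conv g U)) w n)"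
        unfolding norm_mult[symmetric] split by (rule order_trans[OF norm_triangle_ineq add_right_mono])
      moreover have "\<epsilon> * B \<le> cmod G / 2 * B" using \<epsilon> B(2) by (rule mult_right_mono)
      ultimately have "cmod G * (cmod (corr h Y w n) - B / 2) \<le> s n + cmod (corr h (conv Y (conv g U)) w n)"
        unfolding right_diff_distrib by linarith
      then have "cmod (corr h Y w n) - B / 2 \<le> (s n + cmod (corr h (conv Y (conv g U)) w n)) / cmod G"
        using G by (simp add: pos_le_divide_eq mult.commute)
      then show ?thesis using s_nonneg by simp
    qed
    show "(\<lambda>n. max 0 (cmod (corr h Y w n) - B / 2)) \<longlonglongrightarrow> 0"
      by (rule tendsto_sandwich[OF _ _ tendsto_const lim]) (use ub in auto)
  qed
  define B0 where "B0 = M * (LINT z|lborel. cmod (Y z))"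
  have B0: "B0 \<ge> 0" unfolding B0_def using M_nonneg by simp
  have iter: "\<forall>w. (\<lambda>n. max 0 (cmod (corr h Y w n) - B0 / 2 ^ j)) \<longlonglongrightarrow> 0" for j
  proof (induction j)
    case 0
    have "max 0 (cmod (corr h Y w n) - B0) = 0" for w n
      using corr_bound[OF Y, of w n] by (simp add: B0_def)
    then show ?case by simp
  next
    case (Suc j)
    from step[OF Suc] B0 show ?case by (simp add: mult.commute)
  qed
  show ?thesis
  proof (rule LIMSEQ_I)
    fix e :: real assume e: "e > 0"
    have "B0 / 2 ^ j = B0 * (1 / 2) ^ j" for j by (simp add: power_one_over)
    moreover have "(\<lambda>j. B0 * (1 / 2) ^ j) \<longlonglongrightarrow> B0 * 0"
      by (intro tendsto_mult tendsto_const LIMSEQ_realpow_zero) auto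
    ultimately have "(\<lambda>j. B0 / 2 ^ j) \<longlonglongrightarrow> 0" by simp
    then have "eventually (\<lambda>j. B0 / 2 ^ j < e / 2) sequentially"
      by (rule order_tendstoD(2)) (use e in simp)
    then obtain j where j: "B0 / 2 ^ j < e / 2" by (auto simp: eventually_sequentially)
    have "eventually (\<lambda>n. max 0 (cmod (corr h Y w n) - B0 / 2 ^ j) < e / 2) sequentially"
      by (rule order_tendstoD(2)[OF iter[of j, rule_format]]) (use e in simp)
    then have "eventually (\<lambda>n. norm (corr h Y w n - 0) < e) sequentially"
    proof eventually_elim
      case (elim n)
      then have "cmod (corr h Y w n) - B0 / 2 ^ j < e / 2" by (simp only: max_less_iff_conj)
      then show ?case using j by simp
    qed
    then show "\<exists>N. \<forall>n\<ge>N. norm (corr h Y w n - 0) < e" by (simp add: eventually_sequentially)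
  qed
qed

text \<open>\<open>corr_bound\<close> makes the correlation Lipschitz in \<open>f\<close> for the
  \<open>L1\<close> norm, with a constant independent of \<open>n\<close>; null correlations are
  therefore stable under \<open>L1\<close> limits.\<close>

lemma corr_approx_tendsto_0:
  assumes f: "integrable lborel f"
    and ex: "\<And>e. e > 0 \<Longrightarrow> \<exists>k. integrable lborel k \<and> (LINT z|lborel. cmod (f z - k z)) < e \<and> corr h k w \<longlonglongrightarrow> 0"
  shows "corr h f w \<longlonglongrightarrow> 0"
proof (rule LIMSEQ_I)
  fix e :: real assume e: "e > 0"
  \<comment> \<open>\<open>M\<close> may be 0, hence the denominator with
    \<open>M + 1\<close>.\<close>
  define e' where "e' = e / (2 * (M + 1))"
  have e': "e' > 0" using e M_nonneg by (simp add: e'_def)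
  have Me: "M * e' \<le> e / 2" using e M_nonneg by (simp add: e'_def field_simps)
  obtain k where k: "integrable lborel k" "(LINT z|lborel. cmod (f z - k z)) < e'" "corr h k w \<longlonglongrightarrow> 0"
    using ex[OF e'] by blast
  have fk: "integrable lborel (\<lambda>z. f z - k z)" using f k by simp
  have "eventually (\<lambda>n. norm (corr h k w n) < e / 2) sequentially"
    by (rule order_tendstoD(2)[OF tendsto_norm_zero[OF k(3)]]) (use e in simp)
  then have "eventually (\<lambda>n. norm (corr h f w n - 0) < e) sequentially"
  proof eventually_elim
    case (elim n)
    have "cmod (corr h (\<lambda>z. f z - k z) w n) \<le> M * e'"
      by (rule order_trans[OF corr_bound[OF fk]]) (use k(2) M_nonneg in \<open>auto intro!: mult_left_mono\<close>)
    then have "cmod (corr h f w n - corr h k w n) \<le> e / 2"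
      using Me corr_diff[OF f k(1)] by simp
    then show ?case using elim norm_triangle_ineq[of "corr h f w n - corr h k w n" "corr h k w n"] by simp
  qed
  then show "\<exists>N. \<forall>n\<ge>N. norm (corr h f w n - 0) < e" by (simp add: eventually_sequentially)
qed

end

section \<open>Plancherel with inner products and a band-limited kernel\<close>

text \<open>The Euclidean transform rather than the symplectic one, so that Wiener's theorem lives
  on any Euclidean space; a rotation of frequencies links the two later on.\<close>

definition fourier :: "('a::euclidean_space \<Rightarrow> complex) \<Rightarrow> 'a \<Rightarrow> complex" where
  "fourier f \<omega> = (LINT t|lborel. f t * ee (- (\<omega> \<bullet> t)))"

lemma fourier_integrable: "integrable lborel f \<Longrightarrow> integrable lborel (\<lambda>t. f t * ee (- (\<omega> \<bullet> t)))"
  by (rule Bochner_Integration.integrable_bound) (auto simp: norm_mult)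

lemma measurable_fourier [measurable]:
  assumes [measurable]: "f \<in> borel_measurable borel"
  shows "fourier f \<in> borel_measurable borel"
  unfolding fourier_def by measurable

lemma norm_fourier_le: "cmod (fourier f \<omega>) \<le> (LINT t|lborel. cmod (f t))"
  unfolding fourier_def by (rule order_trans[OF integral_norm_bound]) (simp add: norm_mult)

lemma tendsto_fourier:
  fixes x :: "nat \<Rightarrow> 'a::euclidean_space"
  assumes f: "integrable lborel f" and x: "x \<longlonglongrightarrow> l"
  shows "(\<lambda>n. fourier f (x n)) \<longlonglongrightarrow> fourier f l"
  unfolding fourier_def
proof (rule integral_dominated_convergence[where w="\<lambda>t. cmod (f t)"])
  have [measurable]: "f \<in> borel_measurable borel" using f by auto
  show "(\<lambda>t. f t * ee (- (x n \<bullet> t))) \<in> borel_measurable lborel" for n by measurable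
  show "(\<lambda>t. f t * ee (- (l \<bullet> t))) \<in> borel_measurable lborel" by measurable
  show "AE t in lborel. (\<lambda>n. f t * ee (- (x n \<bullet> t))) \<longlonglongrightarrow> f t * ee (- (l \<bullet> t))"
    by (intro AE_I2 tendsto_intros x)
qed (use f in \<open>auto simp: norm_mult\<close>)

lemma fourier_translate: "fourier (\<lambda>t. f (t + \<xi>)) y = ee (y \<bullet> \<xi>) * fourier f y"
proof -
  have "fourier (\<lambda>t. f (t + \<xi>)) y = (LINT t|lborel. f t * ee (- (y \<bullet> (t - \<xi>))))"
    unfolding fourier_def using integral_translate(2)[of "\<lambda>t. f t * ee (- (y \<bullet> (t - \<xi>)))" \<xi>] by simp
  also have "\<dots> = (LINT t|lborel. ee (y \<bullet> \<xi>) * (f t * ee (- (y \<bullet> t))))"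
    by (simp add: inner_diff_right ee_add[of "y \<bullet> \<xi>" "- (y \<bullet> _)", simplified] mult_ac)
  finally show ?thesis by (simp add: fourier_def)
qed

text \<open>Polarisation of \<open>plancherel\<close>: comparing the norms of \<open>f + c g\<close>
  and of its transform for \<open>c = 1\<close> and \<open>c = \<i>\<close> forces the defect
  \<open>D\<close> to vanish.\<close>

lemma plancherel_inner:
  fixes f g :: "'a::euclidean_space \<Rightarrow> complex"
  assumes f: "square_integrable f" "integrable lborel f" and g: "square_integrable g" "integrable lborel g"
  shows "square_integrable (fourier f)"
    and "(LINT y|lborel. fourier f y * cnj (fourier g y)) = (LINT t|lborel. f t * cnj (g t))"
proof -
  have sq: "square_integrable (fourier f)" and nrm: "norm (abs_L2 (fourier f)) = norm (abs_L2 f)"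
    if f: "square_integrable f" "integrable lborel f" for f :: "'a \<Rightarrow> complex"
  proof -
    have [measurable]: "f \<in> borel_measurable borel" using f by auto
    note pl = plancherel[OF f, folded fourier_def]
    show sq: "square_integrable (fourier f)"
      unfolding square_integrable_def using pl by (auto intro!: integrableI_bounded)
    show "norm (abs_L2 (fourier f)) = norm (abs_L2 f)"
      using pl unfolding nn_integral_norm_abs_L2[OF sq] by (simp add: power2_eq_iff_nonneg)
  qed
  show "square_integrable (fourier f)" by (rule sq[OF f])
  let ?A = "abs_L2 (fourier f)" and ?B = "abs_L2 (fourier g)" and ?a = "abs_L2 f" and ?b = "abs_L2 g"
  have comb: "cinner (?A + c *\<^sub>C ?B) (?A + c *\<^sub>C ?B) = cinner (?a + c *\<^sub>C ?b) (?a + c *\<^sub>C ?b)" for c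
  proof -
    let ?h = "\<lambda>t. f t + c * g t"
    have h: "square_integrable ?h" "integrable lborel ?h"
      using f g by (auto intro: square_integrable_add square_integrable_cmult)
    have "fourier ?h = (\<lambda>y. fourier f y + c * fourier g y)"
    proof
      fix y
      have "fourier ?h y = (LINT t|lborel. f t * ee (- (y \<bullet> t)) + c * (g t * ee (- (y \<bullet> t))))"
        unfolding fourier_def by (simp add: distrib_right mult.assoc)
      also have "\<dots> = fourier f y + c * fourier g y"
        unfolding fourier_def using fourier_integrable[OF f(2), of y] fourier_integrable[OF g(2), of y] by simp
      finally show "fourier ?h y = fourier f y + c * fourier g y" .
    qed
    then have "?A + c *\<^sub>C ?B = abs_L2 (fourier ?h)"
      using f g by (simp add: scaleC_abs plus_abs sq square_integrable_cmult)
    moreover have "?a + c *\<^sub>C ?b = abs_L2 ?h"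
      using f g by (simp add: scaleC_abs plus_abs square_integrable_cmult)
    ultimately show ?thesis by (simp add: cinner_self nrm[OF h])
  qed
  define D where "D = cinner ?A ?B - cinner ?a ?b"
  have cA: "cinner ?B ?A = cnj (cinner ?A ?B)" "cinner ?b ?a = cnj (cinner ?a ?b)" by (rule cinner_commute)+
  have AB: "cinner ?A ?A = cinner ?a ?a" "cinner ?B ?B = cinner ?b ?b"
    by (simp_all add: cinner_self nrm f g)
  have D: "cnj c * D + c * cnj D = 0" for c
    using comb[of c]
    by (simp add: cinner_add_left cinner_add_right cinner_scaleC_left cinner_scaleC_right AB cA D_def algebra_simps)
  have "D + cnj D = 0" using D[of 1] by simp
  moreover have "\<i> * (cnj D - D) = 0" using D[of \<i>] by (simp add: algebra_simps)
  ultimately have "D = 0" by simp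
  then show "(LINT y|lborel. fourier f y * cnj (fourier g y)) = (LINT t|lborel. f t * cnj (g t))"
    by (simp add: D_def cinner_abs sq f g)
qed

text \<open>\<open>k\<close> and \<open>v\<close> are the Fourier transforms of \<open>ind\<^sub>1 \<star> ind\<^sub>1\<close> and \<open>ind\<^sub>3 \<star> ind\<^sub>1 / vol\<close>, where \<open>ind\<^sub>r\<close> is the indicator of the ball
  of radius \<open>r\<close> and \<open>\<star>\<close> is correlation; the second function is 1 on the support of the first.\<close>

lemma wiener_kernel:
  obtains a k v :: "'a::euclidean_space \<Rightarrow> complex"
  where "integrable lborel a" "\<And>\<xi>. norm \<xi> > 2 \<Longrightarrow> a \<xi> = 0" "integrable lborel k" "integrable lborel v"
    "k = fourier a" "conv v k = k" "k 0 \<noteq> 0" "(LINT y|lborel. k y) \<noteq> 0"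
proof -
  define ind where "ind r t = (indicator (cball 0 r) t :: complex)" for r and t :: 'a
  have [measurable]: "ind r \<in> borel_measurable borel" for r unfolding ind_def by (rule borel_measurable_indicator) simp
  have ind_i: "integrable lborel (ind r)" for r
  proof -
    have "integrable lborel (\<lambda>t::'a. complex_of_real (indicator (cball 0 r) t))"
      by (intro integrable_of_real integrable_real_indicator) (use emeasure_compact_finite[OF compact_cball, of "0::'a" r] in simp_all)
    moreover have "(\<lambda>t::'a. complex_of_real (indicator (cball 0 r) t)) = ind r"
      by (auto simp: ind_def fun_eq_iff split: split_indicator)
    ultimately show ?thesis by simp
  qed
  have ind_s: "square_integrable (ind r)" for r
  proof -
    have "integrable lborel (\<lambda>t. cmod (ind r t))" using ind_i by simp
    moreover have "(\<lambda>t. cmod (ind r t)) = (\<lambda>t. (cmod (ind r t))\<^sup>2)"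
      by (auto simp: ind_def fun_eq_iff split: split_indicator)
    ultimately show ?thesis by (simp add: square_integrable_def)
  qed
  define \<beta> where "\<beta> = measure lborel (cball (0::'a) 1)"
  have \<beta>: "\<beta> > 0" unfolding \<beta>_def using content_cball_pos[of 1 "0::'a"] by simp
  have ind_int: "(LINT t|lborel. ind 1 t) = \<beta>"
  proof -
    have "(LINT t|lborel. ind 1 t) = (LINT t|lborel. complex_of_real (indicator (cball (0::'a) 1) t))"
      by (intro Bochner_Integration.integral_cong) (auto simp: ind_def split: split_indicator)
    then show ?thesis by (simp add: \<beta>_def)
  qed
  have ind_cnj: "cnj (ind r t) = ind r t" for r t by (auto simp: ind_def split: split_indicator)
  have ind_sq: "ind 1 t * ind 1 t = ind 1 t" for t by (auto simp: ind_def split: split_indicator)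
  define k where "k y = fourier (ind 1) y * cnj (fourier (ind 1) y)" for y
  define v where "v y = fourier (ind 3) y * cnj (fourier (ind 1) y) / \<beta>" for y
  define a where "a \<xi> = (LINT t|lborel. ind 1 (t + \<xi>) * ind 1 t)" for \<xi>
  note sF = plancherel_inner(1)[OF ind_s ind_i ind_s ind_i]
  have ik: "integrable lborel k" unfolding k_def by (rule square_integrable_mult_cnj[OF sF sF])
  have iv: "integrable lborel v" unfolding v_def
    using square_integrable_mult_cnj[OF sF sF, of 3 1] by simp
  have a0: "a \<xi> = 0" if "norm \<xi> > 2" for \<xi>
  proof -
    have z: "ind 1 (t + \<xi>) * ind 1 t = 0" for t
      using that norm_triangle_ineq4[of "t + \<xi>" t] by (auto simp: ind_def split: split_indicator)
    show ?thesis unfolding a_def z by simp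
  qed
  have Fub: "integrable lborel (\<lambda>\<xi>. LINT t|lborel. ind 1 (t + \<xi>) * ind 1 t * ee (- (y \<bullet> \<xi>)))"
    "(LINT t|lborel. LINT \<xi>|lborel. ind 1 (t + \<xi>) * ind 1 t * ee (- (y \<bullet> \<xi>))) = (LINT \<xi>|lborel. LINT t|lborel. ind 1 (t + \<xi>) * ind 1 t * ee (- (y \<bullet> \<xi>)))" for y
  proof -
    have m: "(\<lambda>(t, \<xi>). ind 1 (t + \<xi>) * ind 1 t * ee (- (y \<bullet> \<xi>))) \<in> borel_measurable (borel \<Otimes>\<^sub>M borel)" by measurable
    have i: "integrable lborel (\<lambda>\<xi>. ind 1 (t + \<xi>) * ind 1 t * ee (- (y \<bullet> \<xi>)))" for t
    proof (rule Bochner_Integration.integrable_bound)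
      show "integrable lborel (\<lambda>\<xi>. ind 1 (t + \<xi>) * ind 1 t)"
        using integrable_translate(1)[OF ind_i[of 1], of t] by simp
    qed (auto simp: norm_mult)
    have b: "(LINT \<xi>|lborel. norm (ind 1 (t + \<xi>) * ind 1 t * ee (- (y \<bullet> \<xi>)))) \<le> (LINT s|lborel. cmod (ind 1 s)) * cmod (ind 1 t)" for t
      using integral_translate(1)[of "\<lambda>s. cmod (ind 1 s)" t] by (simp add: norm_mult)
    have G: "integrable lborel (\<lambda>t. (LINT s|lborel. cmod (ind 1 s)) * cmod (ind 1 t))" using ind_i by simp
    show "integrable lborel (\<lambda>\<xi>. LINT t|lborel. ind 1 (t + \<xi>) * ind 1 t * ee (- (y \<bullet> \<xi>)))"
      by (rule Fubini_lborel(2)[OF m i b G])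
    show "(LINT t|lborel. LINT \<xi>|lborel. ind 1 (t + \<xi>) * ind 1 t * ee (- (y \<bullet> \<xi>))) = (LINT \<xi>|lborel. LINT t|lborel. ind 1 (t + \<xi>) * ind 1 t * ee (- (y \<bullet> \<xi>)))"
      by (rule Fubini_lborel(3)[OF m i b G])
  qed
  have ia: "integrable lborel a"
    using Fub(1)[of 0] unfolding a_def[abs_def] by simp
  have ka: "k = fourier a"
  proof
    fix y
    have "k y = (LINT t|lborel. ind 1 t * ee (y \<bullet> t)) * fourier (ind 1) y"
    proof -
      have "cnj (fourier (ind 1) y) = (LINT t|lborel. ind 1 t * ee (y \<bullet> t))"
        unfolding fourier_def by (subst Bochner_Integration.integral_cnj[symmetric]) (simp add: cnj_ee ind_cnj)
      then show ?thesis by (simp add: k_def mult.commute)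
    qed
    also have "\<dots> = (LINT t|lborel. ind 1 t * ee (y \<bullet> t) * fourier (ind 1) y)" by simp
    also have "\<dots> = (LINT t|lborel. LINT \<xi>|lborel. ind 1 (t + \<xi>) * ind 1 t * ee (- (y \<bullet> \<xi>)))"
    proof (rule Bochner_Integration.integral_cong[OF refl])
      fix t
      have "fourier (ind 1) y = (LINT \<xi>|lborel. ind 1 (t + \<xi>) * ee (- (y \<bullet> (t + \<xi>))))"
        unfolding fourier_def using integral_translate(1)[of "\<lambda>s. ind 1 s * ee (- (y \<bullet> s))" t] by simp
      then have "ind 1 t * ee (y \<bullet> t) * fourier (ind 1) y = (LINT \<xi>|lborel. ind 1 t * ee (y \<bullet> t) * (ind 1 (t + \<xi>) * ee (- (y \<bullet> (t + \<xi>)))))"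
        by simp
      also have "\<dots> = (LINT \<xi>|lborel. ind 1 (t + \<xi>) * ind 1 t * ee (- (y \<bullet> \<xi>)))"
      proof (rule Bochner_Integration.integral_cong[OF refl])
        fix \<xi>
        have "ee (y \<bullet> t) * ee (- (y \<bullet> (t + \<xi>))) = ee (- (y \<bullet> \<xi>))"
          unfolding ee_add[symmetric] by (simp add: inner_add_right)
        then show "ind 1 t * ee (y \<bullet> t) * (ind 1 (t + \<xi>) * ee (- (y \<bullet> (t + \<xi>)))) = ind 1 (t + \<xi>) * ind 1 t * ee (- (y \<bullet> \<xi>))"
          by (metis (no_types, lifting) mult.assoc mult.commute)
      qed
      finally show "ind 1 t * ee (y \<bullet> t) * fourier (ind 1) y = (LINT \<xi>|lborel. ind 1 (t + \<xi>) * ind 1 t * ee (- (y \<bullet> \<xi>)))" .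
    qed
    also have "\<dots> = (LINT \<xi>|lborel. LINT t|lborel. ind 1 (t + \<xi>) * ind 1 t * ee (- (y \<bullet> \<xi>)))" by (rule Fub(2))
    also have "\<dots> = fourier a y" by (simp add: fourier_def a_def)
    finally show "k y = fourier a y" .
  qed
  \<comment> \<open>The radius is 3 = 1 + 2: a translate of the unit ball by at most 2 stays inside
    the ball of radius 3, so the correlation equals the volume \<beta>, which the normalisation of
    \<open>v\<close> divides out.\<close>
  have vhat: "(LINT y|lborel. v y * ee (\<xi> \<bullet> y)) = 1" if "norm \<xi> \<le> 2" for \<xi>
  proof -
    have sh: "square_integrable (\<lambda>t. ind 3 (t + \<xi>))"
      using square_integrable_affine[OF ind_s, of 1 3 \<xi>] by (simp add: add.commute)
    have "(LINT y|lborel. v y * ee (\<xi> \<bullet> y)) = (LINT y|lborel. fourier (\<lambda>t. ind 3 (t + \<xi>)) y * cnj (fourier (ind 1) y)) / \<beta>"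
      unfolding fourier_translate
      by (subst integral_divide_zero[symmetric]) (simp add: v_def inner_commute[of \<xi>] mult_ac)
    also have "(LINT y|lborel. fourier (\<lambda>t. ind 3 (t + \<xi>)) y * cnj (fourier (ind 1) y)) = (LINT t|lborel. ind 3 (t + \<xi>) * cnj (ind 1 t))"
      by (rule plancherel_inner(2)[OF sh integrable_translate(2)[OF ind_i] ind_s ind_i])
    also have "\<dots> = (LINT t|lborel. ind 1 t)"
    proof (rule Bochner_Integration.integral_cong[OF refl])
      fix t
      show "ind 3 (t + \<xi>) * cnj (ind 1 t) = ind 1 t"
        using that norm_triangle_ineq[of t \<xi>] by (auto simp: ind_def split: split_indicator)
    qed
    finally show ?thesis using ind_int \<beta> by simp
  qed
  \<comment> \<open>Since \<open>k\<close> is the transform of \<open>a\<close>, convolution with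
    \<open>v\<close> multiplies \<open>a\<close> by the inverse transform of \<open>v\<close>, which
    by \<open>vhat\<close> is 1 wherever \<open>a\<close> can be nonzero.\<close>
  have vk: "conv v k = k"
  proof
    fix x
    have [measurable]: "a \<in> borel_measurable borel" "v \<in> borel_measurable borel" using ia iv by auto
    have "conv v k x = (LINT y|lborel. LINT \<xi>|lborel. v y * (a \<xi> * ee (- ((x - y) \<bullet> \<xi>))))"
      by (simp add: conv_def ka fourier_def)
    also have "\<dots> = (LINT \<xi>|lborel. LINT y|lborel. v y * (a \<xi> * ee (- ((x - y) \<bullet> \<xi>))))"
    proof (rule Fubini_lborel(3))
      show "integrable lborel (\<lambda>\<xi>. v y * (a \<xi> * ee (- ((x - y) \<bullet> \<xi>))))" for y
        using fourier_integrable[OF ia, of "x - y"] by simp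
      show "(LINT \<xi>|lborel. norm (v y * (a \<xi> * ee (- ((x - y) \<bullet> \<xi>))))) \<le> norm (v y) * (LINT \<xi>|lborel. norm (a \<xi>))" for y
        by (simp add: norm_mult)
      show "integrable lborel (\<lambda>y. norm (v y) * (LINT \<xi>|lborel. norm (a \<xi>)))" using iv by simp
    qed measurable
    also have "\<dots> = (LINT \<xi>|lborel. a \<xi> * ee (- (x \<bullet> \<xi>)))"
    proof (rule Bochner_Integration.integral_cong[OF refl])
      fix \<xi>
      have "ee (- ((x - y) \<bullet> \<xi>)) = ee (- (x \<bullet> \<xi>)) * ee (\<xi> \<bullet> y)" for y
        unfolding ee_add[symmetric] by (simp add: inner_diff_left inner_commute[of y])
      then have "(LINT y|lborel. v y * (a \<xi> * ee (- ((x - y) \<bullet> \<xi>)))) = (LINT y|lborel. (a \<xi> * ee (- (x \<bullet> \<xi>))) * (v y * ee (\<xi> \<bullet> y)))"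
        by (simp only: mult_ac)
      also have "\<dots> = (a \<xi> * ee (- (x \<bullet> \<xi>))) * (LINT y|lborel. v y * ee (\<xi> \<bullet> y))"
        by (rule integral_mult_right_zero)
      also have "\<dots> = a \<xi> * ee (- (x \<bullet> \<xi>))"
        using vhat[of \<xi>] a0[of \<xi>] by (cases "norm \<xi> \<le> 2") auto
      finally show "(LINT y|lborel. v y * (a \<xi> * ee (- ((x - y) \<bullet> \<xi>)))) = a \<xi> * ee (- (x \<bullet> \<xi>))" .
    qed
    finally show "conv v k x = k x" by (simp add: ka fourier_def)
  qed
  have "k 0 \<noteq> 0" using ind_int \<beta> by (simp add: k_def fourier_def)
  moreover have "(LINT y|lborel. k y) \<noteq> 0"
    unfolding k_def using plancherel_inner(2)[OF ind_s ind_i ind_s ind_i, of 1 1] ind_int \<beta> by (simp add: ind_cnj ind_sq)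
  ultimately show thesis using that[OF ia a0 ik iv ka vk] by blast
qed

section \<open>Averaged moduli of continuity in \<open>L1\<close>\<close>

lemma integral_translate_diff_le:
  fixes f :: "'a::euclidean_space \<Rightarrow> complex"
  assumes f: "integrable lborel f"
  shows "(LINT x|lborel. cmod (f (x - y) - f x)) \<le> 2 * (LINT x|lborel. cmod (f x))"
proof -
  have "(LINT x|lborel. cmod (f (x - y) - f x)) \<le> (LINT x|lborel. cmod (f (x - y)) + cmod (f x))"
    using f integrable_translate(3)[OF f, of y] by (intro integral_mono norm_triangle_ineq4) auto
  also have "\<dots> = 2 * (LINT x|lborel. cmod (f x))"
    using f integrable_translate(3)[OF f, of y] integral_translate(3)[of "\<lambda>x. cmod (f x)" y] by simp
  finally show ?thesis .
qed

text \<open>Has two uses: with the slowly varying kernel \<open>v\<close> it measures how far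
  \<open>g\<close> is from acting by a constant on a narrow band, and with a normalised kernel in
  place of \<open>g\<close> it is the convergence of an approximate identity to
  \<open>f\<close>.\<close>

lemma mean_modulus_tendsto_0:
  fixes f g :: "'a::euclidean_space \<Rightarrow> complex"
  assumes g: "integrable lborel g" and f: "integrable lborel f"
  shows "(\<lambda>m. LINT y|lborel. cmod (g y) * (LINT x|lborel. cmod (f (x - (1 / real (Suc m)) *\<^sub>R y) - f x))) \<longlonglongrightarrow> 0"
proof -
  have [measurable]: "f \<in> borel_measurable borel" "g \<in> borel_measurable borel" using f g by auto
  note bd = integral_translate_diff_le[OF f]
  have "(\<lambda>m. LINT y|lborel. cmod (g y) * (LINT x|lborel. cmod (f (x - (1 / real (Suc m)) *\<^sub>R y) - f x))) \<longlonglongrightarrow> (LINT y::'a|lborel. 0)"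
  proof (rule integral_dominated_convergence[where w="\<lambda>y. cmod (g y) * (2 * (LINT x|lborel. cmod (f x)))"])
    show "AE y in lborel. (\<lambda>m. cmod (g y) * (LINT x|lborel. cmod (f (x - (1 / real (Suc m)) *\<^sub>R y) - f x))) \<longlonglongrightarrow> 0"
    proof (rule AE_I2, rule tendsto_mult_right_zero, rule translation_continuous_L1[OF f])
      fix y :: 'a
      have "(\<lambda>m. (1 / real (Suc m)) *\<^sub>R y) \<longlonglongrightarrow> 0 *\<^sub>R y"
        by (rule tendsto_scaleR[OF LIMSEQ_Suc[OF lim_1_over_n] tendsto_const])
      then show "(\<lambda>m. (1 / real (Suc m)) *\<^sub>R y) \<longlonglongrightarrow> 0" by simp
    qed
    show "AE y in lborel. norm (cmod (g y) * (LINT x|lborel. cmod (f (x - (1 / real (Suc m)) *\<^sub>R y) - f x)))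
        \<le> cmod (g y) * (2 * (LINT x|lborel. cmod (f x)))" for m
      using bd by (auto simp: abs_mult intro!: mult_left_mono)
  qed (use g in simp_all)
  then show ?thesis by simp
qed

text \<open>Minkowski's integral inequality, by Tonelli. The second part permits splitting the inner
  integral into two at almost every \<open>x\<close>.\<close>

lemma mean_modulus_bound:
  fixes f g :: "'a::euclidean_space \<Rightarrow> complex"
  assumes g: "integrable lborel g" and f: "integrable lborel f"
  shows "(LINT x|lborel. cmod (LINT y|lborel. g y * (f (x - s *\<^sub>R y) - f x)))
    \<le> (LINT y|lborel. cmod (g y) * (LINT x|lborel. cmod (f (x - s *\<^sub>R y) - f x)))"
    and "AE x in lborel. integrable lborel (\<lambda>y. g y * (f (x - s *\<^sub>R y) - f x))"
proof -
  have [measurable]: "f \<in> borel_measurable borel" "g \<in> borel_measurable borel" using f g by auto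
  let ?H = "\<lambda>y x. g y * (f (x - s *\<^sub>R y) - f x)"
  note bd = integral_translate_diff_le[OF f]
  have m: "(\<lambda>(y, x). ?H y x) \<in> borel_measurable (borel \<Otimes>\<^sub>M borel)" by measurable
  have i: "integrable lborel (?H y)" for y
    using f integrable_translate(3)[OF f, of "s *\<^sub>R y"] by simp
  have b: "(LINT x|lborel. norm (?H y x)) \<le> cmod (g y) * (2 * (LINT x|lborel. cmod (f x)))" for y
    using bd[of "s *\<^sub>R y"] by (auto simp: norm_mult intro!: mult_left_mono)
  have G: "integrable lborel (\<lambda>y. cmod (g y) * (2 * (LINT x|lborel. cmod (f x))))" using g by simp
  note F = Fubini_lborel[OF m i b G]
  show "AE x in lborel. integrable lborel (\<lambda>y. ?H y x)" by (rule F(4))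
  have m': "(\<lambda>(y, x). norm (?H y x)) \<in> borel_measurable (borel \<Otimes>\<^sub>M borel)" by measurable
  have i': "integrable lborel (\<lambda>x. norm (?H y x))" for y using i by (rule integrable_norm)
  have b': "(LINT x|lborel. norm (norm (?H y x))) \<le> cmod (g y) * (2 * (LINT x|lborel. cmod (f x)))" for y
    using b by simp
  note F' = Fubini_lborel[OF m' i' b' G]
  have "(LINT x|lborel. cmod (LINT y|lborel. ?H y x)) \<le> (LINT x|lborel. LINT y|lborel. norm (?H y x))"
    by (rule integral_mono[OF integrable_norm[OF F(2)] F'(2)]) (rule integral_norm_bound)
  also have "\<dots> = (LINT y|lborel. LINT x|lborel. norm (?H y x))" by (rule F'(3)[symmetric])
  finally show "(LINT x|lborel. cmod (LINT y|lborel. ?H y x)) \<le> (LINT y|lborel. cmod (g y) * (LINT x|lborel. cmod (f (x - s *\<^sub>R y) - f x)))"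
    by (simp add: norm_mult)
qed


text \<open>Three reductions: modulated kernels of narrow band (\<open>local_lim\<close>), dilates
  of \<open>k\<close> with arbitrary compact band (\<open>dil\<close>), and a general
  \<open>f\<close> as the \<open>L1\<close> limit of its convolutions with normalised dilates of
  \<open>k\<close>.\<close>

theorem wiener_tauberian_sequential:
  fixes h :: "nat \<Rightarrow> 'a::euclidean_space \<Rightarrow> complex"
  assumes hm: "\<And>n. h n \<in> borel_measurable borel" and hb: "\<And>n z. cmod (h n z) \<le> M"
    and g: "integrable lborel g" and nz: "\<And>\<zeta>. fourier g \<zeta> \<noteq> 0" and lim: "\<And>w. corr h g w \<longlonglongrightarrow> 0"
    and f: "integrable lborel f"
  shows "corr h f w \<longlonglongrightarrow> 0"
proof -
  note corr_rules = corr_local_tendsto_0[OF hm hb g lim]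
  obtain a k v :: "'a \<Rightarrow> complex"
    where a: "integrable lborel a" "\<And>\<xi>. norm \<xi> > 2 \<Longrightarrow> a \<xi> = 0"
      and k: "integrable lborel k" and v: "integrable lborel v"
      and ka: "k = fourier a" and vk: "conv v k = k" and k0: "k 0 \<noteq> 0" and kint: "(LINT y|lborel. k y) \<noteq> 0"
    by (rule wiener_kernel) blast
  have [measurable]: "a \<in> borel_measurable borel" "k \<in> borel_measurable borel" "v \<in> borel_measurable borel"
     "g \<in> borel_measurable borel" "f \<in> borel_measurable borel" "\<And>n. h n \<in> borel_measurable borel"
    using a k v g f hm by auto
  define A where "A = (LINT \<xi>|lborel. cmod (a \<xi>))"
  have kA: "cmod (k y) \<le> A" for y unfolding ka A_def by (rule norm_fourier_le)
  define \<delta> where "\<delta> m = 1 / real (Suc m)" for m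
  have \<delta>: "\<delta> m > 0" for m by (simp add: \<delta>_def)
  have \<delta>0: "\<delta> \<longlonglongrightarrow> 0" unfolding \<delta>_def by (rule LIMSEQ_Suc[OF lim_1_over_n])
  \<comment> \<open>No frequency enters this quantity: modulating \<open>g\<close> leaves
    \<open>cmod (g y)\<close> unchanged. That is what makes a single \<open>m\<close> work for a
    whole compact set of frequencies.\<close>
  define e where "e m = (LINT y|lborel. cmod (g y) * (LINT x|lborel. cmod (v (x - \<delta> m *\<^sub>R y) - v x)))" for m
  have e0: "e \<longlonglongrightarrow> 0" unfolding e_def \<delta>_def by (rule mean_modulus_tendsto_0[OF g v])
  have kd: "integrable lborel (\<lambda>z. k (c *\<^sub>R z))" if "c > 0" for c by (rule integral_dilation(1)[OF k that])
  have kc: "integrable lborel (\<lambda>z. ee (\<zeta> \<bullet> z) * k (c *\<^sub>R z))" if "c > 0" for c \<zeta>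
    by (rule Bochner_Integration.integrable_bound[OF kd[OF that]]) (auto simp: norm_mult)
  have local_lim: "corr h (\<lambda>z. ee (\<zeta> \<bullet> z) * k (\<delta> m *\<^sub>R z)) w \<longlonglongrightarrow> 0"
    if em: "e m \<le> cmod (fourier g \<zeta>) / 2" for m \<zeta> w
  proof (rule corr_rules)
    let ?d = "\<delta> m" let ?D = "complex_of_real (?d ^ DIM('a))"
    let ?Y = "\<lambda>z. ee (\<zeta> \<bullet> z) * k (?d *\<^sub>R z)"
    define vd where "vd z = ?D * v (?d *\<^sub>R z)" for z
    \<comment> \<open>The kernel \<open>v\<close>, compressed in frequency by
      \<open>\<delta> m\<close> with its \<open>L1\<close> norm kept, and moved to the frequency
      \<zeta>.\<close>
    define U where "U z = ee (\<zeta> \<bullet> z) * vd z" for z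
    have vd: "integrable lborel vd"
      unfolding vd_def using integral_dilation(1)[OF v \<delta>] by simp
    have [measurable]: "vd \<in> borel_measurable borel" using vd by auto
    show "integrable lborel ?Y" by (rule kc[OF \<delta>])
    show U: "integrable lborel U"
      unfolding U_def by (rule Bochner_Integration.integrable_bound[OF vd]) (auto simp: norm_mult)
    show "fourier g \<zeta> \<noteq> 0" by (rule nz)
    \<comment> \<open>The identity \<open>conv v k = k\<close> survives dilation and modulation,
      because \<open>?Y\<close> and \<open>U\<close> carry the same dilation factor and the same
      character.\<close>
    show "?Y = conv ?Y U"
    proof
      fix x
      have i: "integrable lborel (\<lambda>u. v u * k (?d *\<^sub>R x - u))"
        by (rule Bochner_Integration.integrable_bound[of _ "\<lambda>u. v u * complex_of_real A"])
           (use v kA in \<open>auto simp: norm_mult intro!: mult_left_mono order_trans[OF kA abs_ge_self]\<close>)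
      have "conv ?Y U x = conv U ?Y x" by (simp add: conv_commute)
      also have "\<dots> = (LINT y|lborel. ee (\<zeta> \<bullet> x) * ?D * (v (?d *\<^sub>R y) * k (?d *\<^sub>R x - ?d *\<^sub>R y)))"
        unfolding conv_def
      proof (rule Bochner_Integration.integral_cong[OF refl])
        fix y
        have "ee (\<zeta> \<bullet> y) * ee (\<zeta> \<bullet> (x - y)) = ee (\<zeta> \<bullet> x)"
          unfolding ee_add[symmetric] by (simp add: inner_diff_right)
        then show "U y * ?Y (x - y) = ee (\<zeta> \<bullet> x) * ?D * (v (?d *\<^sub>R y) * k (?d *\<^sub>R x - ?d *\<^sub>R y))"
          by (simp add: U_def vd_def scaleR_diff_right mult_ac flip: \<open>ee (\<zeta> \<bullet> y) * ee (\<zeta> \<bullet> (x - y)) = ee (\<zeta> \<bullet> x)\<close>)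
      qed
      also have "\<dots> = ee (\<zeta> \<bullet> x) * ?D * (LINT y|lborel. v (?d *\<^sub>R y) * k (?d *\<^sub>R x - ?d *\<^sub>R y))"
        by (rule integral_mult_right_zero)
      also have "(LINT y|lborel. v (?d *\<^sub>R y) * k (?d *\<^sub>R x - ?d *\<^sub>R y)) = (1 / ?d ^ DIM('a)) *\<^sub>R conv v k (?d *\<^sub>R x)"
        unfolding conv_def by (rule integral_dilation(2)[OF i \<delta>])
      finally show "?Y x = conv ?Y U x"
        using \<delta>[of m] by (simp add: vk scaleR_conv_of_real)
    qed
    have mod: "(LINT x|lborel. cmod (vd (x - 1 *\<^sub>R y) - vd x)) = (LINT x|lborel. cmod (v (x - ?d *\<^sub>R y) - v x))" for y
    proof -
      have iv: "integrable lborel (\<lambda>x. cmod (v (x - ?d *\<^sub>R y) - v x))"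
        using v integrable_translate(3)[OF v, of "?d *\<^sub>R y"] by simp
      have "(LINT x|lborel. cmod (vd (x - 1 *\<^sub>R y) - vd x)) = (LINT x|lborel. ?d ^ DIM('a) * cmod (v (?d *\<^sub>R x - ?d *\<^sub>R y) - v (?d *\<^sub>R x)))"
        using \<delta>[of m] by (simp add: vd_def scaleR_diff_right norm_mult norm_power flip: right_diff_distrib)
      also have "\<dots> = ?d ^ DIM('a) * (LINT x|lborel. cmod (v (?d *\<^sub>R x - ?d *\<^sub>R y) - v (?d *\<^sub>R x)))"
        by (rule integral_mult_right_zero)
      also have "\<dots> = (LINT x|lborel. cmod (v (x - ?d *\<^sub>R y) - v x))"
        using integral_dilation(2)[OF iv \<delta>[of m]] \<delta>[of m] by simp
      finally show ?thesis .
    qed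
    \<comment> \<open>Pulling the character of \<open>U\<close> out of \<open>conv g U\<close>
      leaves this modulated \<open>g\<close>, whose integral is \<open>fourier g \<zeta>\<close>;
      the error is thus an average of differences of translates of \<open>vd\<close>.\<close>
    let ?g = "\<lambda>y. g y * ee (- (\<zeta> \<bullet> y))"
    have g': "integrable lborel ?g" by (rule fourier_integrable[OF g])
    have "(LINT x|lborel. cmod (fourier g \<zeta> * U x - conv g U x)) = (LINT x|lborel. cmod (LINT y|lborel. ?g y * (vd (x - 1 *\<^sub>R y) - vd x)))"
    proof (rule integral_cong_AE)
      have "integrable lborel (conv g U)" by (rule conv_integrable_pair(2)[OF g U])
      then have [measurable]: "conv g U \<in> borel_measurable borel" "U \<in> borel_measurable borel" using U by auto
      show "(\<lambda>x. cmod (fourier g \<zeta> * U x - conv g U x)) \<in> borel_measurable lborel" by measurable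
      show "(\<lambda>x. cmod (LINT y|lborel. ?g y * (vd (x - 1 *\<^sub>R y) - vd x))) \<in> borel_measurable lborel" by measurable
      show "AE x in lborel. cmod (fourier g \<zeta> * U x - conv g U x) = cmod (LINT y|lborel. ?g y * (vd (x - 1 *\<^sub>R y) - vd x))"
        using mean_modulus_bound(2)[OF g' vd, of 1]
      proof eventually_elim
        case (elim x)
        have i2: "integrable lborel (\<lambda>y. ?g y * vd x)" using g' by simp
        have i1: "integrable lborel (\<lambda>y. ?g y * vd (x - y))"
          using Bochner_Integration.integrable_add[OF elim i2] by (simp add: algebra_simps)
        have "conv g U x = (LINT y|lborel. ee (\<zeta> \<bullet> x) * (?g y * vd (x - y)))"
          unfolding conv_def U_def
          by (rule Bochner_Integration.integral_cong[OF refl]) (simp add: inner_diff_right ee_add[of "\<zeta> \<bullet> x" "- (\<zeta> \<bullet> _)", simplified] mult_ac)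
        also have "\<dots> = ee (\<zeta> \<bullet> x) * (LINT y|lborel. ?g y * vd (x - y))" by (rule integral_mult_right_zero)
        finally have 1: "conv g U x = ee (\<zeta> \<bullet> x) * (LINT y|lborel. ?g y * vd (x - y))" .
        have 2: "fourier g \<zeta> * U x = ee (\<zeta> \<bullet> x) * (LINT y|lborel. ?g y * vd x)"
        proof -
          have "(LINT y|lborel. ?g y * vd x) = fourier g \<zeta> * vd x"
            by (simp only: integral_mult_left_zero fourier_def)
          then show ?thesis by (simp only: U_def mult_ac)
        qed
        have "(LINT y|lborel. ?g y * (vd (x - 1 *\<^sub>R y) - vd x)) = (LINT y|lborel. ?g y * vd (x - y) - ?g y * vd x)"
          by (simp add: right_diff_distrib)
        also have "\<dots> = (LINT y|lborel. ?g y * vd (x - y)) - (LINT y|lborel. ?g y * vd x)"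
          by (rule Bochner_Integration.integral_diff[OF i1 i2])
        finally have "fourier g \<zeta> * U x - conv g U x = - (ee (\<zeta> \<bullet> x) * (LINT y|lborel. ?g y * (vd (x - 1 *\<^sub>R y) - vd x)))"
          unfolding 1 2 by (simp only: right_diff_distrib minus_diff_eq)
        then show ?case by (simp only: norm_minus_cancel norm_mult norm_ee mult_1)
      qed
    qed
    also have "\<dots> \<le> (LINT y|lborel. cmod (?g y) * (LINT x|lborel. cmod (vd (x - 1 *\<^sub>R y) - vd x)))"
      by (rule mean_modulus_bound(1)[OF g' vd])
    also have "\<dots> = e m" unfolding mod e_def by (simp add: norm_mult)
    finally show "(LINT x|lborel. cmod (fourier g \<zeta> * U x - conv g U x)) \<le> cmod (fourier g \<zeta>) / 2"
      using em by simp
  qed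
  have dil: "corr h (\<lambda>z. k (l *\<^sub>R z)) w \<longlonglongrightarrow> 0" if l: "l > 0" for l w
  proof (rule corr_approx_tendsto_0[OF hm hb kd[OF l]])
    fix \<epsilon> :: real assume \<epsilon>: "\<epsilon> > 0"
    have "continuous_on (cball 0 (2 * l)) (\<lambda>\<zeta>. cmod (fourier g \<zeta>))"
      unfolding continuous_on_sequentially by (auto simp: o_def intro!: tendsto_norm tendsto_fourier[OF g])
    moreover have "cball (0::'a) (2 * l) \<noteq> {}" using l by simp
    \<comment> \<open>The frequencies \<open>- l *\<^sub>R \<xi>\<close> with \<xi> in the support
      of \<open>a\<close> lie in the ball of radius \<open>2 * l\<close>. The minimum of
      \<open>cmod (fourier g \<zeta>)\<close> there is positive and fixes one scale for all of
      them.\<close>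
    ultimately obtain \<zeta>0 where \<zeta>0: "\<And>\<zeta>. norm \<zeta> \<le> 2 * l \<Longrightarrow> cmod (fourier g \<zeta>0) \<le> cmod (fourier g \<zeta>)"
      using continuous_attains_inf[OF compact_cball] by (metis mem_cball_0)
    have ev1: "eventually (\<lambda>m. e m < cmod (fourier g \<zeta>0) / 2) sequentially"
      by (rule order_tendstoD(2)[OF e0]) (simp add: nz)
    \<comment> \<open>The second factor is bounded and tends to 1 as the scale goes to 0, so it is a
      mild cutoff; it makes each frequency component of the first factor a kernel covered by
      \<open>local_lim\<close>.\<close>
    define \<Phi> where "\<Phi> m z = k (l *\<^sub>R z) * (k (\<delta> m *\<^sub>R z) / k 0)" for m z
    have [measurable]: "\<Phi> m \<in> borel_measurable borel" for m unfolding \<Phi>_def by measurable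
    have "(\<lambda>m. LINT z|lborel. cmod (k (l *\<^sub>R z) - \<Phi> m z)) \<longlonglongrightarrow> (LINT z::'a|lborel. 0)"
    proof (rule integral_dominated_convergence[where w="\<lambda>z. cmod (k (l *\<^sub>R z)) * (1 + A / cmod (k 0))"])
      show "AE z in lborel. (\<lambda>m. cmod (k (l *\<^sub>R z) - \<Phi> m z)) \<longlonglongrightarrow> 0"
      proof (rule AE_I2)
        fix z :: 'a
        have "(\<lambda>m. \<delta> m *\<^sub>R z) \<longlonglongrightarrow> 0 *\<^sub>R z" by (rule tendsto_scaleR[OF \<delta>0 tendsto_const])
        then have "(\<lambda>m. k (\<delta> m *\<^sub>R z)) \<longlonglongrightarrow> k 0" unfolding ka by (intro tendsto_fourier a) simp
        then have "(\<lambda>m. cmod (k (l *\<^sub>R z) - \<Phi> m z)) \<longlonglongrightarrow> cmod (k (l *\<^sub>R z) - k (l *\<^sub>R z) * (k 0 / k 0))"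
          unfolding \<Phi>_def by (intro tendsto_intros) (auto simp: k0)
        then show "(\<lambda>m. cmod (k (l *\<^sub>R z) - \<Phi> m z)) \<longlonglongrightarrow> 0" using k0 by simp
      qed
      show "AE z in lborel. norm (cmod (k (l *\<^sub>R z) - \<Phi> m z)) \<le> cmod (k (l *\<^sub>R z)) * (1 + A / cmod (k 0))" for m
      proof (rule AE_I2)
        fix z :: 'a
        have "cmod (k (l *\<^sub>R z) - \<Phi> m z) = cmod (k (l *\<^sub>R z)) * cmod (1 - k (\<delta> m *\<^sub>R z) / k 0)"
          unfolding \<Phi>_def norm_mult[symmetric] by (simp add: right_diff_distrib)
        also have "\<dots> \<le> cmod (k (l *\<^sub>R z)) * (1 + A / cmod (k 0))"
        proof (rule mult_left_mono)
          have "cmod (1 - k (\<delta> m *\<^sub>R z) / k 0) \<le> 1 + cmod (k (\<delta> m *\<^sub>R z)) / cmod (k 0)"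
            using norm_triangle_ineq4[of 1 "k (\<delta> m *\<^sub>R z) / k 0"] by (simp add: norm_divide)
          also have "\<dots> \<le> 1 + A / cmod (k 0)" using kA by (simp add: divide_right_mono)
          finally show "cmod (1 - k (\<delta> m *\<^sub>R z) / k 0) \<le> 1 + A / cmod (k 0)" .
        qed simp
        finally show "norm (cmod (k (l *\<^sub>R z) - \<Phi> m z)) \<le> cmod (k (l *\<^sub>R z)) * (1 + A / cmod (k 0))" by simp
      qed
      show "integrable lborel (\<lambda>z. cmod (k (l *\<^sub>R z)) * (1 + A / cmod (k 0)))"
        by (rule integrable_mult_left, rule integrable_norm, rule kd[OF l])
    qed measurable
    then have "(\<lambda>m. LINT z|lborel. cmod (k (l *\<^sub>R z) - \<Phi> m z)) \<longlonglongrightarrow> 0" by simp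
    from order_tendstoD(2)[OF this \<epsilon>]
    have ev2: "eventually (\<lambda>m. (LINT z|lborel. cmod (k (l *\<^sub>R z) - \<Phi> m z)) < \<epsilon>) sequentially" .
    from eventually_happens[OF eventually_conj[OF ev1 ev2]] obtain m
      where m: "e m < cmod (fourier g \<zeta>0) / 2" "(LINT z|lborel. cmod (k (l *\<^sub>R z) - \<Phi> m z)) < \<epsilon>" by auto
    have i\<Phi>: "integrable lborel (\<Phi> m)"
      by (rule Bochner_Integration.integrable_bound[of _ "\<lambda>z. k (l *\<^sub>R z) * complex_of_real (A / cmod (k 0))"])
         (use kd[OF l] kA in \<open>auto simp: \<Phi>_def norm_mult norm_divide intro!: mult_left_mono divide_right_mono order_trans[OF kA abs_ge_self]\<close>)
    let ?Y = "\<lambda>\<xi> z. ee ((- l *\<^sub>R \<xi>) \<bullet> z) * k (\<delta> m *\<^sub>R z)"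
    \<comment> \<open>Expanding \<open>k (l *\<^sub>R z)\<close> as the transform of
      \<open>a\<close> writes \<open>\<Phi> m\<close> as a superposition of the modulated kernels
      \<open>?Y \<xi>\<close>.\<close>
    have rep: "corr h (\<Phi> m) w n = (LINT \<xi>|lborel. a \<xi> / k 0 * corr h (?Y \<xi>) w n)" for n
    proof -
      let ?F = "\<lambda>z \<xi>. a \<xi> * ee (- ((l *\<^sub>R z) \<bullet> \<xi>)) * (k (\<delta> m *\<^sub>R z) / k 0 * h n (w + z))"
      have "corr h (\<Phi> m) w n = (LINT z|lborel. LINT \<xi>|lborel. ?F z \<xi>)"
        unfolding corr_def
      proof (rule Bochner_Integration.integral_cong[OF refl])
        fix z
        have "(LINT \<xi>|lborel. ?F z \<xi>) = fourier a (l *\<^sub>R z) * (k (\<delta> m *\<^sub>R z) / k 0 * h n (w + z))"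
          unfolding fourier_def by (rule integral_mult_left_zero)
        then show "\<Phi> m z * h n (w + z) = (LINT \<xi>|lborel. ?F z \<xi>)"
          by (simp only: \<Phi>_def ka[symmetric] mult.assoc)
      qed
      also have "\<dots> = (LINT \<xi>|lborel. LINT z|lborel. ?F z \<xi>)"
      proof (rule Fubini_lborel(3))
        show "integrable lborel (?F z)" for z
          by (rule integrable_mult_left[OF fourier_integrable[OF a(1)]])
        show "(LINT \<xi>|lborel. norm (?F z \<xi>)) \<le> A * (cmod (k (\<delta> m *\<^sub>R z)) / cmod (k 0) * M)" for z
        proof -
          have "(LINT \<xi>|lborel. norm (?F z \<xi>)) = A * (cmod (k (\<delta> m *\<^sub>R z)) / cmod (k 0) * cmod (h n (w + z)))"
            by (simp add: norm_mult norm_divide A_def)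
          also have "\<dots> \<le> A * (cmod (k (\<delta> m *\<^sub>R z)) / cmod (k 0) * M)"
            by (intro mult_left_mono hb) (auto simp: A_def)
          finally show ?thesis .
        qed
        show "integrable lborel (\<lambda>z. A * (cmod (k (\<delta> m *\<^sub>R z)) / cmod (k 0) * M))"
          using kd[OF \<delta>] by simp
      qed measurable
      also have "\<dots> = (LINT \<xi>|lborel. a \<xi> / k 0 * corr h (?Y \<xi>) w n)"
      proof (rule Bochner_Integration.integral_cong[OF refl])
        fix \<xi>
        have "?F z \<xi> = a \<xi> / k 0 * (?Y \<xi> z * h n (w + z))" for z
          by (simp add: inner_commute[of z])
        then have "(LINT z|lborel. ?F z \<xi>) = (LINT z|lborel. a \<xi> / k 0 * (?Y \<xi> z * h n (w + z)))"
          by (intro Bochner_Integration.integral_cong[OF refl])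
        then show "(LINT z|lborel. ?F z \<xi>) = a \<xi> / k 0 * corr h (?Y \<xi>) w n"
          by (simp only: integral_mult_right_zero corr_def)
      qed
      finally show ?thesis .
    qed
    have "(\<lambda>n. LINT \<xi>|lborel. a \<xi> / k 0 * corr h (?Y \<xi>) w n) \<longlonglongrightarrow> (LINT \<xi>::'a|lborel. 0)"
    proof (rule integral_dominated_convergence[where w="\<lambda>\<xi>. cmod (a \<xi>) / cmod (k 0) * (M * (LINT z|lborel. cmod (k (\<delta> m *\<^sub>R z))))"])
      show "(\<lambda>\<xi>. a \<xi> / k 0 * corr h (?Y \<xi>) w n) \<in> borel_measurable lborel" for n
        unfolding corr_def by measurable
      show "AE \<xi> in lborel. (\<lambda>n. a \<xi> / k 0 * corr h (?Y \<xi>) w n) \<longlonglongrightarrow> 0"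
      proof (rule AE_I2)
        fix \<xi> :: 'a
        show "(\<lambda>n. a \<xi> / k 0 * corr h (?Y \<xi>) w n) \<longlonglongrightarrow> 0"
        proof (cases "norm \<xi> > 2")
          case False
          then have "norm (- l *\<^sub>R \<xi>) \<le> 2 * l" using l by (simp add: mult.commute)
          from \<zeta>0[OF this] m(1) have "e m \<le> cmod (fourier g (- l *\<^sub>R \<xi>)) / 2" by linarith
          from local_lim[OF this] show ?thesis by (rule tendsto_mult_right_zero)
        qed (simp add: a)
      qed
      show "AE \<xi> in lborel. norm (a \<xi> / k 0 * corr h (?Y \<xi>) w n) \<le> cmod (a \<xi>) / cmod (k 0) * (M * (LINT z|lborel. cmod (k (\<delta> m *\<^sub>R z))))" for n
      proof (rule AE_I2)
        fix \<xi> :: 'a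
        have "cmod (corr h (?Y \<xi>) w n) \<le> M * (LINT z|lborel. cmod (?Y \<xi> z))"
          by (rule corr_bound[OF hm hb kc[OF \<delta>]])
        then have "cmod (corr h (?Y \<xi>) w n) \<le> M * (LINT z|lborel. cmod (k (\<delta> m *\<^sub>R z)))"
          by (simp only: norm_mult norm_ee mult_1)
        then show "norm (a \<xi> / k 0 * corr h (?Y \<xi>) w n) \<le> cmod (a \<xi>) / cmod (k 0) * (M * (LINT z|lborel. cmod (k (\<delta> m *\<^sub>R z))))"
          unfolding norm_mult norm_divide by (rule mult_left_mono) simp
      qed
    qed (use a in simp_all)
    then have "(\<lambda>n. corr h (\<Phi> m) w n) \<longlonglongrightarrow> 0" unfolding rep by simp
    then show "\<exists>k'. integrable lborel k' \<and> (LINT z|lborel. cmod (k (l *\<^sub>R z) - k' z)) < \<epsilon> \<and> corr h k' w \<longlonglongrightarrow> 0"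
      using i\<Phi> m(2) by blast
  qed
  show ?thesis
  proof (rule corr_approx_tendsto_0[OF hm hb f])
    fix \<epsilon> :: real assume \<epsilon>: "\<epsilon> > 0"
    define \<kappa> where "\<kappa> = (LINT y|lborel. k y)"
    let ?k = "\<lambda>y. k y / \<kappa>"
    have k': "integrable lborel ?k" using k by simp
    have "(\<lambda>m. LINT y|lborel. cmod (?k y) * (LINT x|lborel. cmod (f (x - \<delta> m *\<^sub>R y) - f x))) \<longlonglongrightarrow> 0"
      unfolding \<delta>_def by (rule mean_modulus_tendsto_0[OF k' f])
    from order_tendstoD(2)[OF this \<epsilon>] obtain m where
      m: "(LINT y|lborel. cmod (?k y) * (LINT x|lborel. cmod (f (x - \<delta> m *\<^sub>R y) - f x))) < \<epsilon>"
      by (auto simp: eventually_sequentially)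
    define l where "l = real (Suc m)"
    have l: "l > 0" "\<delta> m = 1 / l" by (simp_all add: l_def \<delta>_def)
    \<comment> \<open>The power of \<open>l\<close> restores the \<open>L1\<close> mass lost by
      dilation and \<kappa> normalises it to integral 1, so \<open>F\<close> is \<open>f\<close>
      smoothed by an approximate identity at scale \<open>1 / l = \<delta> m\<close>.\<close>
    define c where "c = complex_of_real (l ^ DIM('a)) / \<kappa>"
    define F where "F x = c * conv f (\<lambda>z. k (l *\<^sub>R z)) x" for x
    note ic = conv_integrable_pair(2)[OF f kd[OF l(1)]]
    have iF: "integrable lborel F" unfolding F_def using ic by simp
    have limF: "corr h F w \<longlonglongrightarrow> 0"
    proof -
      have "corr h F w = (\<lambda>n. c * corr h (conv f (\<lambda>z. k (l *\<^sub>R z))) w n)"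
        unfolding F_def by (rule ext) (rule corr_cmult[OF hm hb])
      then show ?thesis
        using tendsto_mult_right_zero[OF corr_conv_tendsto_0[OF hm hb f kd[OF l(1)] dil[OF l(1)]], of c] by simp
    qed
    have "(LINT x|lborel. cmod (f x - F x)) = (LINT x|lborel. cmod (LINT y|lborel. ?k y * (f (x - \<delta> m *\<^sub>R y) - f x)))"
    proof (rule integral_cong_AE)
      show "(\<lambda>x. cmod (f x - F x)) \<in> borel_measurable lborel" using iF f by auto
      show "(\<lambda>x. cmod (LINT y|lborel. ?k y * (f (x - \<delta> m *\<^sub>R y) - f x))) \<in> borel_measurable lborel" by measurable
      show "AE x in lborel. cmod (f x - F x) = cmod (LINT y|lborel. ?k y * (f (x - \<delta> m *\<^sub>R y) - f x))"
        using mean_modulus_bound(2)[OF k' f, of "\<delta> m"]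
      proof eventually_elim
        case (elim x)
        have i2: "integrable lborel (\<lambda>y. ?k y * f x)" by (rule integrable_mult_left[OF k'])
        have i1: "integrable lborel (\<lambda>y. ?k y * f (x - \<delta> m *\<^sub>R y))"
          using Bochner_Integration.integrable_add[OF elim i2] by (simp add: algebra_simps)
        have "conv f (\<lambda>z. k (l *\<^sub>R z)) x = (LINT y|lborel. k (l *\<^sub>R y) * f (x - y))"
          by (simp add: conv_commute[of f] conv_def)
        also have "\<dots> = (LINT y|lborel. \<kappa> * (?k (l *\<^sub>R y) * f (x - \<delta> m *\<^sub>R (l *\<^sub>R y))))"
          using l kint by (simp add: \<kappa>_def)
        also have "\<dots> = \<kappa> * (LINT y|lborel. ?k (l *\<^sub>R y) * f (x - \<delta> m *\<^sub>R (l *\<^sub>R y)))"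
          by (rule integral_mult_right_zero)
        also have "(LINT y|lborel. ?k (l *\<^sub>R y) * f (x - \<delta> m *\<^sub>R (l *\<^sub>R y))) = (1 / l ^ DIM('a)) *\<^sub>R (LINT y|lborel. ?k y * f (x - \<delta> m *\<^sub>R y))"
          by (rule integral_dilation(2)[OF i1 l(1)])
        finally have 1: "F x = (LINT y|lborel. ?k y * f (x - \<delta> m *\<^sub>R y))"
          using l(1) kint by (simp add: F_def c_def \<kappa>_def scaleR_conv_of_real)
        have 2: "f x = (LINT y|lborel. ?k y * f x)"
          using kint by (simp add: \<kappa>_def)
        have "F x - f x = (LINT y|lborel. ?k y * f (x - \<delta> m *\<^sub>R y) - ?k y * f x)"
          unfolding 1 by (subst 2) (rule Bochner_Integration.integral_diff[OF i1 i2, symmetric])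
        also have "\<dots> = (LINT y|lborel. ?k y * (f (x - \<delta> m *\<^sub>R y) - f x))"
          by (simp add: right_diff_distrib)
        finally show ?case by (metis norm_minus_commute)
      qed
    qed
    also have "\<dots> \<le> (LINT y|lborel. cmod (?k y) * (LINT x|lborel. cmod (f (x - \<delta> m *\<^sub>R y) - f x)))"
      by (rule mean_modulus_bound(1)[OF k' f])
    also have "\<dots> < \<epsilon>" by (rule m)
    finally show "\<exists>k'. integrable lborel k' \<and> (LINT z|lborel. cmod (f z - k' z)) < \<epsilon> \<and> corr h k' w \<longlonglongrightarrow> 0"
      using iF limF by blast
  qed
qed

section \<open>Weakly null sequences and compact operators\<close>

lemma unit_vector_exists: "\<exists>\<gamma>::('a::euclidean_space) L2. norm \<gamma> = 1"
proof -
  define \<psi> where "\<psi> = abs_L2 (\<lambda>t::'a. complex_of_real (gauss 1 t))"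
  have sq: "square_integrable (\<lambda>t::'a. complex_of_real (gauss 1 t))" by (rule square_integrable_gauss)
  have "(norm \<psi>)\<^sup>2 \<noteq> 0"
  proof
    assume "(norm \<psi>)\<^sup>2 = 0"
    then have "(LINT t::'a|lborel. (cmod (complex_of_real (gauss 1 t)))\<^sup>2) = 0"
      unfolding \<psi>_def norm_abs_L2[OF sq] .
    then have "AE t::'a in lborel. (cmod (complex_of_real (gauss 1 t)))\<^sup>2 = 0"
      using sq by (subst (asm) integral_nonneg_eq_0_iff_AE) (auto simp: square_integrable_def)
    then have "AE t::'a in lborel. False"
    proof eventually_elim
      case (elim t)
      then show ?case using gauss_pos[of 1 t] by simp
    qed
    then have "emeasure lborel (UNIV :: 'a set) = 0" by (simp add: AE_iff_measurable[OF _ refl])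
    then show False by simp
  qed
  then show ?thesis by (intro exI[of _ "(1 / norm \<psi>) *\<^sub>R \<psi>"]) auto
qed

text \<open>The norm bound is part of the notion: it rescales the sequence into the unit ball and
  supplies the majorants for dominated convergence.\<close>

definition weakly_null :: "(nat \<Rightarrow> ('a::euclidean_space) L2) \<Rightarrow> bool" where
  "weakly_null X \<longleftrightarrow> (\<exists>C. \<forall>n. norm (X n) \<le> C) \<and> (\<forall>\<eta>. (\<lambda>n. cinner (X n) \<eta>) \<longlonglongrightarrow> 0)"

lemma weakly_nullE:
  assumes "weakly_null X"
  obtains C where "C > 0" "\<And>n. norm (X n) \<le> C" "\<And>\<eta>. (\<lambda>n. cinner (X n) \<eta>) \<longlonglongrightarrow> 0"
proof -
  obtain C where C: "\<And>n. norm (X n) \<le> C" using assms by (auto simp: weakly_null_def)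
  show thesis
  proof (rule that[of "max 1 C"])
    show "norm (X n) \<le> max 1 C" for n using C[of n] by simp
  qed (use assms in \<open>auto simp: weakly_null_def\<close>)
qed

lemma weakly_null_tf_adj: "weakly_null X \<Longrightarrow> weakly_null (\<lambda>n. tf_adj z (X n))"
  by (simp add: weakly_null_def cinner_tf_shift_right[symmetric])

text \<open>If the images stayed away from 0 along a subsequence, compactness would give them a
  cluster point. Moving \<open>T\<close> to its adjoint shows that point to be orthogonal to
  everything, hence 0, a contradiction.\<close>

lemma compact_operator_weakly_null:
  assumes T: "compact_operator T" and X: "weakly_null X"
  shows "(\<lambda>n. T (X n)) \<longlonglongrightarrow> 0"
proof (rule ccontr)
  have bT: "bounded_clinear T" and cT: "compact (closure (T ` cball 0 1))"
    using T by (auto simp: compact_operator_def)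
  obtain S where S: "\<And>a b. cinner (T a) b = cinner a (S b)" using adjoint_exists[OF bT] by metis
  obtain C where C: "C > 0" "\<And>n. norm (X n) \<le> C" "\<And>\<eta>. (\<lambda>n. cinner (X n) \<eta>) \<longlonglongrightarrow> 0"
    using weakly_nullE[OF X] by blast
  assume "\<not> (\<lambda>n. T (X n)) \<longlonglongrightarrow> 0"
  then obtain e where e: "e > 0" "\<And>N. \<exists>n\<ge>N. norm (T (X n)) \<ge> e"
    unfolding LIMSEQ_iff by (auto simp: not_less)
  then have "infinite {n. norm (T (X n)) \<ge> e}"
    unfolding infinite_nat_iff_unbounded_le by auto
  from infinite_enumerate[OF this] obtain r :: "nat \<Rightarrow> nat"
    where "strict_mono r \<and> (\<forall>n. r n \<in> {n. norm (T (X n)) \<ge> e})" by blast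
  then have r: "strict_mono r" "\<And>n. norm (T (X (r n))) \<ge> e" by auto
  define y where "y n = T ((1 / C) *\<^sub>R X (r n))" for n
  have "y n \<in> closure (T ` cball 0 1)" for n
  proof -
    have "(1 / C) *\<^sub>R X (r n) \<in> cball 0 1" using C(1) C(2)[of "r n"] by simp
    then show ?thesis unfolding y_def by (intro subsetD[OF closure_subset] imageI)
  qed
  then obtain l s where l: "strict_mono s" "(y \<circ> s) \<longlonglongrightarrow> l"
    using cT unfolding compact_eq_seq_compact_metric seq_compact_def by metis
  have "cinner l \<eta> = 0" for \<eta>
  proof -
    have "(\<lambda>n. cinner ((y \<circ> s) n) \<eta>) \<longlonglongrightarrow> cinner l \<eta>" by (intro tendsto_cinner l tendsto_const)
    moreover have "(\<lambda>n. cinner (X ((r \<circ> s) n)) (S \<eta>)) \<longlonglongrightarrow> 0"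
      using LIMSEQ_subseq_LIMSEQ[OF C(3) strict_mono_o[OF r(1) l(1)], of "S \<eta>"] by (simp add: o_def)
    from tendsto_mult_right_zero[OF this, of "complex_of_real (1 / C)"]
    have "(\<lambda>n. cinner ((y \<circ> s) n) \<eta>) \<longlonglongrightarrow> 0"
      by (simp add: y_def S cinner_scaleR_left)
    ultimately show ?thesis by (rule LIMSEQ_unique)
  qed
  then have "l = 0" by (intro cinner_eqI) simp
  then have "(\<lambda>n. norm ((y \<circ> s) n)) \<longlonglongrightarrow> 0" using tendsto_norm[OF l(2)] by simp
  moreover have "norm ((y \<circ> s) n) \<ge> e / C" for n
  proof -
    have "y (s n) = (1 / C) *\<^sub>R T (X (r (s n)))"
      unfolding y_def scaleR_L2_def by (rule bounded_clinear_imp(3)[OF bT])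
    then show ?thesis using r(2)[of "s n"] C(1) by (simp add: divide_right_mono)
  qed
  ultimately have "e / C \<le> 0" by (intro LIMSEQ_le_const) auto
  with e(1) C(1) show False by (simp add: divide_le_0_iff)
qed

text \<open>Outside a large ball the tail \<open>H m\<close> of \<open>G\<close> is small in norm
  and Cauchy-Schwarz suffices; inside, \<open>C * cmod (G z)\<close> restricted to the ball is an
  integrable majorant.\<close>

lemma integral_mult_tendsto_0:
  fixes F :: "nat \<Rightarrow> 'a::euclidean_space \<Rightarrow> complex"
  assumes F: "\<And>n. square_integrable (F n)" "\<And>n. norm (abs_L2 (F n)) \<le> C" "\<And>n z. cmod (F n z) \<le> C" "\<And>z. (\<lambda>n. F n z) \<longlonglongrightarrow> 0"
    and G: "square_integrable G"
  shows "(\<lambda>n. LINT z|lborel. cmod (F n z) * cmod (G z)) \<longlonglongrightarrow> 0"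
proof (rule LIMSEQ_I)
  fix e :: real assume e: "e > 0"
  have [measurable]: "F n \<in> borel_measurable borel" "G \<in> borel_measurable borel" for n
    using F(1)[of n] G by (auto simp: square_integrable_def)
  have C0: "C \<ge> 0" using norm_ge_zero order_trans F(2) by blast
  define H where "H m z = (if norm z \<le> real m then 0 else G z)" for m z
  have Hm[measurable]: "H m \<in> borel_measurable borel" for m unfolding H_def by measurable
  have H: "square_integrable (H m)" for m
    unfolding square_integrable_def
  proof
    have iG: "integrable lborel (\<lambda>t. (cmod (G t))\<^sup>2)" using G by (simp add: square_integrable_def)
    show "integrable lborel (\<lambda>t. (cmod (H m t))\<^sup>2)"
      by (rule Bochner_Integration.integrable_bound[OF iG]) (auto simp: H_def)
  qed simp
  have "(\<lambda>m. LINT z|lborel. (cmod (H m z))\<^sup>2) \<longlonglongrightarrow> (LINT z::'a|lborel. 0)"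
  proof (rule integral_dominated_convergence[where w="\<lambda>z. (cmod (G z))\<^sup>2"])
    show "AE z in lborel. (\<lambda>m. (cmod (H m z))\<^sup>2) \<longlonglongrightarrow> 0"
    proof (rule AE_I2, rule tendsto_eventually)
      fix z :: 'a
      obtain N where "norm z \<le> real N" using real_arch_simple by blast
      then have "eventually (\<lambda>m. norm z \<le> real m) sequentially"
        unfolding eventually_sequentially by (intro exI[of _ N]) auto
      then show "eventually (\<lambda>m. (cmod (H m z))\<^sup>2 = 0) sequentially" by eventually_elim (simp add: H_def)
    qed
  qed (use G in \<open>auto simp: square_integrable_def H_def\<close>)
  then have "(\<lambda>m. (norm (abs_L2 (H m)))\<^sup>2) \<longlonglongrightarrow> 0" by (simp add: norm_abs_L2[OF H])
  then have "(\<lambda>m. sqrt ((norm (abs_L2 (H m)))\<^sup>2)) \<longlonglongrightarrow> sqrt 0" by (rule tendsto_real_sqrt)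
  then have "(\<lambda>m. C * norm (abs_L2 (H m))) \<longlonglongrightarrow> C * 0" by (intro tendsto_mult tendsto_const) simp
  then have "eventually (\<lambda>m. C * norm (abs_L2 (H m)) < e / 2) sequentially"
    by (rule order_tendstoD(2)) (use e in simp)
  then obtain m where m: "C * norm (abs_L2 (H m)) < e / 2" by (auto simp: eventually_sequentially)
  have iFG: "integrable lborel (\<lambda>z. cmod (F n z) * cmod (K z))" if "square_integrable K" for n K
    using integrable_norm[OF square_integrable_mult_cnj[OF F(1)[of n] that]] by (simp add: norm_mult)
  have [measurable]: "cball (0::'a) (real m) \<in> sets borel" by simp
  define B where "B n = (LINT z|lborel. indicator (cball 0 (real m)) z * (cmod (F n z) * cmod (G z)))" for n
  have iB: "integrable lborel (\<lambda>z. indicator (cball 0 (real m)) z * (cmod (F n z) * cmod (G z)))" for n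
    by (rule Bochner_Integration.integrable_bound[OF iFG[OF G, of n]]) (auto split: split_indicator)
  have "B \<longlonglongrightarrow> (LINT z::'a|lborel. 0)"
    unfolding B_def
  proof (rule integral_dominated_convergence[where w="\<lambda>z. C * (indicator (cball 0 (real m)) z * cmod (G z))"])
    have "square_integrable (\<lambda>z::'a. complex_of_real (indicator (cball 0 (real m)) z))"
    proof -
      have "integrable lborel (\<lambda>z::'a. (indicator (cball 0 (real m)) z :: real))"
        using emeasure_compact_finite[OF compact_cball, of "0::'a" "real m"] by (intro integrable_real_indicator) simp_all
      moreover have "(cmod (complex_of_real (indicator (cball 0 (real m)) z)))\<^sup>2 = indicator (cball 0 (real m)) z" for z :: 'a
        by (auto split: split_indicator)
      ultimately show ?thesis unfolding square_integrable_def by simp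
    qed
    from integrable_norm[OF square_integrable_mult_cnj[OF this G]]
    show "integrable lborel (\<lambda>z. C * (indicator (cball 0 (real m)) z * cmod (G z)))" by (simp add: norm_mult)
    show "AE z in lborel. (\<lambda>n. indicator (cball 0 (real m)) z * (cmod (F n z) * cmod (G z))) \<longlonglongrightarrow> 0"
      by (intro AE_I2 tendsto_mult_right_zero tendsto_mult_left_zero tendsto_norm_zero F(4))
    show "AE z in lborel. norm (indicator (cball 0 (real m)) z * (cmod (F n z) * cmod (G z))) \<le> C * (indicator (cball 0 (real m)) z * cmod (G z))" for n
      using F(3) by (auto split: split_indicator intro!: mult_right_mono)
  qed measurable
  then have "B \<longlonglongrightarrow> 0" by simp
  then have "eventually (\<lambda>n. B n < e / 2) sequentially" by (rule order_tendstoD(2)) (use e in simp)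
  then have "eventually (\<lambda>n. norm ((LINT z|lborel. cmod (F n z) * cmod (G z)) - 0) < e) sequentially"
  proof eventually_elim
    case (elim n)
    have "(LINT z|lborel. cmod (F n z) * cmod (G z)) =
      (LINT z|lborel. indicator (cball 0 (real m)) z * (cmod (F n z) * cmod (G z)) + cmod (F n z) * cmod (H m z))"
      by (rule Bochner_Integration.integral_cong[OF refl]) (auto simp: H_def split: split_indicator)
    also have "\<dots> = B n + (LINT z|lborel. cmod (F n z) * cmod (H m z))"
      unfolding B_def by (rule Bochner_Integration.integral_add[OF iB iFG[OF H]])
    finally have 1: "(LINT z|lborel. cmod (F n z) * cmod (G z)) = B n + (LINT z|lborel. cmod (F n z) * cmod (H m z))" .
    have "(LINT z|lborel. cmod (F n z) * cmod (H m z)) \<le> norm (abs_L2 (F n)) * norm (abs_L2 (H m))"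
      by (rule integral_norm_mult_le[OF F(1) H])
    also have "\<dots> \<le> C * norm (abs_L2 (H m))" by (intro mult_right_mono F(2)) simp
    finally have "(LINT z|lborel. cmod (F n z) * cmod (G z)) < e" using elim m 1 by linarith
    then show ?case by simp
  qed
  then show "\<exists>N. \<forall>n\<ge>N. norm ((LINT z|lborel. cmod (F n z) * cmod (G z)) - 0) < e" by (simp add: eventually_sequentially)
qed

text \<open>Moyal's identity reconstructs \<open>cinner (X n) \<eta>\<close> from the coefficients
  against the shifts of one unit window. Testing on those shifts therefore tests on all of
  \<open>L2\<close>.\<close>

lemma weakly_nullI_stft:
  assumes bound: "\<And>n. norm (X n) \<le> C" and \<gamma>: "norm \<gamma> = 1"
    and lim: "\<And>z. (\<lambda>n. cinner (X n) (tf_shift z \<gamma>)) \<longlonglongrightarrow> 0"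
  shows "weakly_null X"
  unfolding weakly_null_def
proof (intro conjI allI)
  show "\<exists>C. \<forall>n. norm (X n) \<le> C" using bound by blast
  fix \<eta>
  have V: "cmod (cinner (X n) (tf_shift z \<gamma>)) \<le> C" for n z
    using norm_cinner_le[of "X n" "tf_shift z \<gamma>"] bound[of n] \<gamma> by simp
  have lim0: "(\<lambda>n. LINT z|lborel. cmod (cinner (X n) (tf_shift z \<gamma>)) * cmod (cinner \<eta> (tf_shift z \<gamma>))) \<longlonglongrightarrow> 0"
    by (rule integral_mult_tendsto_0[where C=C]) (use V bound \<gamma> lim in \<open>auto simp: square_integrable_stft norm_stft\<close>)
  have "cmod (cinner (X n) \<eta>) \<le> (LINT z|lborel. cmod (cinner (X n) (tf_shift z \<gamma>)) * cmod (cinner \<eta> (tf_shift z \<gamma>)))" for n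
  proof -
    have c: "cmod (cinner (tf_shift z \<gamma>) \<eta>) = cmod (cinner \<eta> (tf_shift z \<gamma>))" for z
      by (subst cinner_commute) simp
    have "cinner (X n) \<eta> = (LINT z|lborel. cinner (X n) (tf_shift z \<gamma>) * cinner (tf_shift z \<gamma>) \<eta>)"
      by (simp add: moyal cinner_self \<gamma>)
    also have "cmod \<dots> \<le> (LINT z|lborel. norm (cinner (X n) (tf_shift z \<gamma>) * cinner (tf_shift z \<gamma>) \<eta>))"
      by (rule integral_norm_bound)
    finally show ?thesis by (simp add: norm_mult c)
  qed
  then have "(\<lambda>n. cmod (cinner (X n) \<eta>)) \<longlonglongrightarrow> 0"
    by (intro tendsto_sandwich[OF _ _ tendsto_const lim0]) auto
  then show "(\<lambda>n. cinner (X n) \<eta>) \<longlonglongrightarrow> 0" by (rule tendsto_norm_zero_cancel)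
qed

text \<open>Diagonal extraction over a countable dense set of shifts of one window. Being weakly
  Cauchy is phrased through index sequences \<open>p\<close>, \<open>q\<close> going to infinity, so
  that a failure of the Cauchy property for the images can be contradicted directly.\<close>

lemma weakly_Cauchy_subsequence:
  fixes x :: "nat \<Rightarrow> ('a::euclidean_space) L2"
  assumes bound: "\<And>n. norm (x n) \<le> 1"
  obtains r :: "nat \<Rightarrow> nat" where "strict_mono r"
    "\<And>p q :: nat \<Rightarrow> nat. (\<And>N. p N \<ge> N) \<Longrightarrow> (\<And>N. q N \<ge> N) \<Longrightarrow> weakly_null (\<lambda>N. x (r (p N)) - x (r (q N)))"
proof -
  obtain \<gamma> :: "'a L2" where \<gamma>: "norm \<gamma> = 1" using unit_vector_exists by blast
  obtain D :: "('a \<times> 'a) set" where D: "countable D" "\<And>U. open U \<Longrightarrow> U \<noteq> {} \<Longrightarrow> \<exists>d\<in>D. d \<in> U"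
    by (rule countable_dense_setE) blast
  have Dne: "D \<noteq> {}" using D(2)[of UNIV] by auto
  define d where "d = from_nat_into D"
  define P where "P k s \<longleftrightarrow> convergent (\<lambda>i. cinner (x (s i)) (tf_shift (d k) \<gamma>))" for k and s :: "nat \<Rightarrow> nat"
  interpret subseqs P
  proof
    fix k and s :: "nat \<Rightarrow> nat"
    have "bounded (range (\<lambda>i. cinner (x (s i)) (tf_shift (d k) \<gamma>)))"
    proof (rule boundedI)
      fix c assume "c \<in> range (\<lambda>i. cinner (x (s i)) (tf_shift (d k) \<gamma>))"
      then obtain i where c: "c = cinner (x (s i)) (tf_shift (d k) \<gamma>)" by blast
      show "norm c \<le> 1" unfolding c using norm_cinner_le[of "x (s i)" "tf_shift (d k) \<gamma>"] bound[of "s i"] \<gamma> by simp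
    qed
    from bounded_imp_convergent_subsequence[OF this] obtain l r where
      "strict_mono (r::nat \<Rightarrow> nat)" "((\<lambda>i. cinner (x (s i)) (tf_shift (d k) \<gamma>)) \<circ> r) \<longlonglongrightarrow> l" by blast
    then show "\<exists>r'. strict_mono r' \<and> P k (s \<circ> r')"
      unfolding P_def by (auto simp: convergent_def o_def)
  qed
  have P_sub: "P k (s \<circ> r)" if sm: "strict_mono r" and Ps: "P k s" for r s k
  proof -
    obtain L where "(\<lambda>i. cinner (x (s i)) (tf_shift (d k) \<gamma>)) \<longlonglongrightarrow> L"
      using Ps by (auto simp: P_def convergent_def)
    from LIMSEQ_subseq_LIMSEQ[OF this sm] show ?thesis
      by (auto simp: P_def convergent_def o_def)
  qed
  have conv: "convergent (\<lambda>i. cinner (x (diagseq i)) (tf_shift (d k) \<gamma>))" for k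
  proof -
    \<comment> \<open>The diagonal sequence is a subsequence of the one selected for
      \<open>k\<close> only from index \<open>Suc k\<close> on; the initial segment does not affect
      convergence.\<close>
    have "P k (diagseq \<circ> (+) (Suc k))" by (rule diagseq_holds) (rule P_sub)
    then have "convergent (\<lambda>i. cinner (x (diagseq (i + Suc k))) (tf_shift (d k) \<gamma>))"
      by (simp add: P_def o_def add.commute)
    then show ?thesis by (subst (asm) convergent_ignore_initial_segment)
  qed
  show thesis
  proof (rule that[OF subseq_diagseq])
    fix p q :: "nat \<Rightarrow> nat"
    assume pq: "\<And>N. p N \<ge> N" "\<And>N. q N \<ge> N"
    define X where "X N = x (diagseq (p N)) - x (diagseq (q N))" for N
    have X2: "norm (X N) \<le> 2" for N
      unfolding X_def using norm_triangle_ineq4[of "x (diagseq (p N))" "x (diagseq (q N))"] bound[of "diagseq (p N)"] bound[of "diagseq (q N)"] by linarith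
    have top: "filterlim p at_top sequentially" "filterlim q at_top sequentially"
      using pq by (auto intro: filterlim_at_top_mono[OF filterlim_ident])
    have lim_d: "(\<lambda>N. cinner (X N) (tf_shift (d k) \<gamma>)) \<longlonglongrightarrow> 0" for k
    proof -
      obtain l where l: "(\<lambda>i. cinner (x (diagseq i)) (tf_shift (d k) \<gamma>)) \<longlonglongrightarrow> l"
        using conv[of k] by (auto simp: convergent_def)
      from tendsto_diff[OF filterlim_compose[OF l top(1)] filterlim_compose[OF l top(2)]]
      show ?thesis by (simp add: X_def cinner_diff_left)
    qed
    \<comment> \<open>Strong continuity of the shifts extends the limit from the dense set to all
      \<open>z\<close>, uniformly in \<open>N\<close> because
      \<open>norm (X N) \<le> 2\<close>.\<close>
    have lim: "(\<lambda>N. cinner (X N) (tf_shift z \<gamma>)) \<longlonglongrightarrow> 0" for z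
    proof (rule LIMSEQ_I)
      fix e :: real assume e: "e > 0"
      have "continuous_on UNIV (\<lambda>z. tf_shift z \<gamma>)" by (intro continuous_intros)
      then have "open {w. norm (tf_shift w \<gamma> - tf_shift z \<gamma>) < e / 4}"
        by (intro open_Collect_less continuous_intros)
      moreover have "z \<in> {w. norm (tf_shift w \<gamma> - tf_shift z \<gamma>) < e / 4}" using e by simp
      ultimately obtain w where w: "w \<in> D" "norm (tf_shift w \<gamma> - tf_shift z \<gamma>) < e / 4"
        using D(2)[of "{w. norm (tf_shift w \<gamma> - tf_shift z \<gamma>) < e / 4}"] by blast
      obtain k where k: "w = d k" using from_nat_into_surj[OF D(1) w(1)] by (auto simp: d_def)
      have "eventually (\<lambda>N. norm (cinner (X N) (tf_shift w \<gamma>)) < e / 2) sequentially"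
        unfolding k by (rule order_tendstoD(2)[OF tendsto_norm_zero[OF lim_d]]) (use e in simp)
      then have "eventually (\<lambda>N. norm (cinner (X N) (tf_shift z \<gamma>) - 0) < e) sequentially"
      proof eventually_elim
        case (elim N)
        have "cmod (cinner (X N) (tf_shift w \<gamma> - tf_shift z \<gamma>)) \<le> norm (X N) * norm (tf_shift w \<gamma> - tf_shift z \<gamma>)"
          by (rule norm_cinner_le)
        also have "\<dots> \<le> 2 * (e / 4)" using X2[of N] w(2) by (intro mult_mono) auto
        finally have "cmod (cinner (X N) (tf_shift w \<gamma>) - cinner (X N) (tf_shift z \<gamma>)) \<le> e / 2"
          by (simp add: cinner_diff_right)
        then show ?case using elim
          norm_triangle_ineq4[of "cinner (X N) (tf_shift w \<gamma>)" "cinner (X N) (tf_shift w \<gamma>) - cinner (X N) (tf_shift z \<gamma>)"] by simp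
      qed
      then show "\<exists>N0. \<forall>N\<ge>N0. norm (cinner (X N) (tf_shift z \<gamma>) - 0) < e" by (simp add: eventually_sequentially)
    qed
    show "weakly_null (\<lambda>N. x (diagseq (p N)) - x (diagseq (q N)))"
      using weakly_nullI_stft[OF X2 \<gamma> lim] unfolding X_def .
  qed
qed

text \<open>Applied to differences along a weakly Cauchy subsequence, the hypothesis makes the
  images Cauchy in norm. Points of the closure are handled by replacing them with genuine images at
  distance below \<open>1 / real (Suc n)\<close>.\<close>

lemma compact_operatorI:
  fixes T :: "('a::euclidean_space) L2_op"
  assumes T: "bounded_clinear T" and cc: "\<And>X. weakly_null X \<Longrightarrow> (\<lambda>n. T (X n)) \<longlonglongrightarrow> 0"
  shows "compact_operator T"
  unfolding compact_operator_def
proof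
  show "bounded_clinear T" by (rule T)
  show "compact (closure (T ` cball 0 1))"
    unfolding compact_eq_seq_compact_metric
  proof (rule seq_compactI)
    fix y :: "nat \<Rightarrow> 'a L2"
    assume y: "\<forall>n. y n \<in> closure (T ` cball 0 1)"
    have "\<exists>x. norm x \<le> 1 \<and> dist (T x) (y n) < 1 / real (Suc n)" for n
    proof -
      have "\<exists>u\<in>T ` cball 0 1. dist u (y n) < 1 / real (Suc n)"
        using y[rule_format, of n] unfolding closure_approachable by simp
      then show ?thesis by auto
    qed
    then obtain x where x: "\<And>n. norm (x n) \<le> 1" "\<And>n. dist (T (x n)) (y n) < 1 / real (Suc n)" by metis
    obtain r :: "nat \<Rightarrow> nat" where r: "strict_mono r"
      "\<And>p q :: nat \<Rightarrow> nat. (\<And>N. p N \<ge> N) \<Longrightarrow> (\<And>N. q N \<ge> N) \<Longrightarrow> weakly_null (\<lambda>N. x (r (p N)) - x (r (q N)))"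
      by (rule weakly_Cauchy_subsequence[where x=x, OF x(1)]) blast
    have "Cauchy (\<lambda>n. T (x (r n)))"
    proof (rule ccontr)
      assume "\<not> Cauchy (\<lambda>n. T (x (r n)))"
      then obtain e where e: "e > 0" "\<And>N. \<exists>p\<ge>N. \<exists>q\<ge>N. norm (T (x (r p)) - T (x (r q))) \<ge> e"
        unfolding Cauchy_iff by (auto simp: not_less)
      then obtain p q where pq: "\<And>N. p N \<ge> N" "\<And>N. q N \<ge> N" "\<And>N. norm (T (x (r (p N))) - T (x (r (q N)))) \<ge> e"
        by metis
      have "(\<lambda>N. T (x (r (p N)) - x (r (q N)))) \<longlonglongrightarrow> 0" by (rule cc[OF r(2)[OF pq(1,2)]])
      then have "(\<lambda>N. norm (T (x (r (p N))) - T (x (r (q N))))) \<longlonglongrightarrow> 0"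
        unfolding bounded_clinear_imp(4)[OF T] by (rule tendsto_norm_zero)
      then have "e \<le> 0" by (rule LIMSEQ_le_const) (use pq(3) in auto)
      with e(1) show False by simp
    qed
    then obtain l where l: "(\<lambda>n. T (x (r n))) \<longlonglongrightarrow> l" using Cauchy_convergent_iff convergent_def by blast
    have "(\<lambda>n. 1 / real (Suc (r n))) \<longlonglongrightarrow> 0"
      using LIMSEQ_subseq_LIMSEQ[OF LIMSEQ_Suc[OF lim_1_over_n] r(1)] by (simp add: o_def)
    then have "(\<lambda>n. T (x (r n)) - y (r n)) \<longlonglongrightarrow> 0"
      by (rule Lim_null_comparison[rotated]) (use x(2) in \<open>auto simp: dist_norm less_imp_le\<close>)
    from tendsto_diff[OF l this] have ly: "(y \<circ> r) \<longlonglongrightarrow> l" by (simp add: o_def)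
    have "l \<in> closure (T ` cball 0 1)"
      by (rule closed_sequentially[OF closed_closure _ ly]) (use y in simp)
    then show "\<exists>l\<in>closure (T ` cball 0 1). \<exists>r. strict_mono r \<and> (y \<circ> r) \<longlonglongrightarrow> l"
      using r(1) ly by blast
  qed
qed

text \<open>The modulus \<open>F\<close> of the coefficient is square integrable by Moyal. A value
  at least \<open>e\<close> forces at least \<open>e / 2\<close> on a ball of fixed radius, but the
  mass of \<open>(F w)\<^sup>2\<close> on balls moving to infinity vanishes.\<close>

lemma weakly_null_tf_shift_at_infinity:
  fixes z :: "nat \<Rightarrow> 'a::euclidean_space \<times> 'a"
  assumes z: "filterlim z at_infinity sequentially"
  shows "weakly_null (\<lambda>n. tf_shift (z n) \<phi>)"
  unfolding weakly_null_def
proof (intro conjI allI)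
  show "\<exists>C. \<forall>n. norm (tf_shift (z n) \<phi>) \<le> C" by auto
  fix \<xi>
  define F where "F w = cmod (cinner (tf_shift w \<phi>) \<xi>)" for w
  have Fc: "F w = cmod (cinner \<xi> (tf_shift w \<phi>))" for w
    unfolding F_def by (subst cinner_commute) simp
  have iF: "integrable lborel (\<lambda>w. (F w)\<^sup>2)"
    unfolding Fc using square_integrable_stft[of \<xi> \<phi>] by (simp add: square_integrable_def)
  have [measurable]: "F \<in> borel_measurable borel"
    unfolding F_def by (intro borel_measurable_continuous_onI continuous_intros)
  have "(\<lambda>n. F (z n)) \<longlonglongrightarrow> 0"
  proof (rule LIMSEQ_I)
    fix e :: real assume e: "e > 0"
    have cont: "continuous_on UNIV (\<lambda>u. norm (tf_shift u \<phi> - \<phi>) * norm \<xi>)" by (intro continuous_intros)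
    have "isCont (\<lambda>u. norm (tf_shift u \<phi> - \<phi>) * norm \<xi>) 0"
      using cont continuous_on_eq_continuous_at[OF open_UNIV] by blast
    then have "\<exists>d>0. \<forall>u. dist u 0 < d \<longrightarrow> dist (norm (tf_shift u \<phi> - \<phi>) * norm \<xi>) (norm (tf_shift 0 \<phi> - \<phi>) * norm \<xi>) < e / 2"
      using e unfolding continuous_at_eps_delta by (metis half_gt_zero)
    then obtain d where d: "d > 0" "\<And>u. norm u < d \<Longrightarrow> norm (tf_shift u \<phi> - \<phi>) * norm \<xi> < e / 2"
      by (auto simp: tf_shift_0 dist_norm)
    \<comment> \<open>\<open>tf_shift w\<close> is isometric, so the radius \<open>d\<close> found
      at the origin works at every \<open>w\<close>.\<close>
    have low: "F (w + u) \<ge> F w - e / 2" if "norm u < d" for w u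
    proof -
      have "F (w + u) = cmod (cinner (tf_shift w (tf_shift u \<phi>)) \<xi>)"
        by (simp add: F_def tf_shift_tf_shift cinner_scaleC_left norm_mult)
      also have "\<dots> = cmod (cinner (tf_shift w \<phi>) \<xi> + cinner (tf_shift w (tf_shift u \<phi> - \<phi>)) \<xi>)"
        by (simp add: tf_shift_diff cinner_diff_left)
      also have "\<dots> \<ge> F w - cmod (cinner (tf_shift w (tf_shift u \<phi> - \<phi>)) \<xi>)"
        unfolding F_def by (metis norm_diff_ineq)
      moreover have "cmod (cinner (tf_shift w (tf_shift u \<phi> - \<phi>)) \<xi>) \<le> e / 2"
        using norm_cinner_le[of "tf_shift w (tf_shift u \<phi> - \<phi>)" \<xi>] d(2)[OF that] by simp
      ultimately show ?thesis by linarith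
    qed
    define V where "V = measure lborel (ball (0::'a \<times> 'a) d)"
    have V: "V > 0" unfolding V_def using content_ball_pos[OF d(1), of "0::'a \<times> 'a"] by simp
    have [measurable]: "ball (z n) d \<in> sets borel" for n by simp
    have iI: "integrable lborel (\<lambda>w. indicator (ball (z n) d) w * (F w)\<^sup>2)" for n
      by (rule Bochner_Integration.integrable_bound[OF iF]) (auto split: split_indicator)
    have "(\<lambda>n. LINT w|lborel. indicator (ball (z n) d) w * (F w)\<^sup>2) \<longlonglongrightarrow> (LINT w::'a \<times> 'a|lborel. 0)"
    proof (rule integral_dominated_convergence[where w="\<lambda>w. (F w)\<^sup>2"])
      show "AE w in lborel. (\<lambda>n. indicator (ball (z n) d) w * (F w)\<^sup>2) \<longlonglongrightarrow> 0"
      proof (rule AE_I2, rule tendsto_eventually)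
        fix w :: "'a \<times> 'a"
        have "eventually (\<lambda>n. norm w + d \<le> norm (z n)) sequentially"
          using z unfolding filterlim_at_infinity[OF order_refl] using d(1) by (metis add_nonneg_pos norm_ge_zero)
        then show "eventually (\<lambda>n. indicator (ball (z n) d) w * (F w)\<^sup>2 = 0) sequentially"
        proof eventually_elim
          case (elim n)
          have "norm (z n) \<le> dist (z n) w + norm w" using norm_triangle_sub[of "z n" w] by (simp add: dist_norm add.commute)
          then have "w \<notin> ball (z n) d" using elim by simp
          then show ?case by simp
        qed
      qed
    qed (use iF in \<open>auto split: split_indicator\<close>)
    then have "(\<lambda>n. LINT w|lborel. indicator (ball (z n) d) w * (F w)\<^sup>2) \<longlonglongrightarrow> 0" by simp
    then have "eventually (\<lambda>n. (LINT w|lborel. indicator (ball (z n) d) w * (F w)\<^sup>2) < (e / 2)\<^sup>2 * V) sequentially"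
      by (rule order_tendstoD(2)) (use e V in simp)
    then have "eventually (\<lambda>n. norm (F (z n) - 0) < e) sequentially"
    proof eventually_elim
      case (elim n)
      show ?case
      proof (rule ccontr)
        assume "\<not> norm (F (z n) - 0) < e"
        then have Fz: "F (z n) \<ge> e" by (simp add: F_def)
        have "(e / 2)\<^sup>2 * V = (LINT w|lborel. (e / 2)\<^sup>2 * indicator (ball 0 d) (w - z n))"
        proof -
          have "(LINT w|lborel. (e / 2)\<^sup>2 * indicator (ball 0 d) (w - z n)) = (e / 2)\<^sup>2 * (LINT w|lborel. indicator (ball 0 d) (w - z n))"
            by (rule integral_mult_right_zero)
          also have "(LINT w|lborel. indicator (ball 0 d) (w - z n)) = (LINT w|lborel. (indicator (ball 0 d) (w::'a \<times> 'a) :: real))"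
            by (rule integral_translate)
          also have "\<dots> = V" by (simp add: V_def)
          finally show ?thesis by (rule sym)
        qed
        also have "\<dots> \<le> (LINT w|lborel. indicator (ball (z n) d) w * (F w)\<^sup>2)"
        proof (rule integral_mono[OF _ iI])
          have "integrable lborel (indicator (ball (0::'a \<times> 'a) d) :: _ \<Rightarrow> real)"
            using emeasure_bounded_finite[OF bounded_ball, of "0::'a \<times> 'a" d] by (intro integrable_real_indicator) simp_all
          from integrable_translate(3)[OF this, of "z n"]
          show "integrable lborel (\<lambda>w. (e / 2)\<^sup>2 * (indicator (ball 0 d) (w - z n) :: real))" by simp
          fix w :: "'a \<times> 'a"
          show "(e / 2)\<^sup>2 * indicator (ball 0 d) (w - z n) \<le> indicator (ball (z n) d) w * (F w)\<^sup>2"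
          proof (cases "norm (w - z n) < d")
            case True
            then have "F w \<ge> e / 2" using low[of "w - z n" "z n"] Fz by simp
            then have "(e / 2)\<^sup>2 \<le> (F w)\<^sup>2" using e by (intro power_mono) auto
            then show ?thesis using True by (simp add: dist_norm norm_minus_commute)
          qed simp
        qed
        finally show False using elim by simp
      qed
    qed
    then show "\<exists>N. \<forall>n\<ge>N. norm (F (z n) - 0) < e" by (simp add: eventually_sequentially)
  qed
  then show "(\<lambda>n. cinner (tf_shift (z n) \<phi>) \<xi>) \<longlonglongrightarrow> 0"
    unfolding F_def by (rule tendsto_norm_zero_cancel)
qed

section \<open>Convolution of functions with operators\<close>

lemma continuous_on_cinner_op_shift:
  assumes "bounded_clinear R"
  shows "continuous_on S (\<lambda>z. cinner (op_shift z R \<xi>) \<eta>)"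
  unfolding cinner_op_shift by (intro continuous_intros continuous_on_bounded_clinear[OF assms])

lemma integrable_mult_continuous_bounded:
  fixes f F :: "'a::euclidean_space \<Rightarrow> complex"
  assumes f: "integrable lborel f" and F: "continuous_on UNIV F" "\<And>z. cmod (F z) \<le> C"
  shows "integrable lborel (\<lambda>z. f z * F z)"
    and "cmod (LINT z|lborel. f z * F z) \<le> (LINT z|lborel. cmod (f z)) * C"
proof -
  have [measurable]: "f \<in> borel_measurable borel" "F \<in> borel_measurable borel"
    using f F by (auto intro: borel_measurable_continuous_onI)
  have C: "cmod (f z * F z) \<le> cmod (f z) * C" for z
    unfolding norm_mult by (rule mult_left_mono[OF F(2)]) simp
  have i: "integrable lborel (\<lambda>z. cmod (f z) * C)" using f by simp
  show int: "integrable lborel (\<lambda>z. f z * F z)"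
    by (rule Bochner_Integration.integrable_bound[OF i]) (use C in \<open>auto intro!: AE_I2 order_trans[OF C abs_ge_self]\<close>)
  have "cmod (LINT z|lborel. f z * F z) \<le> (LINT z|lborel. norm (f z * F z))" by (rule integral_norm_bound)
  also have "\<dots> \<le> (LINT z|lborel. cmod (f z) * C)" by (rule integral_mono[OF integrable_norm[OF int] i C])
  finally show "cmod (LINT z|lborel. f z * F z) \<le> (LINT z|lborel. cmod (f z)) * C" by simp
qed

lemma cinner_op_shift_bound:
  assumes K: "K > 0" "\<And>x. norm (R x) \<le> K * norm x"
  shows "cmod (cinner (op_shift z R \<xi>) \<eta>) \<le> K * norm \<xi> * norm \<eta>"
proof -
  have "cmod (cinner (op_shift z R \<xi>) \<eta>) \<le> norm (R (tf_adj z \<xi>)) * norm (tf_adj z \<eta>)"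
    unfolding cinner_op_shift by (rule norm_cinner_le)
  also have "\<dots> \<le> K * norm \<xi> * norm \<eta>"
    using K(2)[of "tf_adj z \<xi>"] by (simp add: mult_right_mono)
  finally show ?thesis .
qed

text \<open>The weak integral is a bounded sesquilinear form, so
  \<open>sesquilinear_representation\<close> provides an operator; operators with equal matrix
  coefficients coincide, which discharges the definite description.\<close>

lemma fun_op_conv:
  assumes f: "integrable lborel f" and R: "bounded_clinear R"
  shows "bounded_clinear (fun_op_conv f R)"
    and "cinner (fun_op_conv f R \<xi>) \<eta> = (LINT z|lborel. f z * cinner (op_shift z R \<xi>) \<eta>)"
proof -
  obtain K where K: "K > 0" "\<And>x. norm (R x) \<le> K * norm x" using bounded_clinear_bound[OF R] by blast
  note S = bounded_clinear_imp[OF bounded_clinear_op_shift[OF R]]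
  define B where "B \<xi> \<eta> = (LINT z|lborel. f z * cinner (op_shift z R \<xi>) \<eta>)" for \<xi> \<eta>
  note bd = cinner_op_shift_bound[of K R, OF K]
  have int: "integrable lborel (\<lambda>z. f z * cinner (op_shift z R \<xi>) \<eta>)" for \<xi> \<eta>
    by (rule integrable_mult_continuous_bounded(1)[OF f continuous_on_cinner_op_shift[OF R] bd])
  obtain T where T: "bounded_clinear T" "\<And>\<xi> \<eta>. cinner (T \<xi>) \<eta> = B \<xi> \<eta>"
  proof (rule sesquilinear_representation[of B "(LINT z|lborel. cmod (f z)) * K"])
    show "cmod (B \<xi> \<eta>) \<le> (LINT z|lborel. cmod (f z)) * K * norm \<xi> * norm \<eta>" for \<xi> \<eta>
      using integrable_mult_continuous_bounded(2)[OF f continuous_on_cinner_op_shift[OF R] bd, of \<xi> \<eta>]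
      by (simp add: B_def mult.assoc)
    show "B (a + b) c = B a c + B b c" for a b c
      unfolding B_def using int by (simp add: S(2) cinner_add_left distrib_left)
    show "B c (a + b) = B c a + B c b" for a b c
      unfolding B_def using int by (simp add: cinner_add_right distrib_left)
    have "B (k *\<^sub>C a) c = (LINT z|lborel. k * (f z * cinner (op_shift z R a) c))" for k a c
      unfolding B_def by (simp add: S(3) cinner_scaleC_left mult.left_commute)
    then show "B (k *\<^sub>C a) c = k * B a c" for k a c
      by (simp add: B_def)
    have "B c (k *\<^sub>C a) = (LINT z|lborel. cnj k * (f z * cinner (op_shift z R c) a))" for k a c
      unfolding B_def by (simp add: cinner_scaleC_right mult.left_commute)
    then show "B c (k *\<^sub>C a) = cnj k * B c a" for k a c
      by (simp add: B_def)
  qed blast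
  have eq: "fun_op_conv f R = T"
    unfolding fun_op_conv_def
  proof (rule the_equality)
    show "\<forall>\<xi> \<eta>. cinner (T \<xi>) \<eta> = (LINT z|lborel. f z * cinner (op_shift z R \<xi>) \<eta>)"
      using T(2) by (simp add: B_def)
    fix T' assume T': "\<forall>\<xi> \<eta>. cinner (T' \<xi>) \<eta> = (LINT z|lborel. f z * cinner (op_shift z R \<xi>) \<eta>)"
    show "T' = T"
      by (rule ext, rule cinner_eqI) (use T(2) T' in \<open>simp add: B_def\<close>)
  qed
  show "bounded_clinear (fun_op_conv f R)" unfolding eq by (rule T(1))
  show "cinner (fun_op_conv f R \<xi>) \<eta> = (LINT z|lborel. f z * cinner (op_shift z R \<xi>) \<eta>)"
    unfolding eq using T(2) by (simp add: B_def)
qed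

text \<open>The link to \<open>corr\<close>: translating the integrand by \<open>w\<close> amounts
  to applying the same convolution operator to vectors moved by \<open>tf_adj w\<close>.\<close>

lemma cinner_fun_op_conv_shift:
  assumes f: "integrable lborel f" and R: "bounded_clinear R"
  shows "(LINT z|lborel. f z * cinner (op_shift (w + z) R \<xi>) \<eta>) = cinner (fun_op_conv f R (tf_adj w \<xi>)) (tf_adj w \<eta>)"
  by (simp add: fun_op_conv(2)[OF f R] cinner_op_shift_add[OF R])

text \<open>The associativity \<open>(PSP \<star> S) \<star> R = (PSP \<star> R) \<star> S\<close> for \<open>S = \<phi> \<otimes> \<phi>\<close>, in weak form. It reduces to rank-one
  \<open>R\<close>, that is to \<open>stft_parseval\<close>, by inserting the resolution of the identity
  \<open>\<integral> \<pi>(w)\<gamma> \<otimes> \<pi>(w)\<gamma> dw\<close>.\<close>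

lemma autocorrelation_conv:
  fixes \<phi> \<xi> \<eta> :: "('a::euclidean_space) L2"
  assumes R: "bounded_clinear R"
  shows "(LINT z|lborel. complex_of_real ((cmod (cinner \<phi> (tf_shift z \<phi>)))\<^sup>2) * cinner (op_shift z R \<xi>) \<eta>) =
    (LINT z|lborel. cinner (R (tf_shift z \<phi>)) (tf_shift z \<phi>) * (cinner \<xi> (tf_shift z \<phi>) * cinner (tf_shift z \<phi>) \<eta>))"
proof -
  obtain \<gamma> :: "'a L2" where \<gamma>: "norm \<gamma> = 1" using unit_vector_exists by blast
  obtain K where K: "K > 0" "\<And>x. norm (R x) \<le> K * norm x" using bounded_clinear_bound[OF R] by blast
  obtain S where S: "bounded_clinear S" "\<And>a b. cinner (R a) b = cinner a (S b)" using adjoint_exists[OF R] by metis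
  obtain L where L: "L > 0" "\<And>x. norm (S x) \<le> L * norm x" using bounded_clinear_bound[OF S(1)] by blast
  let ?g = "\<lambda>z. complex_of_real ((cmod (cinner \<phi> (tf_shift z \<phi>)))\<^sup>2)"
  let ?k = "\<lambda>a b w. cinner a (tf_shift w \<gamma>) * cinner (R (tf_shift w \<gamma>)) b"
  have g: "?g z = cinner \<phi> (tf_shift z \<phi>) * cinner (tf_shift z \<phi>) \<phi>" for z
    unfolding complex_norm_square by (subst cinner_commute[of "tf_shift z \<phi>" \<phi>]) simp
  \<comment> \<open>Moyal with the unit window \<gamma> in both inner slots and \<open>S b\<close>
    as last vector; moving \<open>S\<close> back gives \<open>R\<close> on the shifted
    window.\<close>
  have rep: "cinner (R a) b = (LINT w|lborel. ?k a b w)" for a b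
    using moyal(2)[of a \<gamma> \<gamma> "S b"] by (simp add: S(2) cinner_self \<gamma>)
  have ki: "integrable lborel (?k a b)" for a b
    using moyal(1)[of a \<gamma> \<gamma> "S b"] by (simp add: S(2))
  have kb: "(LINT w|lborel. norm (?k a b w)) \<le> norm a * (L * norm b)" for a b
  proof -
    have "(LINT w|lborel. norm (?k a b w)) \<le> norm a * norm \<gamma> * (norm (S b) * norm \<gamma>)"
      using integral_norm_stft_le[of a \<gamma> \<gamma> "S b"] by (simp add: norm_mult S(2))
    also have "\<dots> \<le> norm a * (L * norm b)" using L(2)[of b] by (simp add: \<gamma> mult_left_mono)
    finally show ?thesis .
  qed
  \<comment> \<open>Used in both directions: to insert the resolution of the identity on the
    left-hand side, and to remove it once the integrand has been rearranged.\<close>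
  have fubini: "(LINT z|lborel. f z * cinner (R (p z)) (q z)) = (LINT w|lborel. LINT z|lborel. f z * ?k (p z) (q z) w)"
    if f: "integrable lborel f" "continuous_on UNIV f" and p: "continuous_on UNIV p" "\<And>z. norm (p z) \<le> P"
      and q: "continuous_on UNIV q" "\<And>z. norm (q z) \<le> Q" for f :: "'a \<times> 'a \<Rightarrow> complex" and p q P Q
  proof -
    have "(LINT z|lborel. f z * cinner (R (p z)) (q z)) = (LINT z|lborel. LINT w|lborel. f z * ?k (p z) (q z) w)"
    proof (rule Bochner_Integration.integral_cong[OF refl])
      fix z
      show "f z * cinner (R (p z)) (q z) = (LINT w|lborel. f z * ?k (p z) (q z) w)"
        by (subst rep) (simp only: integral_mult_right_zero)
    qed
    also have "\<dots> = (LINT w|lborel. LINT z|lborel. f z * ?k (p z) (q z) w)"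
    proof (rule Fubini_lborel(3))
      have "continuous_on UNIV (\<lambda>x::('a \<times> 'a) \<times> ('a \<times> 'a). f (fst x))" "continuous_on UNIV (\<lambda>x::('a \<times> 'a) \<times> ('a \<times> 'a). p (fst x))"
        "continuous_on UNIV (\<lambda>x::('a \<times> 'a) \<times> ('a \<times> 'a). q (fst x))"
        by (rule continuous_on_compose2[OF f(2)] continuous_on_compose2[OF p(1)] continuous_on_compose2[OF q(1)]; auto intro: continuous_intros)+
      then show "(\<lambda>(z, w). f z * ?k (p z) (q z) w) \<in> borel_measurable (borel \<Otimes>\<^sub>M borel)"
        unfolding borel_prod split_beta
        by (intro borel_measurable_continuous_onI continuous_intros continuous_on_bounded_clinear[OF R])
      show "integrable lborel (\<lambda>w. f z * ?k (p z) (q z) w)" for z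
        using ki by simp
      show "(LINT w|lborel. norm (f z * ?k (p z) (q z) w)) \<le> norm (f z) * (P * (L * Q))" for z
      proof -
        have "(LINT w|lborel. norm (f z * ?k (p z) (q z) w)) = norm (f z) * (LINT w|lborel. norm (?k (p z) (q z) w))"
          unfolding norm_mult[of "f z"] by (rule integral_mult_right_zero)
        also have "\<dots> \<le> norm (f z) * (norm (p z) * (L * norm (q z)))"
          by (intro mult_left_mono kb) simp
        also have "\<dots> \<le> norm (f z) * (P * (L * Q))"
          using p(2)[of z] q(2)[of z] L(1) order_trans[OF norm_ge_zero p(2)] by (intro mult_left_mono mult_mono) auto
        finally show ?thesis .
      qed
      show "integrable lborel (\<lambda>z. norm (f z) * (P * (L * Q)))" using f(1) by simp
    qed
    finally show ?thesis .
  qed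
  have "(LINT z|lborel. ?g z * cinner (op_shift z R \<xi>) \<eta>) = (LINT z|lborel. ?g z * cinner (R (tf_adj z \<xi>)) (tf_adj z \<eta>))"
    by (simp only: cinner_op_shift)
  also have "\<dots> = (LINT w|lborel. LINT z|lborel. ?g z * ?k (tf_adj z \<xi>) (tf_adj z \<eta>) w)"
  proof (rule fubini)
    show "integrable lborel ?g" unfolding g by (rule moyal(1))
    show "continuous_on UNIV ?g" by (intro continuous_intros)
    show "continuous_on UNIV (\<lambda>z. tf_adj z \<xi>)" "continuous_on UNIV (\<lambda>z. tf_adj z \<eta>)" by (intro continuous_intros)+
    show "norm (tf_adj z \<xi>) \<le> norm \<xi>" "norm (tf_adj z \<eta>) \<le> norm \<eta>" for z by simp_all
  qed
  also have "\<dots> = (LINT w|lborel. LINT z|lborel. cinner \<xi> (tf_shift z \<phi>) * cinner (tf_shift z \<phi>) \<eta> * ?k (tf_shift z \<phi>) (tf_shift z \<phi>) w)"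
  proof (rule Bochner_Integration.integral_cong[OF refl])
    fix w
    let ?a = "R (tf_shift w \<gamma>)" and ?b = "tf_shift w \<gamma>"
    have "(LINT z|lborel. ?g z * ?k (tf_adj z \<xi>) (tf_adj z \<eta>) w) =
      (LINT z|lborel. cinner \<phi> (tf_shift z \<phi>) * cinner (tf_shift z ?a) \<eta> * (cinner \<xi> (tf_shift z ?b) * cinner (tf_shift z \<phi>) \<phi>))"
      unfolding g cinner_tf_shift_right[symmetric] cinner_tf_shift_left[symmetric] by (simp only: mult_ac)
    \<comment> \<open>For fixed \<open>w\<close> the operator has become the rank-one pair
      \<open>?a\<close>, \<open>?b\<close>. The identity exchanges shifts of these two vectors for
      shifts of \<phi>.\<close>
    also have "\<dots> = (LINT z|lborel. cinner (tf_shift z \<phi>) \<eta> * cinner ?a (tf_shift z \<phi>) * (cinner \<xi> (tf_shift z \<phi>) * cinner (tf_shift z \<phi>) ?b))"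
      by (rule stft_parseval[symmetric])
    also have "\<dots> = (LINT z|lborel. cinner \<xi> (tf_shift z \<phi>) * cinner (tf_shift z \<phi>) \<eta> * ?k (tf_shift z \<phi>) (tf_shift z \<phi>) w)"
      by (simp only: mult_ac)
    finally show "(LINT z|lborel. ?g z * ?k (tf_adj z \<xi>) (tf_adj z \<eta>) w) =
      (LINT z|lborel. cinner \<xi> (tf_shift z \<phi>) * cinner (tf_shift z \<phi>) \<eta> * ?k (tf_shift z \<phi>) (tf_shift z \<phi>) w)" .
  qed
  also have "\<dots> = (LINT z|lborel. cinner \<xi> (tf_shift z \<phi>) * cinner (tf_shift z \<phi>) \<eta> * cinner (R (tf_shift z \<phi>)) (tf_shift z \<phi>))"
  proof (rule fubini[symmetric])
    show "integrable lborel (\<lambda>z. cinner \<xi> (tf_shift z \<phi>) * cinner (tf_shift z \<phi>) \<eta>)" by (rule moyal(1))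
    show "norm (tf_shift z \<phi>) \<le> norm \<phi>" "norm (tf_shift z \<phi>) \<le> norm \<phi>" for z by simp_all
  qed (intro continuous_intros)+
  finally show ?thesis by (simp only: mult_ac)
qed

section \<open>The equivalences\<close>

text \<open>\<open>cohen\<close> tests \<open>R\<close> on the adjoint shift, which explains the
  sign; the phase between \<open>tf_shift z\<close> and \<open>tf_adj (- z)\<close> cancels across
  the two slots.\<close>

lemma cohen_tf_shift:
  assumes R: "bounded_clinear R"
  shows "cinner (R (tf_shift z \<phi>)) (tf_shift z \<phi>) = cohen R \<phi> (- z)"
proof -
  have "tf_shift z \<phi> = ee (snd z \<bullet> fst z) *\<^sub>C tf_adj (- z) \<phi>" by (simp add: tf_adj_def)
  then show ?thesis
    by (simp add: cohen_eq[OF R] cinner_op_shift bounded_clinear_imp(3)[OF R] cinner_scaleC_left cinner_scaleC_right cnj_ee)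
qed

lemma continuous_on_cohen:
  assumes "bounded_clinear R"
  shows "continuous_on UNIV (cohen R \<psi>)"
proof -
  have "cohen R \<psi> = (\<lambda>z. cinner (op_shift z R \<psi>) \<psi>)" by (rule ext) (rule cohen_eq[OF assms])
  then show ?thesis by (simp add: continuous_on_cinner_op_shift[OF assms])
qed

text \<open>Far out \<open>h\<close> is below \<open>d\<close> and the \<open>L2\<close> bound on
  \<open>V n\<close> takes over; on the remaining ball the integrand is bounded by a constant and
  tends to 0 pointwise.\<close>

lemma integral_C0_mult_tendsto_0:
  fixes h :: "'a::euclidean_space \<Rightarrow> complex"
  assumes h: "continuous_on UNIV h" "\<And>z. cmod (h z) \<le> H" "(h \<longlongrightarrow> 0) at_infinity"
    and V: "\<And>n. square_integrable (V n)" "\<And>n. norm (abs_L2 (V n)) \<le> C" "\<And>n z. cmod (V n z) \<le> C" "\<And>z. (\<lambda>n. V n z) \<longlonglongrightarrow> 0"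
  shows "(\<lambda>n. LINT z|lborel. (cmod (h z * V n z))\<^sup>2) \<longlonglongrightarrow> 0"
proof (rule LIMSEQ_I)
  fix e :: real assume e: "e > 0"
  have [measurable]: "h \<in> borel_measurable borel" "V n \<in> borel_measurable borel" for n
    using h(1) V(1)[of n] by (auto simp: square_integrable_def intro: borel_measurable_continuous_onI)
  have C0: "C \<ge> 0" "H \<ge> 0" using norm_ge_zero order_trans V(2) h(2) by blast+
  \<comment> \<open>Chosen so that \<open>d\<^sup>2 * C\<^sup>2 \<le> e / 2\<close>; the added 1
    covers \<open>C = 0\<close>.\<close>
  define d where "d = sqrt (e / (2 * (C\<^sup>2 + 1)))"
  have C1: "C\<^sup>2 + 1 > 0" by (simp add: add_nonneg_pos)
  have d: "d > 0" "d\<^sup>2 = e / (2 * (C\<^sup>2 + 1))" using e C1 by (simp_all add: d_def)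
  have dC: "d\<^sup>2 * C\<^sup>2 \<le> e / 2" using e C1 by (simp add: d(2) field_simps)
  obtain b where b: "\<And>z. norm z \<ge> b \<Longrightarrow> cmod (h z) < d"
    using h(3) d(1) unfolding Lim_at_infinity by (auto simp: dist_norm)
  have [measurable]: "cball (0::'a) b \<in> sets borel" by simp
  have iV: "integrable lborel (\<lambda>z. (cmod (V n z))\<^sup>2)" for n using V(1)[of n] by (simp add: square_integrable_def)
  define B where "B n = (LINT z|lborel. indicator (cball 0 b) z * (H\<^sup>2 * (cmod (V n z))\<^sup>2))" for n
  have iB: "integrable lborel (\<lambda>z. indicator (cball 0 b) z * (H\<^sup>2 * (cmod (V n z))\<^sup>2))" for n
    by (rule Bochner_Integration.integrable_bound[of _ "\<lambda>z. H\<^sup>2 * (cmod (V n z))\<^sup>2"]) (use iV in \<open>auto split: split_indicator\<close>)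
  have "B \<longlonglongrightarrow> (LINT z::'a|lborel. 0)"
    unfolding B_def
  proof (rule integral_dominated_convergence[where w="\<lambda>z. indicator (cball 0 b) z * (H\<^sup>2 * C\<^sup>2)"])
    have "integrable lborel (\<lambda>z::'a. indicator (cball 0 b) z :: real)"
      using emeasure_compact_finite[OF compact_cball, of "0::'a" b] by (intro integrable_real_indicator) simp_all
    then show "integrable lborel (\<lambda>z::'a. indicator (cball 0 b) z * (H\<^sup>2 * C\<^sup>2))" by simp
    show "AE z in lborel. (\<lambda>n. indicator (cball 0 b) z * (H\<^sup>2 * (cmod (V n z))\<^sup>2)) \<longlonglongrightarrow> 0"
    proof (rule AE_I2)
      fix z
      have "(\<lambda>n. indicator (cball 0 b) z * (H\<^sup>2 * (cmod (V n z))\<^sup>2)) \<longlonglongrightarrow> indicator (cball 0 b) z * (H\<^sup>2 * (cmod 0)\<^sup>2)"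
        by (intro tendsto_intros V(4))
      then show "(\<lambda>n. indicator (cball 0 b) z * (H\<^sup>2 * (cmod (V n z))\<^sup>2)) \<longlonglongrightarrow> 0" by simp
    qed
    show "AE z in lborel. norm (indicator (cball 0 b) z * (H\<^sup>2 * (cmod (V n z))\<^sup>2)) \<le> indicator (cball 0 b) z * (H\<^sup>2 * C\<^sup>2)" for n
      using V(3) by (auto split: split_indicator intro!: mult_left_mono power_mono)
  qed measurable
  then have "B \<longlonglongrightarrow> 0" by simp
  then have "eventually (\<lambda>n. B n < e / 2) sequentially" by (rule order_tendstoD(2)) (use e in simp)
  then have "eventually (\<lambda>n. norm ((LINT z|lborel. (cmod (h z * V n z))\<^sup>2) - 0) < e) sequentially"
  proof eventually_elim
    case (elim n)
    have pt: "(cmod (h z * V n z))\<^sup>2 \<le> indicator (cball 0 b) z * (H\<^sup>2 * (cmod (V n z))\<^sup>2) + d\<^sup>2 * (cmod (V n z))\<^sup>2" for z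
    proof (cases "norm z \<le> b")
      case True
      have "(cmod (h z))\<^sup>2 * (cmod (V n z))\<^sup>2 \<le> H\<^sup>2 * (cmod (V n z))\<^sup>2"
        by (intro mult_right_mono power_mono h(2)) auto
      moreover have "0 \<le> d\<^sup>2 * (cmod (V n z))\<^sup>2" by simp
      ultimately show ?thesis using True by (simp add: norm_mult power_mult_distrib add_increasing2)
    next
      case False
      then have "(cmod (h z))\<^sup>2 * (cmod (V n z))\<^sup>2 \<le> d\<^sup>2 * (cmod (V n z))\<^sup>2"
        using b[of z] by (intro mult_right_mono power_mono) auto
      then show ?thesis using False by (simp add: norm_mult power_mult_distrib)
    qed
    have i2: "integrable lborel (\<lambda>z. d\<^sup>2 * (cmod (V n z))\<^sup>2)" using iV by simp
    have i3: "integrable lborel (\<lambda>z. (cmod (h z * V n z))\<^sup>2)"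
      by (rule Bochner_Integration.integrable_bound[OF Bochner_Integration.integrable_add[OF iB[of n] i2]])
         (use pt in \<open>auto intro!: AE_I2 order_trans[OF pt abs_ge_self]\<close>)
    have "(LINT z|lborel. (cmod (h z * V n z))\<^sup>2) \<le> (LINT z|lborel. indicator (cball 0 b) z * (H\<^sup>2 * (cmod (V n z))\<^sup>2) + d\<^sup>2 * (cmod (V n z))\<^sup>2)"
      by (rule integral_mono[OF i3 Bochner_Integration.integrable_add[OF iB i2] pt])
    also have "\<dots> = B n + d\<^sup>2 * (norm (abs_L2 (V n)))\<^sup>2"
      unfolding B_def norm_abs_L2[OF V(1)] using Bochner_Integration.integral_add[OF iB[of n] i2] by simp
    also have "\<dots> \<le> B n + d\<^sup>2 * C\<^sup>2"
      by (intro add_left_mono mult_left_mono power_mono V(2)) auto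
    also have "\<dots> < e" using elim dC by linarith
    finally show ?case by simp
  qed
  then show "\<exists>N. \<forall>n\<ge>N. norm ((LINT z|lborel. (cmod (h z * V n z))\<^sup>2) - 0) < e" by (simp add: eventually_sequentially)
qed

lemma cohen_C0_imp_compact:
  fixes R :: "('a::euclidean_space) L2_op"
  assumes R: "bounded_clinear R" and nz: "\<And>z. stft \<phi> \<phi> z \<noteq> 0" and C0: "cohen R \<phi> \<in> C0"
  shows "\<exists>g\<in>wiener_class. compact_operator (fun_op_conv g R)"
proof
  define g where "g z = complex_of_real ((cmod (cinner \<phi> (tf_shift z \<phi>)))\<^sup>2)" for z
  have g: "g z = cinner \<phi> (tf_shift z \<phi>) * cinner (tf_shift z \<phi>) \<phi>" for z
    unfolding g_def complex_norm_square by (subst cinner_commute[of "tf_shift z \<phi>" \<phi>]) simp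
  have ig: "integrable lborel g" unfolding g by (rule moyal(1))
  have "symplectic_fourier g z \<noteq> 0" for z
  proof -
    have "symplectic_fourier g z = (LINT z'|lborel. cinner \<phi> (tf_shift z' \<phi>) * cinner (tf_shift z' \<phi>) \<phi> * ee (symplectic_form (- z) z'))"
    proof -
      have "exp (- (2 * pi * \<i> * symplectic_form z z')) = ee (symplectic_form (- z) z')" for z'
      proof -
        have "symplectic_form (- z) z' = - symplectic_form z z'" by (simp add: symplectic_form_def)
        then show ?thesis by (simp add: ee_def)
      qed
      then show ?thesis unfolding symplectic_fourier_def g by (simp only:)
    qed
    also have "\<dots> = cinner (tf_shift (- z) \<phi>) \<phi> * cinner \<phi> (tf_shift (- z) \<phi>)" by (rule moyal_fourier)
    also have "\<dots> \<noteq> 0"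
      using nz[of "- z"] unfolding stft_def by (subst cinner_commute[of "tf_shift (- z) \<phi>"]) simp
    finally show ?thesis .
  qed
  with ig show "g \<in> wiener_class" by (simp add: wiener_class_def)
  define T where "T = fun_op_conv g R"
  have T: "bounded_clinear T" unfolding T_def by (rule fun_op_conv(1)[OF ig R])
  obtain K where K: "K > 0" "\<And>x. norm (R x) \<le> K * norm x" using bounded_clinear_bound[OF R] by blast
  define h where "h z = cinner (R (tf_shift z \<phi>)) (tf_shift z \<phi>)" for z
  have h_cont: "continuous_on UNIV h" unfolding h_def by (intro continuous_intros continuous_on_bounded_clinear[OF R])
  have h_bound: "cmod (h z) \<le> K * norm \<phi> * norm \<phi>" for z
  proof -
    have "cmod (h z) \<le> norm (R (tf_shift z \<phi>)) * norm (tf_shift z \<phi>)" unfolding h_def by (rule norm_cinner_le)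
    also have "\<dots> \<le> K * norm \<phi> * norm \<phi>" using K(2)[of "tf_shift z \<phi>"] by (simp add: mult_right_mono)
    finally show ?thesis .
  qed
  have h_lim: "(h \<longlongrightarrow> 0) at_infinity"
    unfolding Lim_at_infinity
  proof (intro allI impI)
    fix e :: real assume "e > 0"
    then obtain b where "\<And>x. norm x \<ge> b \<Longrightarrow> dist (cohen R \<phi> x) 0 < e"
      using C0 unfolding C0_def Lim_at_infinity by blast
    then show "\<exists>b. \<forall>x. b \<le> norm x \<longrightarrow> dist (h x) 0 < e"
      unfolding h_def cohen_tf_shift[OF R] by (metis norm_minus_cancel)
  qed
  have "compact_operator T"
  proof (rule compact_operatorI[OF T])
    fix X :: "nat \<Rightarrow> 'a L2" assume "weakly_null X"
    then obtain C where C: "C > 0" "\<And>n. norm (X n) \<le> C" "\<And>\<eta>. (\<lambda>n. cinner (X n) \<eta>) \<longlonglongrightarrow> 0"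
      using weakly_nullE by blast
    define V where "V n z = cinner (X n) (tf_shift z \<phi>)" for n z
    have sV: "square_integrable (V n)" for n unfolding V_def by (rule square_integrable_stft)
    have V0: "(\<lambda>n. LINT z|lborel. (cmod (h z * V n z))\<^sup>2) \<longlonglongrightarrow> 0"
    proof (rule integral_C0_mult_tendsto_0[OF h_cont h_bound h_lim sV])
      show "norm (abs_L2 (V n)) \<le> C * norm \<phi>" for n
        unfolding V_def norm_stft by (rule mult_right_mono[OF C(2)]) simp
      show "cmod (V n z) \<le> C * norm \<phi>" for n z
        unfolding V_def using norm_cinner_le[of "X n" "tf_shift z \<phi>"] mult_right_mono[OF C(2)[of n] norm_ge_zero[of \<phi>]] by simp
      show "(\<lambda>n. V n z) \<longlonglongrightarrow> 0" for z unfolding V_def by (rule C(3))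
    qed
    have shV: "square_integrable (\<lambda>z. h z * V n z)" for n
      unfolding square_integrable_def
    proof
      have [measurable]: "h \<in> borel_measurable borel" "V n \<in> borel_measurable borel"
        using h_cont sV[of n] by (auto simp: square_integrable_def intro: borel_measurable_continuous_onI)
      show "(\<lambda>z. h z * V n z) \<in> borel_measurable lborel" by measurable
      have "integrable lborel (\<lambda>z. (K * norm \<phi> * norm \<phi>)\<^sup>2 * (cmod (V n z))\<^sup>2)" using sV[of n] by (simp add: square_integrable_def)
      then show "integrable lborel (\<lambda>z. (cmod (h z * V n z))\<^sup>2)"
      proof (rule Bochner_Integration.integrable_bound)
        show "AE z in lborel. norm ((cmod (h z * V n z))\<^sup>2) \<le> norm ((K * norm \<phi> * norm \<phi>)\<^sup>2 * (cmod (V n z))\<^sup>2)"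
          unfolding norm_mult power_mult_distrib
          using h_bound by (intro AE_I2) (auto simp: abs_mult power_mult_distrib[symmetric] intro!: mult_right_mono power_mono)
      qed measurable
    qed
    \<comment> \<open>By \<open>autocorrelation_conv\<close>, \<open>T\<close> multiplies the
      transform of \<open>X n\<close> by the symbol \<open>h\<close> and synthesises again. Testing
      against \<open>T (X n)\<close> itself lets one factor of its norm cancel.\<close>
    have TX: "norm (T (X n)) \<le> norm \<phi> * norm (abs_L2 (\<lambda>z. h z * V n z))" for n
    proof (cases "T (X n) = 0")
      case False
      let ?\<eta> = "T (X n)"
      have "cinner ?\<eta> ?\<eta> = (LINT z|lborel. (h z * V n z) * cinner (tf_shift z \<phi>) ?\<eta>)"
        unfolding T_def fun_op_conv(2)[OF ig R] unfolding g_def autocorrelation_conv[OF R] h_def V_def by (simp only: mult.assoc)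
      then have "cmod (cinner ?\<eta> ?\<eta>) \<le> (LINT z|lborel. norm ((h z * V n z) * cinner (tf_shift z \<phi>) ?\<eta>))"
        by (simp only: integral_norm_bound)
      also have "\<dots> = (LINT z|lborel. cmod (h z * V n z) * cmod (cinner ?\<eta> (tf_shift z \<phi>)))"
        by (subst cinner_commute) (simp only: norm_mult complex_mod_cnj)
      also have "\<dots> \<le> norm (abs_L2 (\<lambda>z. h z * V n z)) * (norm ?\<eta> * norm \<phi>)"
        using integral_norm_mult_le[OF shV square_integrable_stft] by (simp only: norm_stft)
      finally have "norm ?\<eta> * norm ?\<eta> \<le> norm ?\<eta> * (norm \<phi> * norm (abs_L2 (\<lambda>z. h z * V n z)))"
        by (simp add: cinner_self power2_eq_square norm_mult mult_ac)
      then show ?thesis using False by simp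
    qed simp
    have "(\<lambda>n. sqrt (LINT z|lborel. (cmod (h z * V n z))\<^sup>2)) \<longlonglongrightarrow> sqrt 0" by (rule tendsto_real_sqrt[OF V0])
    then have "(\<lambda>n. norm (abs_L2 (\<lambda>z. h z * V n z))) \<longlonglongrightarrow> 0"
      unfolding norm_abs_L2[OF shV, symmetric] by simp
    then have "(\<lambda>n. norm \<phi> * norm (abs_L2 (\<lambda>z. h z * V n z))) \<longlonglongrightarrow> 0" by (rule tendsto_mult_right_zero)
    then show "(\<lambda>n. T (X n)) \<longlonglongrightarrow> 0" by (rule Lim_null_comparison[rotated]) (use TX in simp)
  qed
  then show "compact_operator (fun_op_conv g R)" by (simp add: T_def)
qed

text \<open>At the rotated point \<open>(- snd \<zeta>, fst \<zeta>)\<close> the symplectic form is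
  the Euclidean inner product with \<zeta>, so both transforms take the same values.\<close>

lemma fourier_nonzero_wiener_class:
  assumes g: "g \<in> wiener_class"
  shows "fourier g \<zeta> \<noteq> 0"
proof -
  have "symplectic_fourier g (- snd \<zeta>, fst \<zeta>) \<noteq> 0" using g by (simp add: wiener_class_def)
  moreover have "symplectic_form (- snd \<zeta>, fst \<zeta>) z = \<zeta> \<bullet> z" for z
    by (simp add: symplectic_form_def inner_prod_def inner_commute)
  then have "symplectic_fourier g (- snd \<zeta>, fst \<zeta>) = fourier g \<zeta>"
    by (simp add: symplectic_fourier_def fourier_def ee_def)
  ultimately show ?thesis by simp
qed

lemma wiener_class_compact_imp_all_compact:
  fixes R :: "('a::euclidean_space) L2_op"
  assumes R: "bounded_clinear R" and g: "g \<in> wiener_class" and cg: "compact_operator (fun_op_conv g R)"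
    and f: "integrable lborel f"
  shows "compact_operator (fun_op_conv f R)"
proof (rule compact_operatorI[OF fun_op_conv(1)[OF f R]])
  have ig: "integrable lborel g" using g by (simp add: wiener_class_def)
  let ?T = "fun_op_conv f R"
  obtain K where K: "K > 0" "\<And>x. norm (R x) \<le> K * norm x" using bounded_clinear_bound[OF R] by blast
  obtain L where L: "L > 0" "\<And>x. norm (?T x) \<le> L * norm x" using bounded_clinear_bound[OF fun_op_conv(1)[OF f R]] by blast
  fix X :: "nat \<Rightarrow> 'a L2" assume X: "weakly_null X"
  then obtain C where C: "C > 0" "\<And>n. norm (X n) \<le> C" using weakly_nullE by metis
  have TC: "norm (?T (X n)) \<le> L * C" for n
    using L(2)[of "X n"] mult_left_mono[OF C(2)[of n], of L] L(1) by linarith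
  define h where "h n z = cinner (op_shift z R (X n)) (?T (X n))" for n z
  have "corr h f 0 \<longlonglongrightarrow> 0"
  proof (rule wiener_tauberian_sequential[OF _ _ ig fourier_nonzero_wiener_class[OF g] _ f])
    show "h n \<in> borel_measurable borel" for n
      unfolding h_def by (rule borel_measurable_continuous_onI[OF continuous_on_cinner_op_shift[OF R]])
    show "cmod (h n z) \<le> K * C * (L * C)" for n z
    proof -
      have "cmod (h n z) \<le> K * norm (X n) * norm (?T (X n))" unfolding h_def by (rule cinner_op_shift_bound[of K R, OF K])
      also have "\<dots> \<le> K * C * (L * C)" using K(1) L(1) C TC by (intro mult_mono) auto
      finally show ?thesis .
    qed
    \<comment> \<open>At each translate the correlation with \<open>g\<close> is a coefficient of
      the compact operator applied to \<open>tf_adj w (X n)\<close>, which is again weakly null,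
      against vectors bounded by \<open>L * C\<close>.\<close>
    fix w
    have "(\<lambda>n. fun_op_conv g R (tf_adj w (X n))) \<longlonglongrightarrow> 0"
      by (rule compact_operator_weakly_null[OF cg weakly_null_tf_adj[OF X]])
    then have l0: "(\<lambda>n. norm (fun_op_conv g R (tf_adj w (X n))) * (L * C)) \<longlonglongrightarrow> 0"
      by (intro tendsto_mult_left_zero tendsto_norm_zero)
    have eq: "corr h g w n = cinner (fun_op_conv g R (tf_adj w (X n))) (tf_adj w (?T (X n)))" for n
      unfolding corr_def h_def by (rule cinner_fun_op_conv_shift[OF ig R])
    have "cmod (corr h g w n) \<le> norm (fun_op_conv g R (tf_adj w (X n))) * (L * C)" for n
      unfolding eq by (rule order_trans[OF norm_cinner_le mult_left_mono]) (use TC in simp_all)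
    then show "corr h g w \<longlonglongrightarrow> 0"
      by (intro Lim_null_comparison[OF _ l0]) simp
  qed
  moreover have "corr h f 0 = (\<lambda>n. complex_of_real ((norm (?T (X n)))\<^sup>2))"
    unfolding corr_def h_def by (rule ext) (simp add: fun_op_conv(2)[OF f R, symmetric] cinner_self)
  ultimately have "(\<lambda>n. complex_of_real ((norm (?T (X n)))\<^sup>2)) \<longlonglongrightarrow> 0" by simp
  from tendsto_Re[OF this] have "(\<lambda>n. (norm (?T (X n)))\<^sup>2) \<longlonglongrightarrow> 0" by (simp del: of_real_power)
  from tendsto_real_sqrt[OF this] have "(\<lambda>n. norm (?T (X n))) \<longlonglongrightarrow> 0" by simp
  then show "(\<lambda>n. ?T (X n)) \<longlonglongrightarrow> 0" by (rule tendsto_norm_zero_cancel)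
qed

lemma tendsto_at_infinityI_sequentially:
  fixes F :: "'b::real_normed_vector \<Rightarrow> 'c::metric_space"
  assumes "\<And>z. filterlim z at_infinity sequentially \<Longrightarrow> (\<lambda>n. F (z n)) \<longlonglongrightarrow> l"
  shows "(F \<longlongrightarrow> l) at_infinity"
proof (rule ccontr)
  assume "\<not> (F \<longlongrightarrow> l) at_infinity"
  then obtain e where e: "e > 0" "\<And>b. \<exists>x. norm x \<ge> b \<and> dist (F x) l \<ge> e"
    unfolding Lim_at_infinity by (auto simp: not_less)
  have "\<forall>n. \<exists>x. norm x \<ge> real n \<and> dist (F x) l \<ge> e" using e(2) by blast
  then obtain z where z: "\<And>n. norm (z n) \<ge> real n" "\<And>n. dist (F (z n)) l \<ge> e" by metis
  have "filterlim z at_infinity sequentially"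
    by (rule filterlim_norm_at_top_imp_at_infinity)
       (rule filterlim_at_top_mono[OF filterlim_real_sequentially], use z(1) in simp)
  from tendstoD[OF assms[OF this] e(1)] show False
    using z(2) by (auto simp: eventually_sequentially not_less[symmetric])
qed

lemma all_compact_imp_cohen_C0:
  fixes R :: "('a::euclidean_space) L2_op"
  assumes R: "bounded_clinear R" and comp: "\<And>f. integrable lborel f \<Longrightarrow> compact_operator (fun_op_conv f R)"
  shows "cohen R \<psi> \<in> C0"
proof -
  obtain K where K: "K > 0" "\<And>x. norm (R x) \<le> K * norm x" using bounded_clinear_bound[OF R] by blast
  let ?F = "cohen R \<psi>"
  \<comment> \<open>The right-hand side does not contain \<open>z\<close>: this is the uniform
    continuity. A translation by \<open>u\<close> moves both slots by \<open>tf_adj u\<close>, and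
    the difference is expanded one slot at a time.\<close>
  have F_diff: "cmod (?F (z + u) - ?F z) \<le> 2 * K * norm \<psi> * norm (tf_adj u \<psi> - \<psi>)" for z u
  proof -
    let ?a = "tf_adj u \<psi>" and ?S = "op_shift z R"
    have "?F (z + u) = cinner (?S ?a) ?a"
      unfolding cohen_eq[OF R] add.commute[of z u] by (rule cinner_op_shift_add[OF R])
    then have "?F (z + u) - ?F z = cinner (?S (?a - \<psi>)) ?a + cinner (?S \<psi>) (?a - \<psi>)"
      unfolding cohen_eq[OF R] by (simp add: bounded_clinear_imp(4)[OF bounded_clinear_op_shift[OF R]] cinner_diff_left cinner_diff_right)
    also have "cmod \<dots> \<le> K * norm (?a - \<psi>) * norm ?a + K * norm \<psi> * norm (?a - \<psi>)"
      by (intro order_trans[OF norm_triangle_ineq add_mono] cinner_op_shift_bound K)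
    finally show ?thesis by (simp add: mult_ac)
  qed
  have "(?F \<longlongrightarrow> 0) at_infinity"
  proof (rule tendsto_at_infinityI_sequentially)
    fix z :: "nat \<Rightarrow> 'a \<times> 'a" assume z: "filterlim z at_infinity sequentially"
    show "(\<lambda>n. ?F (z n)) \<longlonglongrightarrow> 0"
    proof (rule LIMSEQ_I)
      fix e :: real assume e: "e > 0"
      have "continuous_on UNIV (\<lambda>u. 2 * K * norm \<psi> * norm (tf_adj u \<psi> - \<psi>))" by (intro continuous_intros)
      then have "isCont (\<lambda>u. 2 * K * norm \<psi> * norm (tf_adj u \<psi> - \<psi>)) 0"
        using continuous_on_eq_continuous_at[OF open_UNIV] by blast
      then have "\<exists>d>0. \<forall>u. dist u 0 < d \<longrightarrow> dist (2 * K * norm \<psi> * norm (tf_adj u \<psi> - \<psi>)) (2 * K * norm \<psi> * norm (tf_adj 0 \<psi> - \<psi>)) < e / 2"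
        using e unfolding continuous_at_eps_delta by (metis half_gt_zero)
      moreover have "tf_adj 0 \<psi> = \<psi>" by (simp add: tf_adj_def tf_shift_0)
      ultimately obtain d where d: "d > 0" "\<And>u. norm u < d \<Longrightarrow> 2 * K * norm \<psi> * norm (tf_adj u \<psi> - \<psi>) < e / 2"
        using K(1) by (auto simp: dist_norm)
      define v where "v = measure lborel (ball (0::'a \<times> 'a) d)"
      have v: "v > 0" unfolding v_def using content_ball_pos[OF d(1), of "0::'a \<times> 'a"] by simp
      \<comment> \<open>Normalised to integral 1, so that correlating with \<open>f\<close> averages
        \<open>?F\<close> over the ball of radius \<open>d\<close> and changes it by at most
        \<open>e / 2\<close>.\<close>
      define f where "f u = complex_of_real (indicator (ball 0 d) u / v)" for u :: "'a \<times> 'a"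
      have iI: "integrable lborel (\<lambda>u::'a \<times> 'a. indicator (ball 0 d) u :: real)"
        using emeasure_bounded_finite[OF bounded_ball, of "0::'a \<times> 'a" d] by (intro integrable_real_indicator) simp_all
      have f: "integrable lborel f" unfolding f_def using iI by (intro integrable_of_real) simp
      have f1: "(LINT u|lborel. f u) = 1" "(LINT u|lborel. cmod (f u)) = 1"
        unfolding f_def using v by (simp_all add: v_def del: of_real_divide)
      let ?T = "fun_op_conv f R"
      \<comment> \<open>\<open>tf_adj (z n)\<close> is \<open>tf_shift (- z n)\<close> up to a phase
        that the modulus discards, so the compact operator meets a weakly null sequence.\<close>
      have lim: "(\<lambda>n. cinner (?T (tf_adj (z n) \<psi>)) (tf_adj (z n) \<psi>)) \<longlonglongrightarrow> 0"
      proof -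
        have "filterlim (\<lambda>n. - z n) at_infinity sequentially"
          using z by (simp add: filterlim_at_infinity[OF order_refl])
        from weakly_null_tf_shift_at_infinity[OF this, of \<psi>]
        have "(\<lambda>n. ?T (tf_shift (- z n) \<psi>)) \<longlonglongrightarrow> 0" by (rule compact_operator_weakly_null[OF comp[OF f]])
        then have l0: "(\<lambda>n. norm (?T (tf_shift (- z n) \<psi>)) * norm \<psi>) \<longlonglongrightarrow> 0"
          by (intro tendsto_mult_left_zero tendsto_norm_zero)
        have "cmod (cinner (?T (tf_adj (z n) \<psi>)) (tf_adj (z n) \<psi>)) \<le> norm (?T (tf_shift (- z n) \<psi>)) * norm \<psi>" for n
          using norm_cinner_le[of "?T (tf_adj (z n) \<psi>)" "tf_adj (z n) \<psi>"]
          by (simp add: tf_adj_def[of "z n"] bounded_clinear_imp(3)[OF fun_op_conv(1)[OF f R]] norm_scaleC cinner_scaleC_left cinner_scaleC_right norm_mult)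
        then show ?thesis by (intro Lim_null_comparison[OF _ l0]) simp
      qed
      have "eventually (\<lambda>n. norm (cinner (?T (tf_adj (z n) \<psi>)) (tf_adj (z n) \<psi>)) < e / 2) sequentially"
        by (rule order_tendstoD(2)[OF tendsto_norm_zero[OF lim]]) (use e in simp)
      then have "eventually (\<lambda>n. norm (?F (z n) - 0) < e) sequentially"
      proof eventually_elim
        case (elim n)
        have contF: "continuous_on UNIV (\<lambda>u. ?F (z n + u))"
          by (rule continuous_on_compose2[OF continuous_on_cohen[OF R]]) (auto intro: continuous_intros)
        have bF: "cmod (?F (z n + u)) \<le> K * norm \<psi> * norm \<psi>" for u
          unfolding cohen_eq[OF R] by (rule cinner_op_shift_bound[of K R, OF K])
        have i1: "integrable lborel (\<lambda>u. f u * ?F (z n + u))"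
          by (rule integrable_mult_continuous_bounded(1)[OF f contF bF])
        have T: "cinner (?T (tf_adj (z n) \<psi>)) (tf_adj (z n) \<psi>) = (LINT u|lborel. f u * ?F (z n + u))"
          unfolding cohen_eq[OF R] by (rule cinner_fun_op_conv_shift[OF f R, symmetric])
        have "cinner (?T (tf_adj (z n) \<psi>)) (tf_adj (z n) \<psi>) - ?F (z n) = (LINT u|lborel. f u * ?F (z n + u)) - (LINT u|lborel. f u * ?F (z n))"
          unfolding T by (simp add: f1)
        also have "\<dots> = (LINT u|lborel. f u * ?F (z n + u) - f u * ?F (z n))"
          by (rule Bochner_Integration.integral_diff[OF i1 integrable_mult_left[OF f], symmetric])
        finally have "cmod (cinner (?T (tf_adj (z n) \<psi>)) (tf_adj (z n) \<psi>) - ?F (z n)) \<le> (LINT u|lborel. norm (f u * ?F (z n + u) - f u * ?F (z n)))"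
          by (simp only: integral_norm_bound)
        also have "\<dots> \<le> (LINT u|lborel. cmod (f u) * (e / 2))"
        proof (rule integral_mono)
          show "integrable lborel (\<lambda>u. norm (f u * ?F (z n + u) - f u * ?F (z n)))"
            using i1 integrable_mult_left[OF f] by (intro integrable_norm Bochner_Integration.integrable_diff)
          show "integrable lborel (\<lambda>u. cmod (f u) * (e / 2))" using f by simp
          fix u
          show "norm (f u * ?F (z n + u) - f u * ?F (z n)) \<le> cmod (f u) * (e / 2)"
          proof (cases "norm u < d")
            case True
            have "cmod (?F (z n + u) - ?F (z n)) \<le> e / 2"
              using F_diff[of "z n" u] d(2)[OF True] by linarith
            then show ?thesis unfolding right_diff_distrib[symmetric] norm_mult by (rule mult_left_mono) simp
          qed (simp add: f_def)
        qed
        also have "\<dots> = e / 2" by (simp add: f1)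
        finally have "cmod (cinner (?T (tf_adj (z n) \<psi>)) (tf_adj (z n) \<psi>) - ?F (z n)) \<le> e / 2" .
        then show ?case
          using elim norm_triangle_ineq4[of "cinner (?T (tf_adj (z n) \<psi>)) (tf_adj (z n) \<psi>)" "cinner (?T (tf_adj (z n) \<psi>)) (tf_adj (z n) \<psi>) - ?F (z n)"] by simp
      qed
      then show "\<exists>N. \<forall>n\<ge>N. norm (?F (z n) - 0) < e" by (simp add: eventually_sequentially)
    qed
  qed
  then show ?thesis by (simp add: C0_def continuous_on_cohen[OF R])
qed

text \<open>A Gaussian times its translate is again a Gaussian, centred halfway, so the transform is
  a phase times a product of positive Gaussian values.\<close>

lemma stft_gauss_nonzero: "\<exists>\<phi>::('a::euclidean_space) L2. \<forall>z. stft \<phi> \<phi> z \<noteq> 0"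
proof -
  define G where "G t = complex_of_real (gauss 1 t)" for t :: 'a
  have G: "square_integrable G" unfolding G_def by (rule square_integrable_gauss)
  define \<phi> where "\<phi> = abs_L2 G"
  have "stft \<phi> \<phi> (x, \<omega>) \<noteq> 0" for x \<omega>
  proof -
    define E where "E = exp (- (pi * (norm x)\<^sup>2 / 2))"
    \<comment> \<open>Completing the square: the sum of the squared distances of \<open>t\<close> to
      0 and to \<open>x\<close> is expressed through the distance to the midpoint, hence the width
      factor \<open>sqrt 2\<close> and the constant \<open>E\<close>.\<close>
    have prod: "gauss 1 t * gauss 1 (t - x) = E * gauss (sqrt 2) (t - (1/2) *\<^sub>R x)" for t
    proof -
      have "(norm t)\<^sup>2 + (norm (t - x))\<^sup>2 = (norm x)\<^sup>2 / 2 + 2 * (norm (t - (1/2) *\<^sub>R x))\<^sup>2"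
        unfolding power2_norm_eq_inner by (simp add: inner_diff_left inner_diff_right inner_commute[of x t] field_simps)
      then have "- (pi * (norm t)\<^sup>2) + - (pi * (norm (t - x))\<^sup>2) = - (pi * (norm x)\<^sup>2 / 2) + - (pi * (2 * (norm (t - (1/2) *\<^sub>R x))\<^sup>2))"
        by (simp add: algebra_simps flip: distrib_left)
      then show ?thesis unfolding gauss_def E_def exp_add[symmetric] by (simp add: power_mult_distrib)
    qed
    have "stft \<phi> \<phi> (x, \<omega>) = (LINT t|lborel. G t * cnj (ee (\<omega> \<bullet> t) * G (t - x)))"
      unfolding stft_def \<phi>_def tf_shift_abs[OF G] by (rule cinner_abs[OF G square_integrable_tf[OF G]])
    also have "\<dots> = (LINT t|lborel. complex_of_real (gauss 1 t * gauss 1 (t - x)) * ee (- (\<omega> \<bullet> t)))"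
      by (simp add: G_def cnj_ee mult_ac)
    also have "\<dots> = (LINT t|lborel. complex_of_real E * ee (- (\<omega> \<bullet> (1/2) *\<^sub>R x)) * (ee ((- \<omega>) \<bullet> (t - (1/2) *\<^sub>R x)) * gauss (sqrt 2) (t - (1/2) *\<^sub>R x)))"
    proof (rule Bochner_Integration.integral_cong[OF refl])
      fix t
      have "ee (- (\<omega> \<bullet> t)) = ee (- (\<omega> \<bullet> (1/2) *\<^sub>R x)) * ee ((- \<omega>) \<bullet> (t - (1/2) *\<^sub>R x))"
        unfolding ee_add[symmetric] by (simp add: inner_diff_right)
      then show "complex_of_real (gauss 1 t * gauss 1 (t - x)) * ee (- (\<omega> \<bullet> t)) =
          complex_of_real E * ee (- (\<omega> \<bullet> (1/2) *\<^sub>R x)) * (ee ((- \<omega>) \<bullet> (t - (1/2) *\<^sub>R x)) * gauss (sqrt 2) (t - (1/2) *\<^sub>R x))"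
        unfolding prod of_real_mult by (simp only: mult_ac)
    qed
    also have "\<dots> = complex_of_real E * ee (- (\<omega> \<bullet> (1/2) *\<^sub>R x)) * (LINT t|lborel. ee ((- \<omega>) \<bullet> t) * gauss (sqrt 2) t)"
      unfolding integral_mult_right_zero
      using integral_translate(3)[of "\<lambda>t. ee ((- \<omega>) \<bullet> t) * gauss (sqrt 2) t" "(1/2) *\<^sub>R x"] by (simp only:)
    also have "(LINT t|lborel. ee ((- \<omega>) \<bullet> t) * gauss (sqrt 2) t) = complex_of_real (gauss (1 / sqrt 2) (- \<omega>) / sqrt 2 ^ DIM('a))"
      using has_bochner_integral_gauss_ee[of "sqrt 2" "- \<omega>"] by (simp add: has_bochner_integral_iff)
    finally have eq: "stft \<phi> \<phi> (x, \<omega>) = complex_of_real E * ee (- (\<omega> \<bullet> (1/2) *\<^sub>R x)) * complex_of_real (gauss (1 / sqrt 2) (- \<omega>) / sqrt 2 ^ DIM('a))" .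
    have "cmod (stft \<phi> \<phi> (x, \<omega>)) > 0"
      unfolding eq norm_mult using gauss_pos[of "1 / sqrt 2" "- \<omega>"] by (simp add: E_def)
    then show ?thesis by auto
  qed
  then show ?thesis by (intro exI[of _ \<phi>]) auto
qed

theorem proposition6p1:
  fixes R :: "(real ^ 'd) L2 \<Rightarrow> (real ^ 'd) L2"
  assumes "bounded_clinear R"
  shows "((\<exists>\<phi>. (\<forall>z. stft \<phi> \<phi> z \<noteq> 0) \<and> cohen R \<phi> \<in> C0)
            \<longleftrightarrow> (\<exists>g\<in>wiener_class. compact_operator (fun_op_conv g R))) \<and>
         ((\<exists>g\<in>wiener_class. compact_operator (fun_op_conv g R))
            \<longleftrightarrow> (\<forall>\<psi>. cohen R \<psi> \<in> C0)) \<and>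
         ((\<forall>\<psi>. cohen R \<psi> \<in> C0)
            \<longleftrightarrow> (\<forall>f. integrable lborel f \<longrightarrow> compact_operator (fun_op_conv f R)))"
proof -
  let ?i = "\<exists>\<phi>. (\<forall>z. stft \<phi> \<phi> z \<noteq> 0) \<and> cohen R \<phi> \<in> C0"
  let ?ii = "\<exists>g\<in>wiener_class. compact_operator (fun_op_conv g R)"
  let ?iii = "\<forall>\<psi>. cohen R \<psi> \<in> C0"
  let ?iv = "\<forall>f. integrable lborel f \<longrightarrow> compact_operator (fun_op_conv f R)"
  have "?i \<Longrightarrow> ?ii" using cohen_C0_imp_compact[OF assms] by blast
  moreover have "?ii \<Longrightarrow> ?iv" using wiener_class_compact_imp_all_compact[OF assms] by blast
  moreover have "?iv \<Longrightarrow> ?iii" using all_compact_imp_cohen_C0[OF assms] by blast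
  moreover have "?iii \<Longrightarrow> ?i" using stft_gauss_nonzero by blast
  ultimately show ?thesis by argo
qed

end
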